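(* The capacity region of the finite-alphabet cognitive MAC $P_{Y|X_1,X_2}$ with decoding metric $q(x_1,x_2,y)$ contains $$\mathcal R^{bin}_{cog}=\text{closure of the convex hull of }\bigcup_P\mathcal R^{bin,*}_{cog}(P),$$ the union over all distributions $P=P_{X_1,X_2}P_{Y|X_1,X_2}$ on $\mathcal X_1\times\mathcal X_2\times\mathcal Y$ with $P_{Y|X_1,X_2}$ the channel, where $\mathcal R^{bin,*}_{cog}(P)$ is the set of $(R_1,R_2)$ for which there exist $R_{1,a},R_{1,b}\ge0$ with $R_1=R_{1,a}+R_{1,b}$, $R_{1,a}\le R_1'(P)$, $R_{1,b}+R_2\le R_2'(P)$, and either $R_{1,a}\le R_1''(P,R_{1,b}+R_2)$ or $R_{1,b}+R_2\le R_2''(P,R_{1,a})$.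
   Context: Cognitive MAC with mismatched decoding: finite alphabets $\mathcal X_1,\mathcal X_2,\mathcal Y$, memoryless channel $P_{Y|X_1,X_2}$, metric $q$. A code of rates $(R_1,R_2)$: encoder 1 sends $\mathbf x_1(W_1)$, $W_1\le2^{nR_1}$; encoder 2 knows $(W_1,W_2)$, $W_2\le 2^{nR_2}$, and sends $\mathbf x_2(W_1,W_2)$; messages uniform. Decoder outputs $(i,j)$ iff $\sum_t q(x_{1,t}(i),x_{2,t}(i,j),y_t)$ strictly exceeds the sum for all other $(i',j')$, else error. Capacity region = closure of the set of pairs achievable with vanishing average error probability. For a distribution $Q$: $\mathcal G_q(Q)=\{f: f_{X_1,X_2}=Q_{X_1,X_2},\ \mathbb E_f q\ge\mathbb E_Q q\}$; $\mathcal L_1(Q)=\{f\in\mathcal G_q(Q):f_{X_2,Y}=Q_{X_2,Y}\}$; $\mathcal L_2(Q)=\{f\in\mathcal G_q(Q):f_{X_1,Y}=Q_{X_1,Y}\}$; $\mathcal L_0(Q)=\{f\in\mathcal G_q(Q):f_Y=Q_Y\}$. $R_1'(P)=\min_{\tilde P\in\mathcal L_1(P)}I_{\tilde P}(X_1;Y,X_2)$; $R_2'(P)=\min_{\tilde P\in\mathcal L_2(P)}I_{\tilde P}(X_2;Y|X_1)$; $R_1''(P,R_2)=\min_{\tilde P\in\mathcal L_0(P)}[I_{\tilde P}(X_1;Y)+|I_{\tilde P}(X_2;Y|X_1)-R_2|^+]$; $R_2''(P,R_1)=\min_{\tilde P\in\mathcal L_0(P)}[I_{\tilde P}(X_2;Y)-I_{\tilde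 P}(X_2;X_1)+|I_{\tilde P}(X_1;Y,X_2)-R_1|^+]$; $|t|^+=\max\{0,t\}$. *)

theory Defs
  imports "HOL-Analysis.Analysis"
begin

definition is_pmf :: "('w::finite \<Rightarrow> real) \<Rightarrow> bool" where
  "is_pmf f \<longleftrightarrow> (\<forall>w. 0 \<le> f w) \<and> (\<Sum>w\<in>UNIV. f w) = 1"

definition marg :: "('w::finite \<Rightarrow> real) \<Rightarrow> ('w \<Rightarrow> 'z) \<Rightarrow> 'z \<Rightarrow> real" where
  "marg f g z = (\<Sum>w\<in>{w. g w = z}. f w)"

definition mi :: "('u::finite \<times> 'v::finite \<Rightarrow> real) \<Rightarrow> real" where
  "mi p = (\<Sum>(u,v)\<in>UNIV.
      if p (u,v) = 0 then 0
      else p (u,v) * log 2 (p (u,v) / (marg p fst u * marg p snd v)))"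

definition cmi :: "('w::finite \<times> 'u::finite \<times> 'v::finite \<Rightarrow> real) \<Rightarrow> real" where
  "cmi p = (\<Sum>(w,u,v)\<in>UNIV.
      if p (w,u,v) = 0 then 0
      else p (w,u,v) * log 2 ((p (w,u,v) * marg p fst w) /
              (marg p (\<lambda>(w,u,v). (w,u)) (w,u) * marg p (\<lambda>(w,u,v). (w,v)) (w,v))))"

definition I_X1_YX2 :: "('a::finite \<times> 'b::finite \<times> 'c::finite \<Rightarrow> real) \<Rightarrow> real" where
  "I_X1_YX2 f = mi (\<lambda>(x1,(x2,y)). f (x1,x2,y))"

definition I_X2_Y_given_X1 :: "('a::finite \<times> 'b::finite \<times> 'c::finite \<Rightarrow> real) \<Rightarrow> real" where
  "I_X2_Y_given_X1 f = cmi f"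

definition I_X1_Y :: "('a::finite \<times> 'b::finite \<times> 'c::finite \<Rightarrow> real) \<Rightarrow> real" where
  "I_X1_Y f = mi (marg f (\<lambda>(x1,x2,y). (x1,y)))"

definition I_X2_Y :: "('a::finite \<times> 'b::finite \<times> 'c::finite \<Rightarrow> real) \<Rightarrow> real" where
  "I_X2_Y f = mi (marg f (\<lambda>(x1,x2,y). (x2,y)))"

definition I_X2_X1 :: "('a::finite \<times> 'b::finite \<times> 'c::finite \<Rightarrow> real) \<Rightarrow> real" where
  "I_X2_X1 f = mi (marg f (\<lambda>(x1,x2,y). (x2,x1)))"

definition Gq :: "('a::finite \<Rightarrow> 'b::finite \<Rightarrow> 'c::finite \<Rightarrow> real) \<Rightarrow> ('a \<times> 'b \<times> 'c \<Rightarrow> real)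
                   \<Rightarrow> ('a \<times> 'b \<times> 'c \<Rightarrow> real) set" where
  "Gq q Q = {f. is_pmf f
               \<and> marg f (\<lambda>(x1,x2,y). (x1,x2)) = marg Q (\<lambda>(x1,x2,y). (x1,x2))
               \<and> (\<Sum>(x1,x2,y)\<in>UNIV. f (x1,x2,y) * q x1 x2 y)
                   \<ge> (\<Sum>(x1,x2,y)\<in>UNIV. Q (x1,x2,y) * q x1 x2 y)}"

definition L1 where
  "L1 q Q = {f \<in> Gq q Q. marg f (\<lambda>(x1,x2,y). (x2,y)) = marg Q (\<lambda>(x1,x2,y). (x2,y))}"

definition L2 where
  "L2 q Q = {f \<in> Gq q Q. marg f (\<lambda>(x1,x2,y). (x1,y)) = marg Q (\<lambda>(x1,x2,y). (x1,y))}"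

definition L0 where
  "L0 q Q = {f \<in> Gq q Q. marg f (\<lambda>(x1,x2,y). y) = marg Q (\<lambda>(x1,x2,y). y)}"

text \<open>The minima in the paper are attained (continuous functions on nonempty compact sets);
  we write them as infima.\<close>

definition R1' where
  "R1' q P = (INF f\<in>L1 q P. I_X1_YX2 f)"

definition R2' where
  "R2' q P = (INF f\<in>L2 q P. I_X2_Y_given_X1 f)"

definition R1'' where
  "R1'' q P R2 = (INF f\<in>L0 q P. I_X1_Y f + max 0 (I_X2_Y_given_X1 f - R2))"

definition R2'' where
  "R2'' q P R1 = (INF f\<in>L0 q P. I_X2_Y f - I_X2_X1 f + max 0 (I_X1_YX2 f - R1))"

definition Rbin_star :: "('a::finite \<Rightarrow> 'b::finite \<Rightarrow> 'c::finite \<Rightarrow> real) \<Rightarrow> ('a \<times> 'b \<times> 'c \<Rightarrow> real)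
                         \<Rightarrow> (real \<times> real) set" where
  "Rbin_star q P = {(R1, R2). R2 \<ge> 0 \<and>
      (\<exists>R1a R1b. R1a \<ge> 0 \<and> R1b \<ge> 0 \<and> R1 = R1a + R1b
         \<and> R1a \<le> R1' q P
         \<and> R1b + R2 \<le> R2' q P
         \<and> (R1a \<le> R1'' q P (R1b + R2) \<or> R1b + R2 \<le> R2'' q P R1a))}"

definition channel_dists :: "('a::finite \<Rightarrow> 'b::finite \<Rightarrow> 'c::finite \<Rightarrow> real) \<Rightarrow> ('a \<times> 'b \<times> 'c \<Rightarrow> real) set" where
  "channel_dists W = {P. \<exists>PX. is_pmf PX \<and> P = (\<lambda>(x1,x2,y). PX (x1,x2) * W x1 x2 y)}"

definition Rbin_cog where
  "Rbin_cog W q = closure (convex hull (\<Union>P\<in>channel_dists W. Rbin_star q P))"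

text \<open>Number of messages at block length n and rate R: messages are 0..<num_msgs n R,
  i.e. W \<le> 2^{nR} after shifting to 1-based indexing.\<close>
definition num_msgs :: "nat \<Rightarrow> real \<Rightarrow> nat" where
  "num_msgs n R = nat \<lfloor>2 powr (real n * R)\<rfloor>"

definition score :: "('a \<Rightarrow> 'b \<Rightarrow> 'c \<Rightarrow> real) \<Rightarrow> nat \<Rightarrow> (nat \<Rightarrow> nat \<Rightarrow> 'a)
                      \<Rightarrow> (nat \<Rightarrow> nat \<Rightarrow> nat \<Rightarrow> 'b) \<Rightarrow> nat \<Rightarrow> nat \<Rightarrow> (nat \<Rightarrow> 'c) \<Rightarrow> real" where
  "score q n x1 x2 i j y = (\<Sum>t<n. q (x1 i t) (x2 i j t) (y t))"

text \<open>The decoder outputs (i,j) iff its score strictly exceeds that of every other pair;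
  otherwise (in particular on ties) an error is declared.\<close>
definition decodes_correctly where
  "decodes_correctly q n M1 M2 x1 x2 i j y \<longleftrightarrow>
     (\<forall>i'<M1. \<forall>j'<M2. (i',j') \<noteq> (i,j) \<longrightarrow> score q n x1 x2 i j y > score q n x1 x2 i' j' y)"

definition err_prob :: "('a::finite \<Rightarrow> 'b::finite \<Rightarrow> 'c::finite \<Rightarrow> real) \<Rightarrow> ('a \<Rightarrow> 'b \<Rightarrow> 'c \<Rightarrow> real)
        \<Rightarrow> nat \<Rightarrow> nat \<Rightarrow> nat \<Rightarrow> (nat \<Rightarrow> nat \<Rightarrow> 'a) \<Rightarrow> (nat \<Rightarrow> nat \<Rightarrow> nat \<Rightarrow> 'b) \<Rightarrow> nat \<Rightarrow> nat \<Rightarrow> real" where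
  "err_prob W q n M1 M2 x1 x2 i j =
     (\<Sum>y\<in>PiE {..<n} (\<lambda>_. UNIV).
        if decodes_correctly q n M1 M2 x1 x2 i j y then 0
        else (\<Prod>t<n. W (x1 i t) (x2 i j t) (y t)))"

definition avg_err where
  "avg_err W q n M1 M2 x1 x2 =
     (\<Sum>i<M1. \<Sum>j<M2. err_prob W q n M1 M2 x1 x2 i j) / (real M1 * real M2)"

definition achievable :: "('a::finite \<Rightarrow> 'b::finite \<Rightarrow> 'c::finite \<Rightarrow> real) \<Rightarrow> ('a \<Rightarrow> 'b \<Rightarrow> 'c \<Rightarrow> real)
                            \<Rightarrow> real \<times> real \<Rightarrow> bool" where
  "achievable W q R \<longleftrightarrow> fst R \<ge> 0 \<and> snd R \<ge> 0 \<and>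
     (\<exists>(x1 :: nat \<Rightarrow> nat \<Rightarrow> nat \<Rightarrow> 'a) (x2 :: nat \<Rightarrow> nat \<Rightarrow> nat \<Rightarrow> nat \<Rightarrow> 'b).
        (\<lambda>n. avg_err W q n (num_msgs n (fst R)) (num_msgs n (snd R)) (x1 n) (x2 n))
          \<longlonglongrightarrow> 0)"

definition capacity_region where
  "capacity_region W q = closure {R. achievable W q R}"

definition is_channel :: "('a::finite \<Rightarrow> 'b::finite \<Rightarrow> 'c::finite \<Rightarrow> real) \<Rightarrow> bool" where
  "is_channel W \<longleftrightarrow> (\<forall>x1 x2 y. 0 \<le> W x1 x2 y) \<and> (\<forall>x1 x2. (\<Sum>y\<in>UNIV. W x1 x2 y) = 1)"

end

theory Submission
  imports Defs "HOL-Real_Asymp.Real_Asymp"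
begin

text \<open>
  Draw independent codewords \<open>x\<^sub>1(i)\<close> and \<open>x\<^sub>2(m)\<close> from the marginals of the input law, and
  use only jointly typical pairs. A message pair \<open>(i, j)\<close> is sent with some codeword \<open>m\<close> of
  bin \<open>j\<close> that is jointly typical with \<open>x\<^sub>1(i)\<close>; bins of about \<open>2 powr (n I(X\<^sub>1;X\<^sub>2))\<close> words suffice for
  every pair to be served. Summing over all jointly typical \<open>(i, m)\<close> instead of the selected
  one costs only a subexponential factor, so the selection rule plays no role and the union bound involves nothing but
  independent codewords. For those, an empirical mutual information of at least \<open>c\<close> has
  probability at most \<open>poly(n) 2 powr (- n c)\<close>, and compactness of the simplex turns the strict inequalities over the
  sets \<open>L0\<close>, \<open>L1\<close>, \<open>L2\<close> into a uniform exponential margin. Convex combinations come from time sharing.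
  The boundary case \<open>R1b + R2 = 0\<close>, where no rate can be given up by the second user, is handled by using slightly
  fewer than \<open>2 powr (n I(X\<^sub>1;X\<^sub>2))\<close> codewords \<open>x\<^sub>2\<close> and giving up rate of the first user instead.
\<close>

subsection \<open>Empirical distributions and entropy\<close>

text \<open>The second codeword is picked inside a bin after inspecting \<open>x\<^sub>1(i)\<close>,
  so a transmitted pair does not follow the product law; this dependence is the obstacle. The error
  of a fixed index pair is therefore computed together with the indicator of joint typicality. With
  I = I(X1;X2) and C a norm of the information density, passing to the joint law gives a factor
  2^(-n(I - \<eta> C)), while a bin holds about n^2 2^(n(I + \<eta> C)) words. Summation over a bin
  leaves the excess n^2 2^(2 n \<eta> C), so \<eta> is chosen small against the exponential margin
  \<theta>. The factor n^2 makes the chance of an unserved pair about exp(-n^2), which beats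
  exponentially many message pairs.

  The second codebook has rate close to r2 + I, where r2 = R1b + R2. Every competing law has the
  same input marginal, hence the same I, and I(X2;Y|X1) + I = I(X2;X1,Y). The positive parts in the
  region then become a choice between union bounds for competitors that are wrong in both indices:
  over pairs, over second codewords alone, or over first codewords alone.\<close>

definition seqs :: "nat \<Rightarrow> (nat \<Rightarrow> 'w) set" where
  "seqs n = PiE {..<n} (\<lambda>_. UNIV)"

definition iid :: "('w \<Rightarrow> real) \<Rightarrow> nat \<Rightarrow> (nat \<Rightarrow> 'w) \<Rightarrow> real" where
  "iid p n x = (\<Prod>t<n. p (x t))"

text \<open>For \<open>n = 0\<close> the division gives the zero function, which is not a law; hence
  the premise \<open>n > 0\<close> in what follows.\<close>

definition emp :: "nat \<Rightarrow> (nat \<Rightarrow> 'w) \<Rightarrow> 'w \<Rightarrow> real" where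
  "emp n x w = real (card {t. t < n \<and> x t = w}) / real n"

text \<open>The convention 0 log 0 = 0 is built in, since the factor \<open>p w\<close>
  vanishes.\<close>

definition ent :: "('w::finite \<Rightarrow> real) \<Rightarrow> real" where
  "ent p = - (\<Sum>w\<in>UNIV. p w * log 2 (p w))"

lemma finite_seqs [simp]: "finite (seqs n :: (nat \<Rightarrow> 'w::finite) set)"
  unfolding seqs_def by (intro finite_PiE) auto

lemma sum_emp:
  fixes x :: "nat \<Rightarrow> 'w::finite" and F :: "'w \<Rightarrow> real"
  assumes "n > 0"
  shows "(\<Sum>w\<in>UNIV. emp n x w * F w) * real n = (\<Sum>t<n. F (x t))"
proof -
  have "(\<Sum>t<n. F (x t)) = (\<Sum>w\<in>UNIV. \<Sum>t\<in>{t\<in>{..<n}. x t = w}. F (x t))"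
    by (rule sum.group[symmetric]) auto
  also have "\<dots> = (\<Sum>w\<in>UNIV. real (card {t. t < n \<and> x t = w}) * F w)"
    by (intro sum.cong refl) simp
  also have "\<dots> = (\<Sum>w\<in>UNIV. emp n x w * F w) * real n"
    unfolding sum_distrib_right emp_def using assms by (intro sum.cong) auto
  finally show ?thesis by simp
qed

lemma emp_nonneg [simp]: "emp n x w \<ge> 0"
  by (simp add: emp_def)

lemma emp_pos: "t < n \<Longrightarrow> emp n x (x t) > 0"
  unfolding emp_def by (intro divide_pos_pos) (auto simp: card_gt_0_iff)

lemma is_pmf_emp:
  fixes x :: "nat \<Rightarrow> 'w::finite"
  assumes "n > 0" shows "is_pmf (emp n x)"
  using sum_emp[OF assms, of x "\<lambda>_. 1"] assms by (simp add: is_pmf_def)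

lemma marg_emp:
  fixes x :: "nat \<Rightarrow> 'w::finite"
  shows "marg (emp n x) g = emp n (\<lambda>t. g (x t))"
proof
  fix z
  have "real (card {t. t < n \<and> g (x t) = z}) = (\<Sum>t\<in>{t. t < n \<and> g (x t) = z}. 1)"
    by simp
  also have "\<dots> = (\<Sum>w\<in>{w. g w = z}. \<Sum>t\<in>{t\<in>{t. t < n \<and> g (x t) = z}. x t = w}. 1)"
    by (rule sum.group[symmetric]) auto
  also have "\<dots> = (\<Sum>w\<in>{w. g w = z}. real (card {t. t < n \<and> x t = w}))"
    by (intro sum.cong refl) (auto intro!: arg_cong[of _ _ card])
  finally show "marg (emp n x) g z = emp n (\<lambda>t. g (x t)) z"
    by (simp add: marg_def emp_def sum_divide_distrib)
qed

lemma emp_cong: "(\<And>t. t < n \<Longrightarrow> x t = y t) \<Longrightarrow> emp n x = emp n y"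
  by (auto simp: emp_def fun_eq_iff intro!: arg_cong[of _ _ card])

lemma iid_cong: "(\<And>t. t < n \<Longrightarrow> x t = y t) \<Longrightarrow> iid p n x = iid p n y"
  by (auto simp: iid_def intro!: prod.cong)

lemma ent_emp:
  fixes x :: "nat \<Rightarrow> 'w::finite"
  assumes "n > 0"
  shows "real n * ent (emp n x) = - (\<Sum>t<n. log 2 (emp n x (x t)))"
  using sum_emp[OF assms, of x "\<lambda>w. log 2 (emp n x w)"] by (simp add: ent_def mult.commute)

lemma powr_ent_emp:
  fixes x :: "nat \<Rightarrow> 'w::finite"
  assumes "n > 0"
  shows "2 powr (- (real n * ent (emp n x))) = (\<Prod>t<n. emp n x (x t))"
proof -
  have "2 powr (\<Sum>t<n. log 2 (emp n x (x t))) = (\<Prod>t<n. 2 powr (log 2 (emp n x (x t))))"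
    by (subst powr_sum) auto
  also have "\<dots> = (\<Prod>t<n. emp n x (x t))"
    by (intro prod.cong refl powr_log_cancel) (auto simp: emp_pos)
  finally show ?thesis by (simp add: ent_emp[OF assms])
qed

lemma ent_emp_inj:
  fixes x :: "nat \<Rightarrow> 'w::finite" and g :: "'w \<Rightarrow> 'v::finite"
  assumes "n > 0" "inj g"
  shows "ent (emp n (\<lambda>t. g (x t))) = ent (emp n x)"
proof -
  have "emp n (\<lambda>t. g (x t)) (g (x s)) = emp n x (x s)" for s
    using assms(2) by (simp add: emp_def inj_eq)
  then have "real n * ent (emp n (\<lambda>t. g (x t))) = real n * ent (emp n x)"
    by (simp add: ent_emp assms(1))
  then show ?thesis using assms(1) by simp
qed

section \<open>Likelihoods under product laws and counting by empirical laws\<close>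

lemma iid_nonneg: "(\<And>w. 0 \<le> p w) \<Longrightarrow> 0 \<le> iid p n x"
  unfolding iid_def by (intro prod_nonneg) auto

lemma iid_sum:
  fixes p :: "'w::finite \<Rightarrow> real"
  shows "(\<Sum>x\<in>seqs n. iid p n x) = (\<Sum>w\<in>UNIV. p w) ^ n"
  unfolding iid_def seqs_def by (subst prod_sum_PiE[symmetric]) auto

lemma iid_sum_pmf: "is_pmf p \<Longrightarrow> (\<Sum>x\<in>seqs n. iid p n x) = 1"
  by (simp add: iid_sum is_pmf_def)

text \<open>Among all product laws the empirical law itself maximises the likelihood of
  \<open>x\<close>, and the right side is that maximum. This is Gibbs' inequality, obtained by
  applying r <= exp (r - 1) to the ratios of \<open>p\<close> to the empirical law.\<close>

lemma iid_le_powr_ent: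
  fixes x :: "nat \<Rightarrow> 'w::finite"
  assumes "is_pmf p" "n > 0"
  shows "iid p n x \<le> 2 powr (- (real n * ent (emp n x)))"
proof -
  have p: "p w \<ge> 0" "(\<Sum>w\<in>UNIV. p w) = 1" for w
    using assms(1) by (auto simp: is_pmf_def)
  define r where "r w = p w / emp n x w" for w
  have "(\<Prod>t<n. r (x t)) \<le> (\<Prod>t<n. exp (r (x t) - 1))"
    using exp_ge_add_one_self[of "r _ - 1"] p
    by (intro prod_mono) (auto simp: r_def)
  also have "\<dots> = exp ((\<Sum>t<n. r (x t)) - real n)"
    by (subst exp_sum[symmetric]) (auto simp: sum_subtractf)
  also have "(\<Sum>t<n. r (x t)) = (\<Sum>w\<in>UNIV. emp n x w * r w) * real n"
    using sum_emp[OF assms(2)] by metis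
  \<comment> \<open>Only an inequality: letters absent from \<open>x\<close> contribute 0 on the
    left and \<open>p w\<close> on the right.\<close>
  also have "\<dots> \<le> (\<Sum>w\<in>UNIV. p w) * real n"
    using p by (intro mult_right_mono sum_mono) (auto simp: r_def)
  finally have 1: "(\<Prod>t<n. r (x t)) \<le> 1" using p by simp
  have "iid p n x = (\<Prod>t<n. r (x t)) * (\<Prod>t<n. emp n x (x t))"
    unfolding iid_def prod.distrib[symmetric] using emp_pos[of _ n x]
    by (intro prod.cong refl) (auto simp: r_def less_imp_neq[OF emp_pos, symmetric])
  also have "\<dots> \<le> 1 * (\<Prod>t<n. emp n x (x t))"
    using 1 by (intro mult_right_mono prod_nonneg) auto
  finally show ?thesis by (simp only: powr_ent_emp[OF assms(2)] mult_1)
qed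

text \<open>Universal coding: every conditional empirical distribution is one of polynomially many
  conditional laws, and under its own law a sequence has probability exactly
  \<open>2 powr (- n H(x|z))\<close>.\<close>

lemma sum_powr_cond_ent_le:
  fixes z :: "nat \<Rightarrow> 'z::finite"
  assumes "n > 0"
  shows "(\<Sum>x\<in>(seqs n :: (nat \<Rightarrow> 'x::finite) set).
       2 powr (- (real n * (ent (emp n (\<lambda>t. (x t, z t))) - ent (emp n z)))))
     \<le> real (n + 1) ^ CARD('x \<times> 'z)"
proof -
  let ?u = "\<lambda>x :: nat \<Rightarrow> 'x. 2 powr (- (real n * (ent (emp n (\<lambda>t. (x t, z t))) - ent (emp n z))))"
  \<comment> \<open>\<open>T\<close> contains all functions with values in {0, 1/n, ..., 1}, not
    only laws; polynomial cardinality is all that matters.\<close>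
  define T :: "('x \<times> 'z \<Rightarrow> real) set"
    where "T = (\<lambda>c w. real (c w) / real n) ` PiE UNIV (\<lambda>_. {..n})"
  have finT: "finite T" unfolding T_def by (intro finite_imageI finite_PiE) auto
  have "card T \<le> card (PiE (UNIV :: ('x \<times> 'z) set) (\<lambda>_. {..n}))"
    unfolding T_def by (intro card_image_le finite_PiE) auto
  also have "\<dots> = (n + 1) ^ CARD('x \<times> 'z)" by (subst card_PiE) auto
  finally have cardT: "card T \<le> (n + 1) ^ CARD('x \<times> 'z)" .
  have memT: "emp n (\<lambda>t. (x t, z t)) \<in> T" for x
  proof -
    have "(\<lambda>w. card {t. t < n \<and> (x t, z t) = w}) \<in> PiE UNIV (\<lambda>_. {..n})"
    proof (rule PiE_I)
      fix w :: "'x \<times> 'z"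
      show "card {t. t < n \<and> (x t, z t) = w} \<in> {..n}"
        using card_mono[of "{..<n}" "{t. t < n \<and> (x t, z t) = w}"] by auto
    qed simp
    then show ?thesis unfolding T_def emp_def[abs_def] by (rule image_eqI[rotated]) simp
  qed
  \<comment> \<open>The conditional law of the first component given the second. Where the
    denominator is 0 the row is 0, so rows sum to at most 1, which suffices.\<close>
  define V where "V f a b = f (a, b) / (\<Sum>a'\<in>UNIV. f (a', b))" for f :: "'x \<times> 'z \<Rightarrow> real" and a b
  have T0: "f \<in> T \<Longrightarrow> f w \<ge> 0" for f w by (auto simp: T_def)
  then have V0: "f \<in> T \<Longrightarrow> V f a b \<ge> 0" for f a b
    by (auto simp: V_def intro!: divide_nonneg_nonneg sum_nonneg)
  have V1: "(\<Sum>a\<in>UNIV. V f a b) \<le> 1" if "f \<in> T" for f b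
    unfolding V_def sum_divide_distrib[symmetric] by simp
  have eq: "?u x
      = (\<Prod>t<n. V (emp n (\<lambda>t. (x t, z t))) (x t) (z t))" for x
  proof -
    have m: "(\<Sum>a'\<in>UNIV. emp n (\<lambda>t. (x t, z t)) (a', b)) = emp n z b" for b
    proof -
      have "(\<Sum>a'\<in>UNIV. emp n (\<lambda>t. (x t, z t)) (a', b)) = marg (emp n (\<lambda>t. (x t, z t))) snd b"
        unfolding marg_def
        by (rule sum.reindex_bij_witness[of _ fst "\<lambda>a. (a, b)"]) auto
      then show ?thesis by (simp add: marg_emp)
    qed
    have "?u x =
        2 powr (- (real n * ent (emp n (\<lambda>t. (x t, z t))))) / 2 powr (- (real n * ent (emp n z)))"
      by (simp add: powr_diff[symmetric] algebra_simps)
    also have "\<dots> = (\<Prod>t<n. emp n (\<lambda>t. (x t, z t)) (x t, z t)) / (\<Prod>t<n. emp n z (z t))"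
      by (simp only: powr_ent_emp[OF assms])
    also have "\<dots> = (\<Prod>t<n. V (emp n (\<lambda>t. (x t, z t))) (x t) (z t))"
      by (simp add: V_def m prod_dividef)
    finally show ?thesis .
  qed
  \<comment> \<open>The term of \<open>x\<close> is the one for its own empirical law. Adding the
    terms of all other laws in \<open>T\<close> removes the dependence of the law on
    \<open>x\<close>, so that the sum over \<open>x\<close> factorises over time.\<close>
  have "(\<Sum>x\<in>(seqs n :: (nat \<Rightarrow> 'x) set). ?u x)
      \<le> (\<Sum>x\<in>seqs n. \<Sum>f\<in>T. \<Prod>t<n. V f (x t) (z t))"
  proof (rule sum_mono)
    fix x :: "nat \<Rightarrow> 'x"
    show "?u x
        \<le> (\<Sum>f\<in>T. \<Prod>t<n. V f (x t) (z t))"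
      unfolding eq using V0
      by (intro member_le_sum[OF memT _ finT] prod_nonneg) auto
  qed
  also have "\<dots> = (\<Sum>f\<in>T. \<Sum>x\<in>seqs n. \<Prod>t<n. V f (x t) (z t))" by (rule sum.swap)
  also have "\<dots> = (\<Sum>f\<in>T. \<Prod>t<n. \<Sum>a\<in>UNIV. V f a (z t))"
    unfolding seqs_def by (intro sum.cong refl prod_sum_PiE[symmetric]) auto
  also have "\<dots> \<le> (\<Sum>f\<in>T. 1)"
    using V0 V1 by (intro sum_mono prod_le_1) (auto intro: sum_nonneg)
  also have "\<dots> \<le> real ((n + 1) ^ CARD('x \<times> 'z))"
    using of_nat_mono[OF cardT, where ?'a = real] by simp
  finally show ?thesis by simp
qed

text \<open>On \<open>E\<close> the likelihood bound 2^(-n H(x)) is at most 2^(-n H(x|z)) 2^(-n c),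
  and the sum of 2^(-n H(x|z)) over all x is polynomial. The sequence \<open>z\<close> is arbitrary
  and carries no law, so it may be any combination of true codewords and channel output.\<close>

lemma prob_empirical_mi_ge:
  fixes z :: "nat \<Rightarrow> 'z::finite" and p :: "'x::finite \<Rightarrow> real"
  assumes "n > 0" "is_pmf p"
    and E: "\<And>x. x \<in> E \<Longrightarrow> x \<in> seqs n \<and> ent (emp n x) + ent (emp n z) - ent (emp n (\<lambda>t. (x t, z t))) \<ge> c"
  shows "(\<Sum>x\<in>E. iid p n x) \<le> real (n + 1) ^ CARD('x \<times> 'z) * 2 powr (- (real n * c))"
proof -
  let ?u = "\<lambda>x :: nat \<Rightarrow> 'x. 2 powr (- (real n * (ent (emp n (\<lambda>t. (x t, z t))) - ent (emp n z))))"
  have "(\<Sum>x\<in>E. iid p n x) \<le> (\<Sum>x\<in>E. ?u x * 2 powr (- (real n * c)))"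
  proof (rule sum_mono)
    fix x assume "x \<in> E"
    have "iid p n x \<le> 2 powr (- (real n * ent (emp n x)))"
      by (rule iid_le_powr_ent) (use assms in auto)
    also have "\<dots> \<le> ?u x * 2 powr (- (real n * c))"
    proof -
      have "real n * c \<le> real n * (ent (emp n x) + ent (emp n z) - ent (emp n (\<lambda>t. (x t, z t))))"
        using E[OF \<open>x \<in> E\<close>] by (intro mult_left_mono) auto
      then have "- (real n * ent (emp n x)) \<le>
          - (real n * (ent (emp n (\<lambda>t. (x t, z t))) - ent (emp n z))) + - (real n * c)"
        by (simp add: algebra_simps)
      then show ?thesis by (simp only: powr_add[symmetric]) simp
    qed
    finally show "iid p n x \<le> ?u x * 2 powr (- (real n * c))" .
  qed
  also have "\<dots> \<le> (\<Sum>x\<in>seqs n. ?u x * 2 powr (- (real n * c)))"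
    by (rule sum_mono2) (use E in auto)
  also have "\<dots> = (\<Sum>x\<in>seqs n. ?u x) * 2 powr (- (real n * c))"
    by (simp add: sum_distrib_right)
  also have "\<dots> \<le> real (n + 1) ^ CARD('x \<times> 'z) * 2 powr (- (real n * c))"
    by (intro mult_right_mono sum_powr_cond_ent_le assms) auto
  finally show ?thesis .
qed

subsection \<open>Concentration, marginals and continuity of entropy\<close>

lemma exp_le_quadratic:
  fixes v :: real
  assumes "\<bar>v\<bar> \<le> 1"
  shows "exp v \<le> 1 + v + v\<^sup>2"
proof (cases "v \<ge> 0")
  case True
  then show ?thesis using exp_bound[of v] assms by simp
next
  case False
  define u where "u = - v"
  have u: "0 < u" "u \<le> 1" using False assms by (auto simp: u_def)
  have "exp v = 1 / exp u" by (simp add: u_def exp_minus inverse_eq_divide)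
  also have "\<dots> \<le> 1 / (1 + u)"
    using u exp_ge_add_one_self[of u] by (intro divide_left_mono mult_pos_pos) auto
  also have "\<dots> \<le> 1 - u + u\<^sup>2"
  proof -
    have "(1 - u + u\<^sup>2) * (1 + u) = 1 + u ^ 3"
      by (simp add: algebra_simps power2_eq_square power3_eq_cube)
    then show ?thesis using u by (simp add: divide_le_eq)
  qed
  finally show ?thesis by (simp add: u_def)
qed

text \<open>The exponential moment method for the frequency of the letter \<open>w\<close>; the sign
  \<open>s\<close> selects the upper or the lower tail.\<close>

lemma chernoff_one_sided:
  fixes p :: "'w::finite \<Rightarrow> real"
  assumes p: "is_pmf p" and "n > 0" "0 < \<eta>" "\<eta> \<le> 1" and s: "\<bar>s\<bar> = 1"
  shows "(\<Sum>x\<in>{x \<in> seqs n. \<eta> \<le> s * (emp n x w - p w)}. iid p n x) \<le> exp (- (real n * \<eta>\<^sup>2 / 4))"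
proof -
  have p0: "p a \<ge> 0" and p1: "(\<Sum>a\<in>UNIV. p a) = 1" for a using p by (auto simp: is_pmf_def)
  have pw1: "p w \<le> 1" using member_le_sum[of w UNIV p] p0 p1 by simp
  let ?E = "{x \<in> seqs n. \<eta> \<le> s * (emp n x w - p w)}"
  \<comment> \<open>The minimiser of l^2 - l \<eta>, with value - \<eta>^2 / 4. The premise
    \<open>\<eta> \<le> 1\<close> keeps the tilted exponents in the range of
    \<open>exp_le_quadratic\<close>.\<close>
  define l where "l = \<eta> / 2"
  define v where "v a = s * l * ((if a = w then 1 else 0) - p w)" for a
  have l: "0 < l" "l \<le> 1" using assms by (auto simp: l_def)
  have absv: "\<bar>v a\<bar> \<le> l" for a
  proof -
    have "\<bar>(if a = w then 1 else 0) - p w\<bar> \<le> 1" using p0[of w] pw1 by auto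
    then have "l * \<bar>(if a = w then 1 else 0) - p w\<bar> \<le> l * 1" using l by (intro mult_left_mono) auto
    then show ?thesis using l s by (simp add: v_def abs_mult)
  qed
  have vs: "(\<Sum>a\<in>UNIV. p a * v a) = 0"
  proof -
    have "(\<Sum>a\<in>UNIV. p a * v a) = s * l * ((\<Sum>a\<in>UNIV. if a = w then p a else 0) - (\<Sum>a\<in>UNIV. p a) * p w)"
      unfolding sum_distrib_right sum_subtractf[symmetric] sum_distrib_left
      by (intro sum.cong refl) (auto simp: v_def algebra_simps)
    also have "(\<Sum>a\<in>UNIV. if a = w then p a else 0) = p w" by simp
    finally show ?thesis using p1 by simp
  qed
  have mgf: "(\<Sum>a\<in>UNIV. p a * exp (v a)) \<le> exp (l\<^sup>2)"
  proof -
    have "p a * exp (v a) \<le> p a + p a * v a + p a * l\<^sup>2" for a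
    proof -
      have "exp (v a) \<le> 1 + v a + (v a)\<^sup>2" using absv[of a] l by (intro exp_le_quadratic) auto
      also have "(v a)\<^sup>2 \<le> l\<^sup>2" using absv[of a] l by (simp add: abs_le_square_iff[symmetric])
      finally have "p a * exp (v a) \<le> p a * (1 + v a + l\<^sup>2)" using p0 by (intro mult_left_mono) auto
      then show ?thesis by (simp add: algebra_simps)
    qed
    then have "(\<Sum>a\<in>UNIV. p a * exp (v a)) \<le> (\<Sum>a\<in>UNIV. p a + p a * v a + p a * l\<^sup>2)"
      by (intro sum_mono)
    also have "\<dots> = 1 + l\<^sup>2"
      by (simp add: sum.distrib vs p1 flip: sum_distrib_right)
    also have "\<dots> \<le> exp (l\<^sup>2)" by (rule exp_ge_add_one_self)
    finally show ?thesis .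
  qed
  have "(\<Sum>x\<in>?E. iid p n x)
     \<le> (\<Sum>x\<in>?E. iid p n x * (\<Prod>t<n. exp (v (x t))) * exp (- (real n * l * \<eta>)))"
  proof (rule sum_mono)
    fix x assume "x \<in> ?E"
    then have h: "\<eta> \<le> s * (emp n x w - p w)" by simp
    have "(\<Sum>t<n. v (x t)) = real n * l * (s * (emp n x w - p w))"
    proof -
      have "(\<Sum>t<n. v (x t)) = (\<Sum>a\<in>UNIV. emp n x a * v a) * real n"
        using sum_emp[OF \<open>n > 0\<close>] by metis
      also have "(\<Sum>a\<in>UNIV. emp n x a * v a) =
          s * l * ((\<Sum>a\<in>UNIV. if a = w then emp n x a else 0) - (\<Sum>a\<in>UNIV. emp n x a) * p w)"
        unfolding sum_distrib_right sum_subtractf[symmetric] sum_distrib_left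
        by (intro sum.cong refl) (auto simp: v_def algebra_simps)
      also have "(\<Sum>a\<in>UNIV. emp n x a) = 1" using is_pmf_emp[OF \<open>n > 0\<close>, of x] by (simp add: is_pmf_def)
      finally show ?thesis by simp
    qed
    also have "\<dots> \<ge> real n * l * \<eta>" using h l by (intro mult_left_mono) auto
    finally have "1 \<le> exp ((\<Sum>t<n. v (x t)) - real n * l * \<eta>)" by simp
    also have "\<dots> = (\<Prod>t<n. exp (v (x t))) * exp (- (real n * l * \<eta>))"
      by (simp add: exp_diff exp_sum exp_minus divide_inverse)
    finally have "iid p n x * 1 \<le> iid p n x * ((\<Prod>t<n. exp (v (x t))) * exp (- (real n * l * \<eta>)))"
      by (intro mult_left_mono iid_nonneg p0)
    then show "iid p n x \<le> iid p n x * (\<Prod>t<n. exp (v (x t))) * exp (- (real n * l * \<eta>))"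
      by (simp add: mult.assoc)
  qed
  also have "\<dots> \<le> (\<Sum>x\<in>seqs n. iid p n x * (\<Prod>t<n. exp (v (x t))) * exp (- (real n * l * \<eta>)))"
    by (rule sum_mono2) (auto intro!: mult_nonneg_nonneg iid_nonneg p0 prod_nonneg)
  also have "\<dots> = (\<Sum>x\<in>seqs n. \<Prod>t<n. p (x t) * exp (v (x t))) * exp (- (real n * l * \<eta>))"
    by (simp add: iid_def sum_distrib_right prod.distrib)
  also have "(\<Sum>x\<in>seqs n. \<Prod>t<n. p (x t) * exp (v (x t))) = (\<Prod>t<n. \<Sum>a\<in>UNIV. p a * exp (v a))"
    unfolding seqs_def by (rule prod_sum_PiE[symmetric]) auto
  also have "\<dots> = (\<Sum>a\<in>UNIV. p a * exp (v a)) ^ n" by simp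
  also have "\<dots> * exp (- (real n * l * \<eta>)) \<le> exp (l\<^sup>2) ^ n * exp (- (real n * l * \<eta>))"
    using mgf p0 by (intro mult_right_mono power_mono sum_nonneg) auto
  also have "\<dots> = exp (real n * l\<^sup>2 - real n * l * \<eta>)"
    by (simp add: exp_of_nat_mult[symmetric] exp_add[symmetric])
  also have "real n * l\<^sup>2 - real n * l * \<eta> = - (real n * \<eta>\<^sup>2 / 4)"
    by (simp add: l_def power2_eq_square field_simps)
  finally show ?thesis .
qed

definition near :: "real \<Rightarrow> ('w \<Rightarrow> real) \<Rightarrow> ('w \<Rightarrow> real) \<Rightarrow> bool" where
  "near \<eta> f p \<longleftrightarrow> (\<forall>w. \<bar>f w - p w\<bar> \<le> \<eta>)"

lemma sum_UN_le:
  fixes f :: "'x \<Rightarrow> real"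
  assumes "finite I" "\<And>i. i \<in> I \<Longrightarrow> finite (A i)" "\<And>x. 0 \<le> f x"
  shows "sum f (\<Union>i\<in>I. A i) \<le> (\<Sum>i\<in>I. sum f (A i))"
  using assms(1,2)
proof (induction I rule: finite_induct)
  case (insert i I)
  have "sum f (A i \<union> (\<Union>i\<in>I. A i)) \<le> sum f (A i) + sum f (\<Union>i\<in>I. A i)"
    using insert.prems insert.hyps assms(3) by (subst sum_Un) (auto intro!: sum_nonneg)
  then show ?case using insert by (simp add: order_trans)
qed simp

lemma prob_not_near:
  fixes p :: "'w::finite \<Rightarrow> real"
  assumes p: "is_pmf p" and "n > 0" "0 < \<eta>" "\<eta> \<le> 1"
  shows "(\<Sum>x\<in>{x \<in> seqs n. \<not> near \<eta> (emp n x) p}. iid p n x) \<le> 2 * real CARD('w) * exp (- (real n * \<eta>\<^sup>2 / 4))"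
proof -
  have p0: "p a \<ge> 0" for a using p by (auto simp: is_pmf_def)
  let ?E = "\<lambda>s w. {x \<in> seqs n. \<eta> \<le> s * (emp n x w - p w)}"
  have "(\<Sum>x\<in>{x \<in> seqs n. \<not> near \<eta> (emp n x) p}. iid p n x) \<le> (\<Sum>x\<in>(\<Union>w. ?E 1 w \<union> ?E (-1) w). iid p n x)"
    by (rule sum_mono2) (auto intro!: finite_subset[OF _ finite_seqs] iid_nonneg p0 simp: near_def not_le abs_le_iff intro: less_imp_le)
  also have "\<dots> \<le> (\<Sum>w\<in>UNIV. \<Sum>x\<in>?E 1 w \<union> ?E (-1) w. iid p n x)"
    by (rule sum_UN_le) (auto intro!: iid_nonneg p0)
  also have "\<dots> \<le> (\<Sum>w\<in>(UNIV :: 'w set). exp (- (real n * \<eta>\<^sup>2 / 4)) + exp (- (real n * \<eta>\<^sup>2 / 4)))"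
  proof (rule sum_mono)
    fix w
    have "(\<Sum>x\<in>?E 1 w \<union> ?E (-1) w. iid p n x) \<le> (\<Sum>x\<in>?E 1 w. iid p n x) + (\<Sum>x\<in>?E (-1) w. iid p n x)"
      by (subst sum_Un) (auto intro!: sum_nonneg iid_nonneg p0)
    also have "\<dots> \<le> exp (- (real n * \<eta>\<^sup>2 / 4)) + exp (- (real n * \<eta>\<^sup>2 / 4))"
      by (intro add_mono chernoff_one_sided assms) auto
    finally show "(\<Sum>x\<in>?E 1 w \<union> ?E (-1) w. iid p n x) \<le> \<dots>" .
  qed
  also have "\<dots> = 2 * real CARD('w) * exp (- (real n * \<eta>\<^sup>2 / 4))" by simp
  finally show ?thesis .
qed

text \<open>Pairs of sequences correspond to sequences of pairs only on \<open>{..<n}\<close>: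
  outside, the pointwise pairing has the value \<open>(undefined, undefined)\<close> instead of
  \<open>undefined\<close>. The congruence premise makes this difference invisible to
  \<open>F\<close>.\<close>

lemma sum_seqs_pair:
  fixes F :: "(nat \<Rightarrow> 'u::finite \<times> 'v::finite) \<Rightarrow> real"
  assumes cong: "\<And>x y. (\<And>t. t < n \<Longrightarrow> x t = y t) \<Longrightarrow> F x = F y"
  shows "(\<Sum>x\<in>seqs n. \<Sum>y\<in>seqs n. F (\<lambda>t. (x t, y t))) = (\<Sum>z\<in>seqs n. F z)"
proof -
  have "(\<Sum>x\<in>seqs n. \<Sum>y\<in>seqs n. F (\<lambda>t. (x t, y t))) = (\<Sum>(x, y)\<in>seqs n \<times> seqs n. F (\<lambda>t. (x t, y t)))"
    by (subst sum.cartesian_product) auto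
  also have "\<dots> = (\<Sum>z\<in>seqs n. F z)"
    by (rule sum.reindex_bij_witness[of _ "\<lambda>z. (\<lambda>t\<in>{..<n}. fst (z t), \<lambda>t\<in>{..<n}. snd (z t))"
          "\<lambda>(x, y). \<lambda>t\<in>{..<n}. (x t, y t)"])
       (auto simp: seqs_def PiE_def extensional_def fun_eq_iff split: prod.splits intro!: cong)
  finally show ?thesis .
qed

section \<open>Marginals, and information quantities as combinations of entropies\<close>

lemma marg_nonneg: "(\<And>w. 0 \<le> p w) \<Longrightarrow> 0 \<le> marg p g z"
  unfolding marg_def by (rule sum_nonneg) auto

lemma marg_pos:
  assumes "\<And>w. 0 \<le> p w" "p w \<noteq> 0"
  shows "0 < marg p g (g w)"
proof -
  have "p w \<le> marg p g (g w)" unfolding marg_def by (rule member_le_sum) (use assms in auto)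
  then show ?thesis using assms(1)[of w] assms(2) by linarith
qed

lemma sum_marg:
  fixes p :: "'w::finite \<Rightarrow> real" and g :: "'w \<Rightarrow> 'z::finite"
  shows "(\<Sum>z\<in>UNIV. marg p g z * F z) = (\<Sum>w\<in>UNIV. p w * F (g w))"
proof -
  have "(\<Sum>w\<in>UNIV. p w * F (g w)) = (\<Sum>z\<in>UNIV. \<Sum>w\<in>{w\<in>UNIV. g w = z}. p w * F (g w))"
    by (rule sum.group[symmetric]) auto
  also have "\<dots> = (\<Sum>z\<in>UNIV. marg p g z * F z)"
    by (intro sum.cong refl) (auto simp: marg_def sum_distrib_right)
  finally show ?thesis by simp
qed

lemma is_pmf_marg:
  fixes p :: "'w::finite \<Rightarrow> real" and g :: "'w \<Rightarrow> 'z::finite"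
  shows "is_pmf p \<Longrightarrow> is_pmf (marg p g)"
  using sum_marg[of p g "\<lambda>_. 1"] by (auto simp: is_pmf_def intro!: marg_nonneg)

lemma marg_marg:
  fixes p :: "'w::finite \<Rightarrow> real" and g :: "'w \<Rightarrow> 'z::finite"
  shows "marg (marg p g) h = marg p (\<lambda>w. h (g w))"
proof
  fix y
  have "(\<Sum>w\<in>{w. h (g w) = y}. p w) = (\<Sum>z\<in>{z. h z = y}. \<Sum>w\<in>{w\<in>{w. h (g w) = y}. g w = z}. p w)"
    by (rule sum.group[symmetric]) auto
  also have "\<dots> = (\<Sum>z\<in>{z. h z = y}. marg p g z)"
    by (intro sum.cong refl) (auto simp: marg_def intro!: sum.cong)
  finally show "marg (marg p g) h y = marg p (\<lambda>w. h (g w)) y" by (simp add: marg_def)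
qed

lemma ent_marg: "ent (marg p g) = - (\<Sum>w\<in>UNIV. p w * log 2 (marg p g (g w)))"
  for p :: "'w::finite \<Rightarrow> real" and g :: "'w \<Rightarrow> 'z::finite"
  using sum_marg[of p g "\<lambda>z. log 2 (marg p g z)"] by (simp add: ent_def)

lemma ent_marg_inj:
  fixes p :: "'w::finite \<Rightarrow> real" and g :: "'w \<Rightarrow> 'z::finite" and h :: "'z \<Rightarrow> 'y::finite"
  assumes "inj h"
  shows "ent (marg p (\<lambda>w. h (g w))) = ent (marg p g)"
  using assms by (simp add: ent_marg marg_def inj_eq)

lemma mi_ent:
  fixes p :: "'u::finite \<times> 'v::finite \<Rightarrow> real"
  assumes "\<And>w. 0 \<le> p w"
  shows "mi p = ent (marg p fst) + ent (marg p snd) - ent p"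
proof -
  have "mi p = (\<Sum>w\<in>UNIV. p w * log 2 (p w) - p w * log 2 (marg p fst (fst w)) - p w * log 2 (marg p snd (snd w)))"
    unfolding mi_def
  proof (intro sum.cong refl, clarify)
    fix u v
    show "(if p (u, v) = 0 then 0 else p (u, v) * log 2 (p (u, v) / (marg p fst u * marg p snd v))) =
       p (u, v) * log 2 (p (u, v)) - p (u, v) * log 2 (marg p fst (fst (u, v))) - p (u, v) * log 2 (marg p snd (snd (u, v)))"
    proof (cases "p (u, v) = 0")
      case False
      then have "p (u, v) > 0" "marg p fst u > 0" "marg p snd v > 0"
        using assms[of "(u, v)"] marg_pos[of p "(u, v)" fst] marg_pos[of p "(u, v)" snd] assms
        by (auto simp: less_le)
      then show ?thesis using False by (simp add: log_divide log_mult algebra_simps)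
    qed simp
  qed
  then show ?thesis by (simp add: ent_marg ent_def[of p] sum_subtractf)
qed

lemma cmi_ent:
  fixes p :: "'w::finite \<times> 'u::finite \<times> 'v::finite \<Rightarrow> real"
  assumes "\<And>w. 0 \<le> p w"
  shows "cmi p = ent (marg p (\<lambda>(w,u,v). (w,u))) + ent (marg p (\<lambda>(w,u,v). (w,v))) - ent p - ent (marg p fst)"
proof -
  have "cmi p = (\<Sum>w\<in>UNIV. p w * log 2 (p w) + p w * log 2 (marg p fst (fst w))
      - p w * log 2 (marg p (\<lambda>(w,u,v). (w,u)) ((\<lambda>(w,u,v). (w,u)) w))
      - p w * log 2 (marg p (\<lambda>(w,u,v). (w,v)) ((\<lambda>(w,u,v). (w,v)) w)))"
    unfolding cmi_def
  proof (intro sum.cong refl, clarify)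
    fix a u v
    show "(if p (a, u, v) = 0 then 0 else p (a, u, v) * log 2 (p (a, u, v) * marg p fst a /
            (marg p (\<lambda>(w,u,v). (w,u)) (a, u) * marg p (\<lambda>(w,u,v). (w,v)) (a, v)))) =
      p (a, u, v) * log 2 (p (a, u, v)) + p (a, u, v) * log 2 (marg p fst (fst (a, u, v)))
      - p (a, u, v) * log 2 (marg p (\<lambda>(w,u,v). (w,u)) (a, u))
      - p (a, u, v) * log 2 (marg p (\<lambda>(w,u,v). (w,v)) (a, v))"
    proof (cases "p (a, u, v) = 0")
      case False
      then have "p (a, u, v) > 0" "marg p fst a > 0" "marg p (\<lambda>(w,u,v). (w,u)) (a, u) > 0"
          "marg p (\<lambda>(w,u,v). (w,v)) (a, v) > 0"
        using False assms[of "(a, u, v)"] marg_pos[of p "(a, u, v)" fst]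
          marg_pos[of p "(a, u, v)" "\<lambda>(w,u,v). (w,u)"] marg_pos[of p "(a, u, v)" "\<lambda>(w,u,v). (w,v)"] assms
        by (auto simp: less_le)
      then show ?thesis using False by (simp add: log_divide log_mult algebra_simps)
    qed simp
  qed
  then show ?thesis by (simp add: ent_marg ent_def[of p] sum_subtractf sum.distrib)
qed

abbreviation "HX1 f \<equiv> ent (marg f (\<lambda>(x1,x2,y). x1))"
abbreviation "HX2 f \<equiv> ent (marg f (\<lambda>(x1,x2,y). x2))"
abbreviation "HY f \<equiv> ent (marg f (\<lambda>(x1,x2,y). y))"
abbreviation "HX1X2 f \<equiv> ent (marg f (\<lambda>(x1,x2,y). (x1,x2)))"
abbreviation "HX1Y f \<equiv> ent (marg f (\<lambda>(x1,x2,y). (x1,y)))"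
abbreviation "HX2Y f \<equiv> ent (marg f (\<lambda>(x1,x2,y). (x2,y)))"

text \<open>In this form continuity reduces to that of entropy, and the identities between
  information quantities become linear arithmetic in joint entropies.\<close>

lemma information_ent:
  fixes f :: "'a::finite \<times> 'b::finite \<times> 'c::finite \<Rightarrow> real"
  assumes "\<And>w. 0 \<le> f w"
  shows "I_X1_YX2 f = HX1 f + HX2Y f - ent f"
    and "I_X2_Y_given_X1 f = HX1X2 f + HX1Y f - ent f - HX1 f"
    and "I_X1_Y f = HX1 f + HY f - HX1Y f"
    and "I_X2_Y f = HX2 f + HY f - HX2Y f"
    and "I_X2_X1 f = HX2 f + HX1 f - HX1X2 f"
proof -
  have m: "0 \<le> marg f g z" for g :: "'a \<times> 'b \<times> 'c \<Rightarrow> 'z" and z using assms by (rule marg_nonneg)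
  have e: "(\<lambda>w. fst w) = (\<lambda>(x1,x2,y). x1)" "(\<lambda>w. snd w) = (\<lambda>(x1,x2,y). (x2,y))" "(\<lambda>(x1,x2,y). f (x1,x2,y)) = f"
     "fst = (\<lambda>(x1,x2,y). x1)" "snd = (\<lambda>(x1,x2,y). (x2,y))"
    by (auto simp: fun_eq_iff)
  show "I_X1_YX2 f = HX1 f + HX2Y f - ent f"
    unfolding I_X1_YX2_def e by (subst mi_ent[OF assms]) (simp add: e)
  show "I_X2_Y_given_X1 f = HX1X2 f + HX1Y f - ent f - HX1 f"
    unfolding I_X2_Y_given_X1_def cmi_ent[OF assms] by (simp add: e)
  show "I_X1_Y f = HX1 f + HY f - HX1Y f"
    unfolding I_X1_Y_def by (subst mi_ent[OF m]) (simp add: marg_marg case_prod_beta')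
  show "I_X2_Y f = HX2 f + HY f - HX2Y f"
    unfolding I_X2_Y_def by (subst mi_ent[OF m]) (simp add: marg_marg case_prod_beta')
  have "ent (marg f (\<lambda>(x1,x2,y). (x2,x1))) = ent (marg f (\<lambda>w. prod.swap ((\<lambda>(x1,x2,y). (x1,x2)) w)))"
    by (simp add: case_prod_beta')
  also have "\<dots> = HX1X2 f" by (rule ent_marg_inj) simp
  finally show "I_X2_X1 f = HX2 f + HX1 f - HX1X2 f"
    unfolding I_X2_X1_def by (subst mi_ent[OF m]) (simp add: marg_marg case_prod_beta')
qed

section \<open>Continuity of entropy and compactness of the simplex\<close>

lemma continuous_on_xlog: "continuous_on {0..} (\<lambda>x::real. x * log 2 x)"
proof -
  have "continuous (at x within {0..}) (\<lambda>x::real. x * log 2 x)" if "x \<ge> 0" for x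
  proof (cases "x = 0")
    case True
    have "((\<lambda>x::real. x * log 2 x) \<longlongrightarrow> 0) (at_right 0)" by real_asymp
    then have "((\<lambda>x::real. x * log 2 x) \<longlongrightarrow> 0) (at 0 within {0..})"
      by (simp add: at_within_Ici_at_right)
    then show ?thesis using True by (simp add: continuous_within)
  next
    case False
    then have "isCont (\<lambda>x::real. x * log 2 x) x"
      unfolding log_def using that by (intro continuous_intros) auto
    then show ?thesis by (rule continuous_at_imp_continuous_at_within)
  qed
  then show ?thesis by (simp add: continuous_on_eq_continuous_within)
qed

lemma continuous_on_apply: "continuous_on S (\<lambda>f :: 'w \<Rightarrow> real. f w)"
  by (rule continuous_on_subset[OF continuous_on_product_coordinates]) simp

lemma continuous_on_marg: "continuous_on S (\<lambda>f :: 'w::finite \<Rightarrow> real. marg f g z)"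
  unfolding marg_def by (intro continuous_on_sum continuous_on_apply)

lemma continuous_on_ent_marg:
  fixes g :: "'w::finite \<Rightarrow> 'z::finite"
  shows "continuous_on {f. is_pmf f} (\<lambda>f. ent (marg f g))"
  unfolding ent_def
  by (intro continuous_on_minus continuous_on_sum continuous_on_compose2[OF continuous_on_xlog continuous_on_marg])
     (auto intro!: marg_nonneg simp: is_pmf_def)

lemma continuous_on_ent: "continuous_on {f. is_pmf f} (ent :: ('w::finite \<Rightarrow> real) \<Rightarrow> real)"
  unfolding ent_def[abs_def]
  by (intro continuous_on_minus continuous_on_sum continuous_on_compose2[OF continuous_on_xlog continuous_on_apply])
     (auto simp: is_pmf_def)

text \<open>Laws are functions under the product topology, so the simplex is a closed subset of a
  cube that is compact by Tychonoff's theorem.\<close>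

lemma compact_pmf: "compact {f :: 'w::finite \<Rightarrow> real. is_pmf f}"
proof -
  have "compactin (product_topology (\<lambda>_::'w. euclidean :: real topology) UNIV) (PiE UNIV (\<lambda>_. {0..1::real}))"
    by (subst compactin_PiE) auto
  then have K: "compact (PiE UNIV (\<lambda>_::'w. {0..1::real}))"
    by (simp add: euclidean_product_topology)
  have c: "closed {f :: 'w \<Rightarrow> real. is_pmf f}"
    unfolding is_pmf_def
    by (intro closed_Collect_conj closed_Collect_all closed_Collect_le closed_Collect_eq
        continuous_on_sum continuous_on_apply continuous_on_const)
  have "{f :: 'w \<Rightarrow> real. is_pmf f} = PiE UNIV (\<lambda>_::'w. {0..1::real}) \<inter> {f. is_pmf f}"
  proof -
    have "f w \<le> 1" if "is_pmf f" for f :: "'w \<Rightarrow> real" and w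
      using that member_le_sum[of w UNIV f] by (auto simp: is_pmf_def)
    then show ?thesis by (auto simp: is_pmf_def)
  qed
  then show ?thesis using compact_Int_closed[OF K c] by simp
qed

text \<open>The premise says that max (G f) (\<Phi> f) is positive on the whole simplex, so by
  compactness it has a positive minimum m. If G f <= m / 2, the maximum must be attained by \<Phi>
  f. Thus \<open>m / 2\<close> serves both as tolerance and as margin.\<close>

lemma pmf_constraint_margin:
  fixes G \<Phi> :: "('w::finite \<Rightarrow> real) \<Rightarrow> real"
  assumes "continuous_on {f. is_pmf f} G" "continuous_on {f. is_pmf f} \<Phi>"
    and pos: "\<And>f. is_pmf f \<Longrightarrow> G f \<le> 0 \<Longrightarrow> \<Phi> f > 0"
  shows "\<exists>\<eta>>0. \<forall>f. is_pmf f \<longrightarrow> G f \<le> \<eta> \<longrightarrow> \<Phi> f \<ge> \<eta>"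
proof (cases "{f :: 'w \<Rightarrow> real. is_pmf f} = {}")
  case True
  then show ?thesis by (intro exI[of _ 1]) auto
next
  case False
  have "continuous_on {f. is_pmf f} (\<lambda>f. max (G f) (\<Phi> f))"
    by (intro continuous_on_max assms)
  then obtain f0 where f0: "is_pmf f0" and min: "\<And>f. is_pmf f \<Longrightarrow> max (G f0) (\<Phi> f0) \<le> max (G f) (\<Phi> f)"
    using continuous_attains_inf[OF compact_pmf False, of "\<lambda>f. max (G f) (\<Phi> f)"] by auto
  define m where "m = max (G f0) (\<Phi> f0)"
  have m: "m > 0" using pos[OF f0] unfolding m_def less_max_iff_disj by linarith
  show ?thesis
  proof (intro exI[of _ "m / 2"] conjI allI impI)
    fix f assume "is_pmf f" "G f \<le> m / 2"
    then show "\<Phi> f \<ge> m / 2"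
      using min[of f, folded m_def] m unfolding le_max_iff_disj by linarith
  qed (use m in auto)
qed

subsection \<open>Operations on codes\<close>

text \<open>Message numbers replace rates here, because the numbers produced by splitting and
  concatenating codes need not have the form \<open>num_msgs n R\<close>.\<close>

definition has_code where
  "has_code W q n M1 M2 e \<longleftrightarrow> (\<exists>x1 x2. avg_err W q n M1 M2 x1 x2 \<le> e)"

text \<open>The small code keeps codewords and scores but has fewer competitors, so correct decoding
  is inherited for every output. The premise on \<open>x1'\<close> holds for all \<open>j\<close>,
  which encodes that the first encoder does not know the second message.\<close>

lemma err_prob_reindex:
  assumes W: "is_channel W"
    and \<phi>: "inj_on \<phi> ({..<M1'} \<times> {..<M2'})" "\<phi> ` ({..<M1'} \<times> {..<M2'}) \<subseteq> {..<M1} \<times> {..<M2}"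
    and x1: "\<And>i j t. i < M1' \<Longrightarrow> j < M2' \<Longrightarrow> x1' i t = x1 (fst (\<phi> (i, j))) t"
    and x2: "\<And>i j t. i < M1' \<Longrightarrow> j < M2' \<Longrightarrow> x2' i j t = x2 (fst (\<phi> (i, j))) (snd (\<phi> (i, j))) t"
    and ij: "i < M1'" "j < M2'"
  shows "err_prob W q n M1' M2' x1' x2' i j \<le> err_prob W q n M1 M2 x1 x2 (fst (\<phi> (i, j))) (snd (\<phi> (i, j)))"
proof -
  have sc: "score q n x1' x2' i j y = score q n x1 x2 (fst (\<phi> (i, j))) (snd (\<phi> (i, j))) y"
    if "i < M1'" "j < M2'" for i j y
    using that by (simp add: score_def x1[of i j] x2[of i j])
  have "decodes_correctly q n M1' M2' x1' x2' i j y"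
    if dec: "decodes_correctly q n M1 M2 x1 x2 (fst (\<phi> (i, j))) (snd (\<phi> (i, j))) y" for y
    unfolding decodes_correctly_def
  proof (intro allI impI)
    fix i' j' assume h: "i' < M1'" "j' < M2'" "(i', j') \<noteq> (i, j)"
    have "\<phi> (i', j') \<noteq> \<phi> (i, j)" using inj_onD[OF \<phi>(1), of "(i', j')" "(i, j)"] h ij by auto
    moreover have "\<phi> (i', j') \<in> {..<M1} \<times> {..<M2}" using \<phi>(2) h by auto
    ultimately show "score q n x1' x2' i' j' y < score q n x1' x2' i j y"
      using dec h ij unfolding decodes_correctly_def by (auto simp: sc mem_Times_iff)
  qed
  then show ?thesis
    unfolding err_prob_def using W ij x1[OF ij] x2[OF ij]
    by (intro sum_mono) (auto simp: is_channel_def intro!: prod_nonneg)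
qed

lemma err_prob_nonneg: "is_channel W \<Longrightarrow> 0 \<le> err_prob W q n M1 M2 x1 x2 i j"
  unfolding err_prob_def by (intro sum_nonneg) (auto simp: is_channel_def intro!: prod_nonneg)

lemma avg_err_nonneg: "is_channel W \<Longrightarrow> 0 \<le> avg_err W q n M1 M2 x1 x2"
  unfolding avg_err_def by (intro divide_nonneg_nonneg sum_nonneg err_prob_nonneg) auto

lemma has_code_mono: "has_code W q n M1 M2 e \<Longrightarrow> e \<le> e' \<Longrightarrow> has_code W q n M1 M2 e'"
  unfolding has_code_def using order_trans by blast

lemma mod_add_left_cancel_less:
  fixes i s t M :: nat
  assumes "(i + s) mod M = (i + t) mod M" "s < M" "t < M"
  shows "s = t"
proof -
  have "(int i + int s) mod int M = (int i + int t) mod int M"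
    using arg_cong[OF assms(1), of int] by (simp add: zmod_int)
  then have "int M dvd int s - int t" by (simp add: mod_eq_dvd_iff)
  then have "int s - int t = 0"
    using dvd_imp_le_int[of "int s - int t" "int M"] assms(2,3) by (cases "s = t") auto
  then show ?thesis by simp
qed

lemma sum_shift_mod:
  fixes F :: "nat \<Rightarrow> 'x::comm_monoid_add"
  shows "(\<Sum>s<M. F ((i + s) mod M)) = (\<Sum>k<M. F k)"
proof (cases "M = 0")
  case False
  have "inj_on (\<lambda>s. (i + s) mod M) {..<M}"
  proof (rule inj_onI)
    fix s t assume h: "s \<in> {..<M}" "t \<in> {..<M}" "(i + s) mod M = (i + t) mod M"
    then show "s = t" using mod_add_left_cancel_less[OF h(3)] h(1,2) by simp
  qed
  moreover have "(\<lambda>s. (i + s) mod M) ` {..<M} \<subseteq> {..<M}" using False by auto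
  ultimately have "bij_betw (\<lambda>s. (i + s) mod M) {..<M} {..<M}"
    by (simp add: bij_betw_def endo_inj_surj)
  then show ?thesis by (rule sum.reindex_bij_betw)
qed simp

text \<open>A subcode given by cyclically shifted windows of messages has, on average over the shifts,
  the same error as the full code.\<close>

lemma has_code_subcode:
  assumes W: "is_channel W" and "has_code W q n M1 M2 e"
    and M: "0 < M1'" "M1' \<le> M1" "0 < M2'" "M2' \<le> M2"
  shows "has_code W q n M1' M2' e"
proof -
  obtain x1 x2 where e: "avg_err W q n M1 M2 x1 x2 \<le> e" using assms(2) by (auto simp: has_code_def)
  let ?e = "err_prob W q n M1 M2 x1 x2"
  define y1 where "y1 s i = x1 ((i + s) mod M1)" for s i
  define y2 where "y2 s t i j = x2 ((i + s) mod M1) ((j + t) mod M2)" for s t i j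
  have inj: "inj_on (\<lambda>i. (i + s) mod M) {..<M'}" if "M' \<le> M" for M M' s :: nat
  proof (rule inj_onI)
    fix k l assume h: "k \<in> {..<M'}" "l \<in> {..<M'}" "(k + s) mod M = (l + s) mod M"
    then show "k = l" using mod_add_left_cancel_less[of s k M l] that by (auto simp: add.commute)
  qed
  have err: "err_prob W q n M1' M2' (y1 s) (y2 s t) i j \<le> ?e ((i + s) mod M1) ((j + t) mod M2)"
    if "i < M1'" "j < M2'" for s t i j
  proof -
    let ?\<phi> = "\<lambda>(i, j). ((i + s) mod M1, (j + t) mod M2)"
    have "inj_on ?\<phi> ({..<M1'} \<times> {..<M2'})"
      using inj[OF M(2), of s] inj[OF M(4), of t] by (auto simp: inj_on_def)
    then have "err_prob W q n M1' M2' (y1 s) (y2 s t) i j \<le> ?e (fst (?\<phi> (i, j))) (snd (?\<phi> (i, j)))"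
      using M that by (intro err_prob_reindex[OF W]) (auto simp: y1_def y2_def)
    then show ?thesis by simp
  qed
  let ?f = "\<lambda>s t i j. ?e ((i + s) mod M1) ((j + t) mod M2)"
  \<comment> \<open>Deleting arbitrary messages could keep exactly the bad ones, hence the average
    over all shifts: for fixed \<open>i\<close> and \<open>j\<close> the shifted indices run through
    all message pairs of the large code once.\<close>
  have "\<exists>s<M1. \<exists>t<M2. avg_err W q n M1' M2' (y1 s) (y2 s t) \<le> e"
  proof (rule ccontr)
    assume "\<not> ?thesis"
    then have gt: "avg_err W q n M1' M2' (y1 s) (y2 s t) > e" if "s < M1" "t < M2" for s t
      using that by (auto simp: not_le)
    have "real M1 * real M2 * e = (\<Sum>s<M1. \<Sum>t<M2. e)" by simp
    also have "\<dots> < (\<Sum>s<M1. \<Sum>t<M2. avg_err W q n M1' M2' (y1 s) (y2 s t))"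
      using gt M by (intro sum_strict_mono) (auto simp: lessThan_empty_iff)
    also have "\<dots> \<le> (\<Sum>s<M1. \<Sum>t<M2. (\<Sum>i<M1'. \<Sum>j<M2'. ?f s t i j) / (real M1' * real M2'))"
      unfolding avg_err_def by (intro sum_mono divide_right_mono err) auto
    also have "\<dots> = (\<Sum>s<M1. \<Sum>t<M2. \<Sum>i<M1'. \<Sum>j<M2'. ?f s t i j) / (real M1' * real M2')"
      by (simp add: sum_divide_distrib)
    also have "(\<Sum>s<M1. \<Sum>t<M2. \<Sum>i<M1'. \<Sum>j<M2'. ?f s t i j)
        = (\<Sum>i<M1'. \<Sum>j<M2'. \<Sum>s<M1. \<Sum>t<M2. ?f s t i j)"
    proof -
      have "(\<Sum>s<M1. \<Sum>t<M2. \<Sum>i<M1'. \<Sum>j<M2'. ?f s t i j)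
          = (\<Sum>s<M1. \<Sum>i<M1'. \<Sum>t<M2. \<Sum>j<M2'. ?f s t i j)"
        by (rule sum.cong[OF refl], rule sum.swap)
      also have "\<dots> = (\<Sum>i<M1'. \<Sum>s<M1. \<Sum>j<M2'. \<Sum>t<M2. ?f s t i j)"
        by (subst sum.swap, rule sum.cong[OF refl], rule sum.cong[OF refl], rule sum.swap)
      also have "\<dots> = (\<Sum>i<M1'. \<Sum>j<M2'. \<Sum>s<M1. \<Sum>t<M2. ?f s t i j)"
        by (rule sum.cong[OF refl], rule sum.swap)
      finally show ?thesis .
    qed
    also have "\<dots> = (\<Sum>i<M1'. \<Sum>j<M2'. \<Sum>k<M1. \<Sum>l<M2. ?e k l)"
    proof (rule sum.cong[OF refl], rule sum.cong[OF refl])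
      fix i j
      have "(\<Sum>s<M1. \<Sum>t<M2. ?f s t i j) = (\<Sum>s<M1. \<Sum>l<M2. ?e ((i + s) mod M1) l)"
        by (intro sum.cong refl sum_shift_mod)
      also have "\<dots> = (\<Sum>k<M1. \<Sum>l<M2. ?e k l)" by (rule sum_shift_mod)
      finally show "(\<Sum>s<M1. \<Sum>t<M2. ?f s t i j) = (\<Sum>k<M1. \<Sum>l<M2. ?e k l)" .
    qed
    also have "\<dots> / (real M1' * real M2') = (\<Sum>k<M1. \<Sum>l<M2. ?e k l)" using M by simp
    also have "\<dots> = real M1 * real M2 * avg_err W q n M1 M2 x1 x2"
      using M by (simp add: avg_err_def)
    also have "\<dots> \<le> real M1 * real M2 * e" using e by (intro mult_left_mono) auto
    finally show False by simp
  qed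
  then show ?thesis by (auto simp: has_code_def)
qed

lemma bij_betw_div_mod:
  "bij_betw (\<lambda>(a, b). a * N + b) ({..<M} \<times> {..<N}) {..<M * N :: nat}"
proof (rule bij_betw_byWitness[where f' = "\<lambda>k. (k div N, k mod N)"])
  show "(\<lambda>(a, b). a * N + b) ` ({..<M} \<times> {..<N}) \<subseteq> {..<M * N}"
  proof clarsimp
    fix a b assume "a < M" "b < N"
    then have "a * N + b < Suc a * N" by simp
    also have "\<dots> \<le> M * N" using \<open>a < M\<close> by (intro mult_right_mono) auto
    finally show "a * N + b < M * N" .
  qed
  show "(\<lambda>k. (k div N, k mod N)) ` {..<M * N} \<subseteq> {..<M} \<times> {..<N}"
    by (auto simp: less_mult_imp_div_less) (metis mod_less_divisor mult_0_right not_less_zero bot_nat_0.not_eq_extremum)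
qed auto

lemma sum_div_mod:
  fixes F :: "nat \<Rightarrow> nat \<Rightarrow> 'x::comm_monoid_add"
  shows "(\<Sum>k<M * N. F (k div N) (k mod N)) = (\<Sum>a<M. \<Sum>b<N. F a b)"
proof -
  have "(\<Sum>k<M * N. F (k div N) (k mod N)) = (\<Sum>(a, b)\<in>{..<M} \<times> {..<N}. F a b)"
    by (subst sum.reindex_bij_betw[OF bij_betw_div_mod, symmetric]) (auto intro!: sum.cong)
  then show ?thesis by (simp add: sum.cartesian_product)
qed

text \<open>Rate splitting: the cognitive encoder takes over a part of the first user's message.\<close>

lemma has_code_split:
  assumes W: "is_channel W" and "has_code W q n Ma (Mb * M2) e"
  shows "has_code W q n (Ma * Mb) M2 e"
proof -
  obtain x1 x2 where e: "avg_err W q n Ma (Mb * M2) x1 x2 \<le> e" using assms(2) by (auto simp: has_code_def)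
  \<comment> \<open>Only the quotient of \<open>i\<close> reaches the first codeword. The remainder
    is combined with \<open>j\<close> into the message carried by the second codeword, whose encoder
    knows both.\<close>
  define y1 where "y1 i = x1 (i div Mb)" for i
  define y2 where "y2 i j = x2 (i div Mb) ((i mod Mb) * M2 + j)" for i j
  let ?\<phi> = "\<lambda>(i, j). (i div Mb, (i mod Mb) * M2 + j)"
  let ?e = "err_prob W q n Ma (Mb * M2) x1 x2"
  have b: "bij_betw (\<lambda>(a, b). a * M2 + b) ({..<Mb} \<times> {..<M2}) {..<Mb * M2}" by (rule bij_betw_div_mod)
  have mb: "i mod Mb < Mb" if "i < Ma * Mb" for i using that by (cases "Mb = 0") auto
  have inj: "inj_on ?\<phi> ({..<Ma * Mb} \<times> {..<M2})"
  proof (rule inj_onI, clarsimp)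
    fix i j i' j' assume h: "i < Ma * Mb" "j < M2" "i' < Ma * Mb" "j' < M2"
      "i div Mb = i' div Mb" "i mod Mb * M2 + j = i' mod Mb * M2 + j'"
    then have "(i mod Mb, j) = (i' mod Mb, j')"
      using inj_onD[OF bij_betw_imp_inj_on[OF b], of "(i mod Mb, j)" "(i' mod Mb, j')"] mb by auto
    then show "i = i' \<and> j = j'" using h(5) by (metis div_mult_mod_eq prod.inject)
  qed
  have sub: "?\<phi> ` ({..<Ma * Mb} \<times> {..<M2}) \<subseteq> {..<Ma} \<times> {..<Mb * M2}"
  proof clarsimp
    fix i j assume h: "i < Ma * Mb" "j < M2"
    then show "i div Mb < Ma \<and> i mod Mb * M2 + j < Mb * M2"
      using bij_betwE[OF b] mb[OF h(1)] by (auto simp: less_mult_imp_div_less)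
  qed
  have "(\<Sum>i<Ma * Mb. \<Sum>j<M2. err_prob W q n (Ma * Mb) M2 y1 y2 i j)
      \<le> (\<Sum>i<Ma * Mb. \<Sum>j<M2. ?e (fst (?\<phi> (i, j))) (snd (?\<phi> (i, j))))"
    using err_prob_reindex[OF W inj sub, of y1 x1 y2 x2 _ _ q n]
    by (intro sum_mono) (auto simp: y1_def y2_def)
  also have "\<dots> = (\<Sum>i<Ma * Mb. \<Sum>j<M2. ?e (i div Mb) (i mod Mb * M2 + j))" by simp
  also have "\<dots> = (\<Sum>a<Ma. \<Sum>b<Mb. \<Sum>j<M2. ?e a (b * M2 + j))"
    using sum_div_mod[of "\<lambda>a b. \<Sum>j<M2. ?e a (b * M2 + j)" Mb Ma] by simp
  also have "\<dots> = (\<Sum>a<Ma. \<Sum>k<Mb * M2. ?e a k)"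
  proof (rule sum.cong[OF refl])
    fix a
    have "(\<Sum>b<Mb. \<Sum>j<M2. ?e a (b * M2 + j)) = (\<Sum>k<Mb * M2. ?e a (k div M2 * M2 + k mod M2))"
      by (rule sum_div_mod[of "\<lambda>b j. ?e a (b * M2 + j)", symmetric])
    then show "(\<Sum>b<Mb. \<Sum>j<M2. ?e a (b * M2 + j)) = (\<Sum>k<Mb * M2. ?e a k)" by simp
  qed
  finally have "avg_err W q n (Ma * Mb) M2 y1 y2 \<le> avg_err W q n Ma (Mb * M2) x1 x2"
    unfolding avg_err_def by (simp add: divide_right_mono mult.assoc)
  then show ?thesis using e by (auto simp: has_code_def intro: order_trans)
qed

section \<open>Concatenation of codes\<close>

lemma sum_PiE_append:
  fixes F :: "(nat \<Rightarrow> 'w::finite) \<Rightarrow> (nat \<Rightarrow> 'w) \<Rightarrow> real"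
  shows "(\<Sum>y\<in>seqs (n + m). F (restrict y {..<n}) (\<lambda>t\<in>{..<m}. y (n + t))) = (\<Sum>u\<in>seqs n. \<Sum>v\<in>seqs m. F u v)"
proof -
  have "(\<Sum>u\<in>seqs n. \<Sum>v\<in>seqs m. F u v) = (\<Sum>(u, v)\<in>seqs n \<times> seqs m. F u v)"
    by (subst sum.cartesian_product) auto
  also have "\<dots> = (\<Sum>y\<in>seqs (n + m). F (restrict y {..<n}) (\<lambda>t\<in>{..<m}. y (n + t)))"
    by (rule sum.reindex_bij_witness[of _ "\<lambda>y. (restrict y {..<n}, \<lambda>t\<in>{..<m}. y (n + t))"
          "\<lambda>(u, v). \<lambda>t\<in>{..<n + m}. if t < n then u t else v (t - n)"])
       (auto simp: seqs_def PiE_def extensional_def fun_eq_iff restrict_def intro!: arg_cong2[of _ _ _ _ F])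
  finally show ?thesis by simp
qed

lemma sum_lessThan_append:
  fixes f :: "nat \<Rightarrow> 'x::comm_monoid_add"
  shows "(\<Sum>t<n + m. f t) = (\<Sum>t<n. f t) + (\<Sum>t<m. f (n + t))"
  by (induction m) (auto simp: add.assoc)

lemma prod_lessThan_append:
  fixes f :: "nat \<Rightarrow> 'x::comm_monoid_mult"
  shows "(\<Prod>t<n + m. f t) = (\<Prod>t<n. f t) * (\<Prod>t<m. f (n + t))"
  by (induction m) (auto simp: mult.assoc)

lemma err_prob_seqs:
  "err_prob W q n M1 M2 x1 x2 i j =
     (\<Sum>y\<in>seqs n. if decodes_correctly q n M1 M2 x1 x2 i j y then 0 else (\<Prod>t<n. W (x1 i t) (x2 i j t) (y t)))"
  by (simp add: err_prob_def seqs_def)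

lemma sum_channel_seqs:
  assumes "is_channel W"
  shows "(\<Sum>y\<in>seqs n. \<Prod>t<n. W (u t) (v t) (y t)) = 1"
proof -
  have "(\<Sum>y\<in>seqs n. \<Prod>t<n. W (u t) (v t) (y t)) = (\<Prod>t<n. \<Sum>c\<in>UNIV. W (u t) (v t) c)"
    unfolding seqs_def by (rule prod_sum_PiE[symmetric]) auto
  then show ?thesis using assms by (simp add: is_channel_def)
qed

text \<open>The metric is additive, so scores of the two blocks add. If both blocks decode
  correctly, a wrong message pair differs from the true one in at least one block and loses strictly
  there, while in a block where it agrees the scores are equal. An error therefore requires an error
  in one of the blocks.\<close>

lemma has_code_concat:
  assumes W: "is_channel W" and "has_code W q n M1 M2 e" "has_code W q m N1 N2 d"
    and pos: "0 < M1" "0 < M2" "0 < N1" "0 < N2"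
  shows "has_code W q (n + m) (M1 * N1) (M2 * N2) (e + d)"
proof -
  obtain x1 x2 where e: "avg_err W q n M1 M2 x1 x2 \<le> e" using assms(2) by (auto simp: has_code_def)
  obtain y1 y2 where d: "avg_err W q m N1 N2 y1 y2 \<le> d" using assms(3) by (auto simp: has_code_def)
  define z1 where "z1 i t = (if t < n then x1 (i div N1) t else y1 (i mod N1) (t - n))" for i t
  define z2 where "z2 i j t = (if t < n then x2 (i div N1) (j div N2) t else y2 (i mod N1) (j mod N2) (t - n))" for i j t
  let ?ez = "err_prob W q (n + m) (M1 * N1) (M2 * N2) z1 z2"
  let ?ex = "err_prob W q n M1 M2 x1 x2" and ?ey = "err_prob W q m N1 N2 y1 y2"
  have err: "?ez i j \<le>
      ?ex (i div N1) (j div N2) + ?ey (i mod N1) (j mod N2)" for i j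
  proof -
    let ?dx = "decodes_correctly q n M1 M2 x1 x2 (i div N1) (j div N2)"
    let ?dy = "decodes_correctly q m N1 N2 y1 y2 (i mod N1) (j mod N2)"
    let ?px = "\<lambda>u. \<Prod>t<n. W (x1 (i div N1) t) (x2 (i div N1) (j div N2) t) (u t)"
    let ?py = "\<lambda>u. \<Prod>t<m. W (y1 (i mod N1) t) (y2 (i mod N1) (j mod N2) t) (u t)"
    have px: "?px u \<ge> 0" "?py u \<ge> 0" for u using W by (auto simp: is_channel_def intro!: prod_nonneg)
    have sc: "score q (n + m) z1 z2 i' j' y = score q n x1 x2 (i' div N1) (j' div N2) (restrict y {..<n})
        + score q m y1 y2 (i' mod N1) (j' mod N2) (\<lambda>t\<in>{..<m}. y (n + t))" for i' j' y
      by (simp add: score_def sum_lessThan_append z1_def z2_def)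
    have dec: "decodes_correctly q (n + m) (M1 * N1) (M2 * N2) z1 z2 i j y"
      if dx: "?dx (restrict y {..<n})" and dy: "?dy (\<lambda>t\<in>{..<m}. y (n + t))" for y
      unfolding decodes_correctly_def sc
    proof (intro allI impI)
      fix i' j' assume h: "i' < M1 * N1" "j' < M2 * N2" "(i', j') \<noteq> (i, j)"
      have a: "i' div N1 < M1" "j' div N2 < M2" "i' mod N1 < N1" "j' mod N2 < N2"
        using h pos by (auto simp: less_mult_imp_div_less)
      have ne: "(i' div N1, j' div N2) \<noteq> (i div N1, j div N2) \<or> (i' mod N1, j' mod N2) \<noteq> (i mod N1, j mod N2)"
        using h(3) by (metis div_mult_mod_eq prod.inject)
      let ?u = "restrict y {..<n}" and ?v = "\<lambda>t\<in>{..<m}. y (n + t)"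
      have X: "(i' div N1, j' div N2) \<noteq> (i div N1, j div N2) \<Longrightarrow>
          score q n x1 x2 (i' div N1) (j' div N2) ?u < score q n x1 x2 (i div N1) (j div N2) ?u"
        using dx a unfolding decodes_correctly_def by blast
      have Y: "(i' mod N1, j' mod N2) \<noteq> (i mod N1, j mod N2) \<Longrightarrow>
          score q m y1 y2 (i' mod N1) (j' mod N2) ?v < score q m y1 y2 (i mod N1) (j mod N2) ?v"
        using dy a unfolding decodes_correctly_def by blast
      show "score q n x1 x2 (i' div N1) (j' div N2) ?u + score q m y1 y2 (i' mod N1) (j' mod N2) ?v
          < score q n x1 x2 (i div N1) (j div N2) ?u + score q m y1 y2 (i mod N1) (j mod N2) ?v"
        using X Y ne by (cases "(i' div N1, j' div N2) = (i div N1, j div N2)";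
            cases "(i' mod N1, j' mod N2) = (i mod N1, j mod N2)") (force intro: add_strict_mono)+
    qed
    have "?ez i j \<le>
        (\<Sum>y\<in>seqs (n + m). (\<lambda>u v. (if ?dx u then 0 else ?px u * ?py v) + (if ?dy v then 0 else ?px u * ?py v))
            (restrict y {..<n}) (\<lambda>t\<in>{..<m}. y (n + t)))"
      unfolding err_prob_seqs
    proof (rule sum_mono)
      fix y
      have "(\<Prod>t<n + m. W (z1 i t) (z2 i j t) (y t)) = ?px (restrict y {..<n}) * ?py (\<lambda>t\<in>{..<m}. y (n + t))"
        by (simp add: prod_lessThan_append z1_def z2_def)
      then show "(if decodes_correctly q (n + m) (M1 * N1) (M2 * N2) z1 z2 i j y then 0
            else \<Prod>t<n + m. W (z1 i t) (z2 i j t) (y t))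
          \<le> (\<lambda>u v. (if ?dx u then 0 else ?px u * ?py v) + (if ?dy v then 0 else ?px u * ?py v))
            (restrict y {..<n}) (\<lambda>t\<in>{..<m}. y (n + t))"
        using dec[of y] px by (auto intro!: mult_nonneg_nonneg)
    qed
    also have "\<dots> = (\<Sum>u\<in>seqs n. \<Sum>v\<in>seqs m. (if ?dx u then 0 else ?px u * ?py v) + (if ?dy v then 0 else ?px u * ?py v))"
      by (rule sum_PiE_append)
    also have "\<dots> = (\<Sum>u\<in>seqs n. \<Sum>v\<in>seqs m. (if ?dx u then 0 else ?px u) * ?py v)
        + (\<Sum>u\<in>seqs n. \<Sum>v\<in>seqs m. ?px u * (if ?dy v then 0 else ?py v))"
      unfolding sum.distrib[symmetric] by (intro sum.cong refl) auto
    also have "\<dots> = (\<Sum>u\<in>seqs n. if ?dx u then 0 else ?px u) * (\<Sum>v\<in>seqs m. ?py v)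
        + (\<Sum>u\<in>seqs n. ?px u) * (\<Sum>v\<in>seqs m. if ?dy v then 0 else ?py v)"
      by (simp add: sum_product)
    also have "\<dots> = ?ex (i div N1) (j div N2) + ?ey (i mod N1) (j mod N2)"
      by (simp add: sum_channel_seqs[OF W] err_prob_seqs)
    finally show ?thesis .
  qed
  let ?MM = "real M1 * real N1 * (real M2 * real N2)"
  have "(\<Sum>i<M1 * N1. \<Sum>j<M2 * N2. ?ez i j)
      \<le> (\<Sum>i<M1 * N1. \<Sum>j<M2 * N2. ?ex (i div N1) (j div N2) + ?ey (i mod N1) (j mod N2))"
    by (intro sum_mono err)
  also have "\<dots> = (\<Sum>i<M1 * N1. \<Sum>a<M2. \<Sum>b<N2. ?ex (i div N1) a + ?ey (i mod N1) b)"
    by (intro sum.cong refl sum_div_mod)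
  also have "\<dots> = (\<Sum>c<M1. \<Sum>f<N1. \<Sum>a<M2. \<Sum>b<N2. ?ex c a + ?ey f b)"
    by (rule sum_div_mod)
  also have "\<dots> = real N1 * real N2 * (\<Sum>c<M1. \<Sum>a<M2. ?ex c a) + real M1 * real M2 * (\<Sum>f<N1. \<Sum>b<N2. ?ey f b)"
    by (simp add: sum.distrib sum_distrib_left mult_ac)
  also have "\<dots> = ?MM * (avg_err W q n M1 M2 x1 x2 + avg_err W q m N1 N2 y1 y2)"
    using pos by (simp add: avg_err_def field_simps)
  also have "\<dots> \<le> ?MM * (e + d)" using e d by (intro mult_left_mono) auto
  finally have "avg_err W q (n + m) (M1 * N1) (M2 * N2) z1 z2 \<le> e + d"
    using pos by (simp add: avg_err_def pos_divide_le_eq mult_ac)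
  then show ?thesis by (auto simp: has_code_def)
qed

subsection \<open>Time sharing and the achievable rates\<close>

text \<open>The slack in the rates absorbs rounding of block lengths and message numbers, which
  makes this set convex and lets boundary rate pairs belong to it.\<close>

definition rate_ok where
  "rate_ok W q R \<longleftrightarrow> 0 \<le> fst R \<and> 0 \<le> snd R \<and>
     (\<forall>\<epsilon>>0. \<forall>\<^sub>F n in sequentially. \<exists>M1 M2.
        2 powr (real n * (fst R - \<epsilon>)) \<le> real M1 \<and> 2 powr (real n * (snd R - \<epsilon>)) \<le> real M2 \<and>
        has_code W q n M1 M2 \<epsilon>)"

section \<open>Message numbers against rates, and passage to achievability\<close>

lemma num_msgs_pos: "R \<ge> 0 \<Longrightarrow> 0 < num_msgs n R"
  using ge_one_powr_ge_zero[of 2 "real n * R"] by (simp add: num_msgs_def)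

lemma num_msgs_le_powr: "real (num_msgs n R) \<le> 2 powr (real n * R)"
  unfolding num_msgs_def by (simp add: of_nat_floor)

lemma num_msgs_ge_powr: "2 powr (real n * R) - 1 \<le> real (num_msgs n R)"
  unfolding num_msgs_def by linarith

lemma num_msgs_ge_half:
  assumes "R \<ge> 0" shows "2 powr (real n * R) / 2 \<le> real (num_msgs n R)"
  using num_msgs_ge_powr[of n R] num_msgs_pos[OF assms, of n] by (cases "2 powr (real n * R) \<ge> 2") linarith+

lemma num_msgs_le_nat:
  assumes "2 powr (real n * R) \<le> real M" shows "num_msgs n R \<le> M"
  using assms num_msgs_le_powr[of n R] by linarith

lemma powr_le_pos: "2 powr x \<le> real M \<Longrightarrow> 0 < M"
  by (metis less_le_trans not_gr_zero of_nat_0 powr_gt_zero zero_neq_numeral less_irrefl)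

text \<open>Codes depending on \<open>\<epsilon>\<close> have to be merged into one sequence.
  Choosing at each block length a code within 1 / (n + 1) of the infimal error does this without a
  diagonal argument.\<close>

lemma achievable_if_codes:
  assumes W: "is_channel W" and "0 \<le> R1" "0 \<le> R2"
    and codes: "\<And>\<epsilon>. \<epsilon> > 0 \<Longrightarrow> \<forall>\<^sub>F n in sequentially. has_code W q n (num_msgs n R1) (num_msgs n R2) \<epsilon>"
  shows "achievable W q (R1, R2)"
proof -
  let ?e = "\<lambda>n. avg_err W q n (num_msgs n R1) (num_msgs n R2)"
  define m where "m n = Inf (range (\<lambda>(x1, x2). ?e n x1 x2))" for n
  have bdd: "bdd_below (range (\<lambda>(x1, x2). ?e n x1 x2))" for n
    by (rule bdd_belowI[of _ 0]) (auto intro: avg_err_nonneg[OF W])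
  have "\<exists>x1 x2. ?e n x1 x2 < m n + 1 / real (n + 1)" for n
  proof -
    have "Inf (range (\<lambda>(x1, x2). ?e n x1 x2)) < m n + 1 / real (n + 1)" by (simp add: m_def)
    from cInf_lessD[OF _ this] show ?thesis by auto
  qed
  then obtain x1 x2 where x: "\<And>n. ?e n (x1 n) (x2 n) < m n + 1 / real (n + 1)" by metis
  have "(\<lambda>n. ?e n (x1 n) (x2 n)) \<longlonglongrightarrow> 0"
  proof (rule LIMSEQ_I)
    fix r :: real assume r: "r > 0"
    have "\<forall>\<^sub>F n in sequentially. has_code W q n (num_msgs n R1) (num_msgs n R2) (r / 2)"
      using codes r by simp
    moreover have "\<forall>\<^sub>F n in sequentially. 1 / real (n + 1) < r / 2"
      using r by real_asymp
    ultimately have "\<forall>\<^sub>F n in sequentially. norm (?e n (x1 n) (x2 n) - 0) < r"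
    proof eventually_elim
      case (elim n)
      then obtain y1 y2 where "?e n y1 y2 \<le> r / 2" by (auto simp: has_code_def)
      moreover have "m n \<le> ?e n y1 y2"
        unfolding m_def by (rule cInf_lower[OF _ bdd]) auto
      ultimately show ?case using x[of n] elim avg_err_nonneg[OF W, of q n _ _ "x1 n" "x2 n"] by simp
    qed
    then show "\<exists>no. \<forall>n\<ge>no. norm (?e n (x1 n) (x2 n) - 0) < r" by (simp add: eventually_sequentially)
  qed
  then show ?thesis using assms(2,3) unfolding achievable_def by auto
qed

lemma rate_ok_in_closure:
  assumes W: "is_channel W" and ok: "rate_ok W q R"
  shows "R \<in> closure {R. achievable W q R}"
  unfolding closure_approachable
proof (intro allI impI)
  fix e :: real assume e: "e > 0"
  obtain r1 r2 where R: "R = (r1, r2)" by force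
  \<comment> \<open>Each coordinate moves by at most \<open>e / 3\<close>, so the distance stays
    below \<open>e\<close>. The truncation is needed because achievable rates are nonnegative; at
    rate 0 there is a single message.\<close>
  define R1 where "R1 = max 0 (r1 - e / 3)"
  define R2 where "R2 = max 0 (r2 - e / 3)"
  have r: "r1 \<ge> 0" "r2 \<ge> 0" using ok by (auto simp: rate_ok_def R)
  have "achievable W q (R1, R2)"
  proof (rule achievable_if_codes[OF W])
    fix \<epsilon> :: real assume eps: "\<epsilon> > 0"
    define d where "d = min \<epsilon> (e / 3)"
    have d: "d > 0" "d \<le> \<epsilon>" "d \<le> e / 3" using eps e by (auto simp: d_def)
    have "\<forall>\<^sub>F n in sequentially. \<exists>M1 M2. 2 powr (real n * (r1 - d)) \<le> real M1 \<and>
        2 powr (real n * (r2 - d)) \<le> real M2 \<and> has_code W q n M1 M2 d"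
      using ok d(1) unfolding rate_ok_def R fst_conv snd_conv by blast
    then show "\<forall>\<^sub>F n in sequentially. has_code W q n (num_msgs n R1) (num_msgs n R2) \<epsilon>"
    proof eventually_elim
      case (elim n)
      then obtain M1 M2 where M: "2 powr (real n * (r1 - d)) \<le> real M1"
        "2 powr (real n * (r2 - d)) \<le> real M2" "has_code W q n M1 M2 d" by blast
      have le: "num_msgs n (max 0 (s - e / 3)) \<le> M" if "2 powr (real n * (s - d)) \<le> real M" for s M
      proof (cases "s - e / 3 \<ge> 0")
        case True
        have "2 powr (real n * (s - e / 3)) \<le> 2 powr (real n * (s - d))"
          using d by (intro powr_mono mult_left_mono) auto
        also note that
        finally show ?thesis using True by (intro num_msgs_le_nat) simp
      next
        case False
        then have "max 0 (s - e / 3) = 0" by simp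
        then show ?thesis using powr_le_pos[OF that] by (simp add: num_msgs_def)
      qed
      have "has_code W q n (num_msgs n R1) (num_msgs n R2) d"
        unfolding R1_def R2_def
        by (rule has_code_subcode[OF W M(3)]) (auto intro!: num_msgs_pos le M)
      then show ?case using d has_code_mono by blast
    qed
  qed (auto simp: R1_def R2_def)
  moreover have "dist (R1, R2) R < e"
  proof -
    have "dist (R1, R2) R \<le> \<bar>R1 - r1\<bar> + \<bar>R2 - r2\<bar>"
      unfolding R dist_Pair_Pair dist_real_def
      using sqrt_sum_squares_le_sum_abs[of "R1 - r1" "R2 - r2"] by simp
    also have "\<dots> < e" using r e by (auto simp: R1_def R2_def max_def)
    finally show ?thesis .
  qed
  ultimately show "\<exists>y\<in>{R. achievable W q R}. dist y R < e" by blast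
qed

lemma rate_ok_convex:
  assumes W: "is_channel W"
  shows "convex {R. rate_ok W q R}"
  unfolding convex_def
proof (intro ballI allI impI)
  fix R S :: "real \<times> real" and u v :: real
  assume "R \<in> {R. rate_ok W q R}" "S \<in> {R. rate_ok W q R}" and uv: "0 \<le> u" "0 \<le> v" "u + v = 1"
  then have RS: "rate_ok W q R" "rate_ok W q S" by auto
  obtain r1 r2 where R: "R = (r1, r2)" by force
  obtain s1 s2 where S: "S = (s1, s2)" by force
  have r: "r1 \<ge> 0" "r2 \<ge> 0" "s1 \<ge> 0" "s2 \<ge> 0" using RS by (auto simp: rate_ok_def R S)
  \<comment> \<open>The extreme weights are treated apart, since one of the two block lengths would
    not tend to infinity.\<close>
  have "rate_ok W q (u *\<^sub>R R + v *\<^sub>R S)"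
  proof (cases "u = 0 \<or> v = 0")
    case True
    then have "u *\<^sub>R R + v *\<^sub>R S = R \<or> u *\<^sub>R R + v *\<^sub>R S = S" using uv by auto
    then show ?thesis using RS by auto
  next
    case False
    then have u: "u > 0" "v > 0" using uv by auto
    define k where "k n = nat \<lfloor>u * real n\<rfloor>" for n
    have kn: "k n \<le> n" "real (k n) \<le> u * real n" "u * real n - 1 \<le> real (k n)" for n
    proof -
      have "u * real n \<le> 1 * real n" using uv by (intro mult_right_mono) auto
      moreover have "0 \<le> u * real n" using u by simp
      ultimately show "k n \<le> n" "real (k n) \<le> u * real n" "u * real n - 1 \<le> real (k n)"
        unfolding k_def by linarith+
    qed
    have lim1: "filterlim k at_top sequentially"
      unfolding filterlim_at_top
    proof
      fix Z :: nat
      have "\<forall>\<^sub>F n in sequentially. u * real n - 1 \<ge> real Z" using u by real_asymp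
      then show "\<forall>\<^sub>F n in sequentially. Z \<le> k n"
        by eventually_elim (use kn(3) in \<open>metis of_nat_le_iff order_trans\<close>)
    qed
    have lim2: "filterlim (\<lambda>n. n - k n) at_top sequentially"
      unfolding filterlim_at_top
    proof
      fix Z :: nat
      have "\<forall>\<^sub>F n in sequentially. v * real n \<ge> real Z" using u by real_asymp
      then show "\<forall>\<^sub>F n in sequentially. Z \<le> n - k n"
      proof eventually_elim
        case (elim n)
        have "u * real n + v * real n = real n" using uv by (simp flip: distrib_right)
        then have "v * real n \<le> real (n - k n)" using kn(1,2)[of n] by (simp add: of_nat_diff)
        then show ?case using elim by linarith
      qed
    qed
    show ?thesis unfolding rate_ok_def
    proof (intro conjI allI impI)
      fix \<epsilon> :: real assume eps: "\<epsilon> > 0"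
      then have e2: "\<epsilon> / 2 > 0" by simp
      have "\<forall>\<^sub>F n in sequentially. \<exists>M1 M2. 2 powr (real n * (r1 - \<epsilon>/2)) \<le> real M1 \<and>
        2 powr (real n * (r2 - \<epsilon>/2)) \<le> real M2 \<and> has_code W q n M1 M2 (\<epsilon>/2)"
        using RS(1) e2 unfolding rate_ok_def R fst_conv snd_conv by blast
      then have A: "\<forall>\<^sub>F n in sequentially. \<exists>M1 M2. 2 powr (real (k n) * (r1 - \<epsilon>/2)) \<le> real M1 \<and>
        2 powr (real (k n) * (r2 - \<epsilon>/2)) \<le> real M2 \<and> has_code W q (k n) M1 M2 (\<epsilon>/2)"
        by (rule eventually_compose_filterlim[OF _ lim1])
      have "\<forall>\<^sub>F n in sequentially. \<exists>M1 M2. 2 powr (real n * (s1 - \<epsilon>/2)) \<le> real M1 \<and>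
        2 powr (real n * (s2 - \<epsilon>/2)) \<le> real M2 \<and> has_code W q n M1 M2 (\<epsilon>/2)"
        using RS(2) e2 unfolding rate_ok_def S fst_conv snd_conv by blast
      then have B: "\<forall>\<^sub>F n in sequentially. \<exists>M1 M2. 2 powr (real (n - k n) * (s1 - \<epsilon>/2)) \<le> real M1 \<and>
        2 powr (real (n - k n) * (s2 - \<epsilon>/2)) \<le> real M2 \<and> has_code W q (n - k n) M1 M2 (\<epsilon>/2)"
        by (rule eventually_compose_filterlim[OF _ lim2])
      \<comment> \<open>Rounding the first block length down costs at most one symbol, hence at most
        \<open>r1\<close> or \<open>r2\<close> in the exponents; half of \<open>\<epsilon>\<close>
        pays for this.\<close>
      have C: "\<forall>\<^sub>F n in sequentially. real n * (\<epsilon>/2) \<ge> r1 + r2" using eps by real_asymp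
      show "\<forall>\<^sub>F n in sequentially. \<exists>M1 M2.
        2 powr (real n * (fst (u *\<^sub>R R + v *\<^sub>R S) - \<epsilon>)) \<le> real M1 \<and>
        2 powr (real n * (snd (u *\<^sub>R R + v *\<^sub>R S) - \<epsilon>)) \<le> real M2 \<and> has_code W q n M1 M2 \<epsilon>"
        using A B C
      proof eventually_elim
        case (elim n)
        from elim(1) obtain M1 M2 where M: "2 powr (real (k n) * (r1 - \<epsilon>/2)) \<le> real M1"
          "2 powr (real (k n) * (r2 - \<epsilon>/2)) \<le> real M2" "has_code W q (k n) M1 M2 (\<epsilon>/2)" by blast
        from elim(2) obtain N1 N2 where N: "2 powr (real (n - k n) * (s1 - \<epsilon>/2)) \<le> real N1"
          "2 powr (real (n - k n) * (s2 - \<epsilon>/2)) \<le> real N2" "has_code W q (n - k n) N1 N2 (\<epsilon>/2)" by blast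
        have code: "has_code W q n (M1 * N1) (M2 * N2) \<epsilon>"
          using has_code_concat[OF W M(3) N(3) powr_le_pos[OF M(1)] powr_le_pos[OF M(2)]
              powr_le_pos[OF N(1)] powr_le_pos[OF N(2)]] kn(1)[of n] by simp
        have nk: "real (n - k n) \<ge> v * real n" "real (k n) + real (n - k n) = real n"
        proof -
          have "u * real n + v * real n = real n" using uv by (simp flip: distrib_right)
          then show "real (n - k n) \<ge> v * real n" using kn(1,2)[of n] by (simp add: of_nat_diff)
          show "real (k n) + real (n - k n) = real n" using kn(1)[of n] by (simp add: of_nat_diff)
        qed
        have rate: "2 powr (real n * (u * a + v * b - \<epsilon>)) \<le> real (M * N)"
          if "2 powr (real (k n) * (a - \<epsilon>/2)) \<le> real M" "2 powr (real (n - k n) * (b - \<epsilon>/2)) \<le> real N"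
             "0 \<le> a" "0 \<le> b" "a \<le> real n * (\<epsilon>/2)" for a b M N
        proof -
          have "(u * real n - 1) * a \<le> real (k n) * a" "v * real n * b \<le> real (n - k n) * b"
            using kn(3)[of n] nk(1) that by (auto intro!: mult_right_mono)
          moreover have "real (k n) * (\<epsilon>/2) + real (n - k n) * (\<epsilon>/2) = real n * (\<epsilon>/2)"
            by (simp add: distrib_right[symmetric] nk(2) del: times_divide_eq_right)
          ultimately have "real n * (u * a + v * b - \<epsilon>) \<le> real (k n) * (a - \<epsilon>/2) + real (n - k n) * (b - \<epsilon>/2)"
            using that(5) by (simp add: algebra_simps)
          then have "2 powr (real n * (u * a + v * b - \<epsilon>)) \<le> 2 powr (real (k n) * (a - \<epsilon>/2)) * 2 powr (real (n - k n) * (b - \<epsilon>/2))"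
            by (subst powr_add[symmetric]) simp
          also have "\<dots> \<le> real M * real N" using that by (intro mult_mono) auto
          finally show ?thesis by simp
        qed
        show ?case
          using code rate[OF M(1) N(1)] rate[OF M(2) N(2)] r elim(3) unfolding R S
          by (intro exI[of _ "M1 * N1"] exI[of _ "M2 * N2"]) auto
      qed
    qed (use r uv in \<open>auto simp: R S\<close>)
  qed
  then show "u *\<^sub>R R + v *\<^sub>R S \<in> {R. rate_ok W q R}" by simp
qed

subsection \<open>Margins for competing codewords\<close>

text \<open>The pair (a, b) is read as one sequence over the product alphabet and the bound for
  conditional entropies applies. The threshold concerns total correlation, so the dependence between
  the two independently drawn words counts as evidence too.\<close>

lemma prob_empirical_triple_ge:
  fixes z :: "nat \<Rightarrow> 'c::finite" and p :: "'a::finite \<Rightarrow> real" and r :: "'b::finite \<Rightarrow> real"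
  assumes n: "n > 0" and p: "is_pmf p" and r: "is_pmf r"
  shows "(\<Sum>a\<in>seqs n. \<Sum>b\<in>seqs n. iid p n a * iid r n b * of_bool (c \<le> ent (emp n a) + ent (emp n b) + ent (emp n z)
        - ent (emp n (\<lambda>t. (a t, b t, z t)))))
    \<le> real (n + 1) ^ CARD('a \<times> 'b \<times> 'c) * 2 powr (- (real n * c))"
proof -
  let ?u = "\<lambda>x :: nat \<Rightarrow> 'a \<times> 'b. 2 powr (- (real n * (ent (emp n (\<lambda>t. (x t, z t))) - ent (emp n z))))"
  have "(\<Sum>a\<in>seqs n. \<Sum>b\<in>seqs n. iid p n a * iid r n b * of_bool (c \<le> ent (emp n a) + ent (emp n b) + ent (emp n z)
        - ent (emp n (\<lambda>t. (a t, b t, z t)))))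
    \<le> (\<Sum>a\<in>seqs n. \<Sum>b\<in>seqs n. ?u (\<lambda>t. (a t, b t)) * 2 powr (- (real n * c)))"
  proof (intro sum_mono)
    fix a :: "nat \<Rightarrow> 'a" and b :: "nat \<Rightarrow> 'b"
    have "ent (emp n (\<lambda>t. (\<lambda>((a, b), c). (a, b, c)) ((a t, b t), z t))) = ent (emp n (\<lambda>t. ((a t, b t), z t)))"
      by (rule ent_emp_inj[OF n]) (auto simp: inj_def)
    then have eq: "ent (emp n (\<lambda>t. (a t, b t, z t))) = ent (emp n (\<lambda>t. ((a t, b t), z t)))" by simp
    show "iid p n a * iid r n b * of_bool (c \<le> ent (emp n a) + ent (emp n b) + ent (emp n z)
        - ent (emp n (\<lambda>t. (a t, b t, z t)))) \<le> ?u (\<lambda>t. (a t, b t)) * 2 powr (- (real n * c))"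
    proof (cases "c \<le> ent (emp n a) + ent (emp n b) + ent (emp n z) - ent (emp n (\<lambda>t. (a t, b t, z t)))")
      case True
      have "iid p n a * iid r n b \<le> 2 powr (- (real n * ent (emp n a))) * 2 powr (- (real n * ent (emp n b)))"
        using p r by (intro mult_mono iid_le_powr_ent n iid_nonneg) (auto simp: is_pmf_def)
      also have "\<dots> = 2 powr (- (real n * ent (emp n a)) + - (real n * ent (emp n b)))"
        by (rule powr_add[symmetric])
      also have "\<dots> \<le> 2 powr (- (real n * (ent (emp n (\<lambda>t. ((a t, b t), z t))) - ent (emp n z))) + - (real n * c))"
      proof (intro powr_mono)
        have "real n * c \<le> real n * (ent (emp n a) + ent (emp n b) + ent (emp n z) - ent (emp n (\<lambda>t. ((a t, b t), z t))))"
          using True eq by (intro mult_left_mono) auto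
        then show "- (real n * ent (emp n a)) + - (real n * ent (emp n b)) \<le>
            - (real n * (ent (emp n (\<lambda>t. ((a t, b t), z t))) - ent (emp n z))) + - (real n * c)"
          by (simp add: algebra_simps)
      qed simp
      finally show ?thesis using True by (simp only: powr_add of_bool_eq mult_1_right)
    qed simp
  qed
  also have "\<dots> = (\<Sum>a\<in>seqs n. \<Sum>b\<in>seqs n. ?u (\<lambda>t. (a t, b t))) * 2 powr (- (real n * c))"
    by (simp add: sum_distrib_right)
  also have "(\<Sum>a\<in>seqs n. \<Sum>b\<in>seqs n. ?u (\<lambda>t. (a t, b t))) = (\<Sum>x\<in>seqs n. ?u x)"
    by (rule sum_seqs_pair) (simp cong: emp_cong)
  also have "\<dots> * 2 powr (- (real n * c)) \<le> real (n + 1) ^ CARD(('a \<times> 'b) \<times> 'c) * 2 powr (- (real n * c))"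
    by (intro mult_right_mono sum_powr_cond_ent_le n) auto
  finally show ?thesis by (simp add: mult.assoc)
qed

lemma near_mono: "near \<eta> f p \<Longrightarrow> \<eta> \<le> \<eta>' \<Longrightarrow> near \<eta>' f p"
  unfolding near_def using order_trans by blast

lemma near_marg:
  fixes f p :: "'w::finite \<Rightarrow> real"
  assumes "near \<eta> f p" shows "near (real CARD('w) * \<eta>) (marg f g) (marg p g)"
  unfolding near_def
proof
  fix z
  have eta: "0 \<le> \<eta>" using assms unfolding near_def by (meson abs_ge_zero order_trans)
  have "\<bar>marg f g z - marg p g z\<bar> = \<bar>\<Sum>w\<in>{w. g w = z}. f w - p w\<bar>"
    by (simp add: marg_def sum_subtractf)
  also have "\<dots> \<le> (\<Sum>w\<in>{w. g w = z}. \<bar>f w - p w\<bar>)" by (rule sum_abs)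
  also have "\<dots> \<le> (\<Sum>w\<in>UNIV. \<bar>f w - p w\<bar>)" by (rule sum_mono2) auto
  also have "\<dots> \<le> (\<Sum>w\<in>(UNIV :: 'w set). \<eta>)" using assms by (intro sum_mono) (auto simp: near_def)
  finally show "\<bar>marg f g z - marg p g z\<bar> \<le> real CARD('w) * \<eta>" by simp
qed

lemma near_sum:
  fixes f p :: "'w::finite \<Rightarrow> real"
  assumes "near \<eta> f p"
  shows "\<bar>(\<Sum>w\<in>UNIV. f w * F w) - (\<Sum>w\<in>UNIV. p w * F w)\<bar> \<le> \<eta> * (\<Sum>w\<in>UNIV. \<bar>F w\<bar>)"
proof -
  have "\<bar>(\<Sum>w\<in>UNIV. f w * F w) - (\<Sum>w\<in>UNIV. p w * F w)\<bar> = \<bar>\<Sum>w\<in>UNIV. (f w - p w) * F w\<bar>"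
    by (simp add: sum_subtractf left_diff_distrib)
  also have "\<dots> \<le> (\<Sum>w\<in>UNIV. \<bar>(f w - p w) * F w\<bar>)" by (rule sum_abs)
  also have "\<dots> \<le> (\<Sum>w\<in>UNIV. \<eta> * \<bar>F w\<bar>)"
    using assms by (intro sum_mono) (auto simp: near_def abs_mult intro: mult_right_mono)
  finally show ?thesis by (simp add: sum_distrib_left)
qed

abbreviation "pX1X2 \<equiv> (\<lambda>(x1, x2, y). (x1, x2))"
abbreviation (input) "qt q \<equiv> (\<lambda>(x1, x2, y). q x1 x2 y)"

lemma Gq_iff:
  "f \<in> Gq q P \<longleftrightarrow> is_pmf f \<and> marg f pX1X2 = marg P pX1X2 \<and>
     (\<Sum>w\<in>UNIV. f w * qt q w) \<ge> (\<Sum>w\<in>UNIV. P w * qt q w)"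
  by (simp add: Gq_def case_prod_beta')

text \<open>The minima over the constraint sets are lower semicontinuous: relaxing all constraints
  slightly keeps a strict lower bound.\<close>

lemma constraint_margin:
  fixes q :: "'a::finite \<Rightarrow> 'b::finite \<Rightarrow> 'c::finite \<Rightarrow> real" and h :: "'a \<times> 'b \<times> 'c \<Rightarrow> 'z::finite"
  assumes \<Phi>: "continuous_on {f. is_pmf f} \<Phi>"
    and pos: "\<And>f. f \<in> Gq q P \<Longrightarrow> marg f h = marg P h \<Longrightarrow> \<Phi> f > 0"
  shows "\<exists>\<eta>>0. \<forall>f. is_pmf f \<longrightarrow> near \<eta> (marg f pX1X2) (marg P pX1X2) \<longrightarrow> near \<eta> (marg f h) (marg P h) \<longrightarrow>
     (\<Sum>w\<in>UNIV. P w * qt q w) - \<eta> \<le> (\<Sum>w\<in>UNIV. f w * qt q w) \<longrightarrow> \<eta> \<le> \<Phi> f"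
proof -
  \<comment> \<open>A continuous gauge of the constraints, which vanishes exactly when both
    marginals agree with those of \<open>P\<close> and the metric inequality holds.\<close>
  define G where "G f = (\<Sum>z\<in>UNIV. \<bar>marg f pX1X2 z - marg P pX1X2 z\<bar>) + (\<Sum>z\<in>UNIV. \<bar>marg f h z - marg P h z\<bar>)
      + max 0 ((\<Sum>w\<in>UNIV. P w * qt q w) - (\<Sum>w\<in>UNIV. f w * qt q w))" for f
  have "continuous_on {f. is_pmf f} G"
    unfolding G_def by (intro continuous_intros continuous_on_marg continuous_on_apply)
  moreover have "\<Phi> f > 0" if "is_pmf f" "G f \<le> 0" for f
  proof -
    have s: "(\<Sum>z\<in>UNIV. \<bar>marg f pX1X2 z - marg P pX1X2 z\<bar>) \<ge> 0" "(\<Sum>z\<in>UNIV. \<bar>marg f h z - marg P h z\<bar>) \<ge> 0"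
      by (auto intro: sum_nonneg)
    then have z: "(\<Sum>z\<in>UNIV. \<bar>marg f pX1X2 z - marg P pX1X2 z\<bar>) = 0" "(\<Sum>z\<in>UNIV. \<bar>marg f h z - marg P h z\<bar>) = 0"
      "(\<Sum>w\<in>UNIV. P w * qt q w) \<le> (\<Sum>w\<in>UNIV. f w * qt q w)"
      using that(2) unfolding G_def by linarith+
    have "marg f pX1X2 = marg P pX1X2" "marg f h = marg P h"
      using z(1,2) by (auto simp: sum_nonneg_eq_0_iff fun_eq_iff)
    then show ?thesis using pos[of f] that(1) z(3) by (simp add: Gq_iff)
  qed
  ultimately obtain \<theta> where \<theta>: "\<theta> > 0" "\<And>f. is_pmf f \<Longrightarrow> G f \<le> \<theta> \<Longrightarrow> \<Phi> f \<ge> \<theta>"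
    using pmf_constraint_margin[OF _ \<Phi>, of G] by blast
  \<comment> \<open>One share \<open>\<theta> / K\<close> for each coordinate of the two marginals
    and one for the metric.\<close>
  define K where "K = real CARD('a \<times> 'b) + real CARD('z) + 1"
  have K: "K \<ge> 1" by (simp add: K_def)
  show ?thesis
  proof (intro exI[of _ "\<theta> / K"] conjI allI impI)
    fix f assume h: "is_pmf f" "near (\<theta> / K) (marg f pX1X2) (marg P pX1X2)" "near (\<theta> / K) (marg f h) (marg P h)"
      "(\<Sum>w\<in>UNIV. P w * qt q w) - \<theta> / K \<le> (\<Sum>w\<in>UNIV. f w * qt q w)"
    have "(\<Sum>z\<in>UNIV. \<bar>marg f pX1X2 z - marg P pX1X2 z\<bar>) \<le> (\<Sum>z\<in>(UNIV :: ('a \<times> 'b) set). \<theta> / K)"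
      using h(2) unfolding near_def by (intro sum_mono) blast
    moreover have "(\<Sum>z\<in>UNIV. \<bar>marg f h z - marg P h z\<bar>) \<le> (\<Sum>z\<in>(UNIV :: 'z set). \<theta> / K)"
      using h(3) unfolding near_def by (intro sum_mono) blast
    moreover have "max 0 ((\<Sum>w\<in>UNIV. P w * qt q w) - (\<Sum>w\<in>UNIV. f w * qt q w)) \<le> \<theta> / K"
      using h(4) \<theta>(1) K by simp
    moreover have "K * (\<theta> / K) = real CARD('a \<times> 'b) * (\<theta> / K) + real CARD('z) * (\<theta> / K) + \<theta> / K"
      by (subst (1) K_def) (simp only: distrib_right mult_1)
    ultimately have "G f \<le> K * (\<theta> / K)"
      unfolding G_def sum_constant by linarith
    then have "G f \<le> \<theta>" using K by simp
    then have "\<theta> \<le> \<Phi> f" using \<theta>(2) h(1) by blast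
    moreover have "\<theta> / K \<le> \<theta>" using K \<theta>(1) by (simp add: divide_le_eq)
    ultimately show "\<theta> / K \<le> \<Phi> f" by simp
  qed (use \<theta> K in auto)
qed

text \<open>Here \<open>\<omega>\<close> is the transmitted triple of sequences and
  \<open>\<omega>'\<close> a competing one. The map \<open>h\<close> extracts the coordinates they
  share: (x2, y), (x1, y) or y, according to which message indices are wrong.\<close>

definition competes where
  "competes q P h \<eta> n \<omega> \<omega>' \<longleftrightarrow> n > 0 \<and> near \<eta> (emp n \<omega>) P \<and> near \<eta> (emp n (\<lambda>t. pX1X2 (\<omega>' t))) (marg P pX1X2) \<and>
     (\<forall>t<n. h (\<omega>' t) = h (\<omega> t)) \<and> (\<Sum>t<n. qt q (\<omega> t)) \<le> (\<Sum>t<n. qt q (\<omega>' t))"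

text \<open>The law of \<open>\<omega>\<close> is close to \<open>P\<close>, and
  \<open>\<omega>'\<close> has the same \<open>h\<close>-marginal and at least the same score. Hence
  the law of \<open>\<omega>'\<close> violates the constraints only slightly, and the compactness
  margin applies.\<close>

lemma sequence_margin:
  fixes q :: "'a::finite \<Rightarrow> 'b::finite \<Rightarrow> 'c::finite \<Rightarrow> real" and h :: "'a \<times> 'b \<times> 'c \<Rightarrow> 'z::finite"
  assumes \<Phi>: "continuous_on {f. is_pmf f} \<Phi>"
    and pos: "\<And>f. f \<in> Gq q P \<Longrightarrow> marg f h = marg P h \<Longrightarrow> \<Phi> f > 0"
  shows "\<exists>\<eta>>0. \<forall>n \<omega> \<omega>'. competes q P h \<eta> n \<omega> \<omega>' \<longrightarrow> \<eta> \<le> \<Phi> (emp n \<omega>')"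
proof -
  obtain \<theta> where \<theta>: "\<theta> > 0" and m: "\<And>f. is_pmf f \<Longrightarrow> near \<theta> (marg f pX1X2) (marg P pX1X2) \<Longrightarrow> near \<theta> (marg f h) (marg P h) \<Longrightarrow>
     (\<Sum>w\<in>UNIV. P w * qt q w) - \<theta> \<le> (\<Sum>w\<in>UNIV. f w * qt q w) \<Longrightarrow> \<theta> \<le> \<Phi> f"
    using constraint_margin[OF \<Phi>, of q P h] pos by blast
  define Q where "Q = (\<Sum>w\<in>UNIV. \<bar>qt q w\<bar>)"
  \<comment> \<open>A law within d of \<open>P\<close> has marginals within CARD d and expected
    metric within Q d of those of \<open>P\<close>; the tolerance \<open>\<theta> / K\<close> keeps
    both within \<open>\<theta>\<close>.\<close>
  define K where "K = real CARD('a \<times> 'b \<times> 'c) + Q + 1"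
  have Q: "Q \<ge> 0" by (auto simp: Q_def intro: sum_nonneg)
  then have K: "K \<ge> 1" by (simp add: K_def)
  have e: "\<theta> / K > 0" "\<theta> / K \<le> \<theta>" using K \<theta> by (auto simp: divide_le_eq)
  have eK: "real CARD('a \<times> 'b \<times> 'c) * (\<theta> / K) + Q * (\<theta> / K) + \<theta> / K = \<theta>"
  proof -
    have "real CARD('a \<times> 'b \<times> 'c) * (\<theta> / K) + Q * (\<theta> / K) + \<theta> / K = K * (\<theta> / K)"
      unfolding K_def by (simp add: distrib_right del: times_divide_eq_right)
    then show ?thesis using K by simp
  qed
  have ge: "Q * (\<theta> / K) \<ge> 0" "real CARD('a \<times> 'b \<times> 'c) * (\<theta> / K) \<ge> 0"
    using Q e by (intro mult_nonneg_nonneg; simp)+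
  show ?thesis
  proof (intro exI[of _ "\<theta> / K"] conjI allI impI)
    fix n \<omega> \<omega>'
    assume "competes q P h (\<theta> / K) n \<omega> \<omega>'"
    then have n: "n > 0" and H: "near (\<theta> / K) (emp n \<omega>) P" "near (\<theta> / K) (emp n (\<lambda>t. pX1X2 (\<omega>' t))) (marg P pX1X2)"
      "\<forall>t<n. h (\<omega>' t) = h (\<omega> t)" "(\<Sum>t<n. qt q (\<omega> t)) \<le> (\<Sum>t<n. qt q (\<omega>' t))"
      unfolding competes_def by blast+
    have "\<theta> \<le> \<Phi> (emp n \<omega>')"
    proof (rule m)
      show "is_pmf (emp n \<omega>')" by (rule is_pmf_emp[OF n])
      show "near \<theta> (marg (emp n \<omega>') pX1X2) (marg P pX1X2)"
        unfolding marg_emp using H(2) e(2) by (rule near_mono)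
      have "marg (emp n \<omega>') h = marg (emp n \<omega>) h" unfolding marg_emp using H(3) by (intro emp_cong) auto
      moreover have "near \<theta> (marg (emp n \<omega>) h) (marg P h)"
        by (rule near_mono[OF near_marg[OF H(1)]]) (use eK ge e in linarith)
      ultimately show "near \<theta> (marg (emp n \<omega>') h) (marg P h)" by simp
      have "(\<Sum>w\<in>UNIV. emp n \<omega> w * qt q w) * real n \<le> (\<Sum>w\<in>UNIV. emp n \<omega>' w * qt q w) * real n"
        unfolding sum_emp[OF n] by (rule H(4))
      then have "(\<Sum>w\<in>UNIV. emp n \<omega> w * qt q w) \<le> (\<Sum>w\<in>UNIV. emp n \<omega>' w * qt q w)"
        using n by simp
      moreover have "(\<theta> / K) * Q \<le> \<theta>" using eK ge e by (subst mult.commute) linarith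
      ultimately show "(\<Sum>w\<in>UNIV. P w * qt q w) - \<theta> \<le> (\<Sum>w\<in>UNIV. emp n \<omega>' w * qt q w)"
        using near_sum[OF H(1), of "qt q"] unfolding Q_def[symmetric] by linarith
    qed
    then show "\<theta> / K \<le> \<Phi> (emp n \<omega>')" using e by linarith
  qed (use e in auto)
qed

text \<open>Here \<open>s1\<close> and \<open>s2\<close> are the rates of two independent codebooks,
  so \<open>s2\<close> includes the binning overhead. The bounds are I(X1;X2,Y), I(X2;X1,Y) and, for
  two wrong indices, one of total correlation, I(X2;Y) and I(X1;Y), where the choice may depend on
  \<open>f\<close>. At rate 0 a codebook has one word and no competitor, hence the guards.\<close>

definition rates_below where
  "rates_below q P s1 s2 \<longleftrightarrow>
     (s1 > 0 \<longrightarrow> (\<forall>f\<in>L1 q P. s1 < HX1 f + HX2Y f - ent f)) \<and>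
     (s2 > 0 \<longrightarrow> (\<forall>f\<in>L2 q P. s2 < HX2 f + HX1Y f - ent f)) \<and>
     (s1 > 0 \<longrightarrow> s2 > 0 \<longrightarrow> (\<forall>f\<in>L0 q P. s1 + s2 < HX1 f + HX2 f + HY f - ent f
        \<or> s2 < HX2 f + HY f - HX2Y f \<or> s1 < HX1 f + HY f - HX1Y f))"

text \<open>The empirical counterpart of \<open>rates_below\<close> for one competitor, with margin
  \<open>\<theta>\<close>.\<close>

definition separates :: "real \<Rightarrow> real \<Rightarrow> real \<Rightarrow> nat \<Rightarrow> (nat \<Rightarrow> 'a::finite) \<Rightarrow> (nat \<Rightarrow> 'b::finite) \<Rightarrow>
    (nat \<Rightarrow> 'c::finite) \<Rightarrow> (nat \<Rightarrow> 'a) \<Rightarrow> (nat \<Rightarrow> 'b) \<Rightarrow> bool" where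
  "separates s1 s2 \<theta> n a b y a' b' \<longleftrightarrow>
      (s1 > 0 \<longrightarrow> b' = b \<longrightarrow> s1 + \<theta> \<le> ent (emp n a') + ent (emp n (\<lambda>t. (b t, y t))) - ent (emp n (\<lambda>t. (a' t, b t, y t)))) \<and>
      (s2 > 0 \<longrightarrow> a' = a \<longrightarrow> s2 + \<theta> \<le> ent (emp n b') + ent (emp n (\<lambda>t. (a t, y t))) - ent (emp n (\<lambda>t. (b' t, a t, y t)))) \<and>
      (s1 > 0 \<longrightarrow> s2 > 0 \<longrightarrow>
          s1 + s2 + \<theta> \<le> ent (emp n a') + ent (emp n b') + ent (emp n y) - ent (emp n (\<lambda>t. (a' t, b' t, y t)))
        \<or> s2 + \<theta> \<le> ent (emp n b') + ent (emp n y) - ent (emp n (\<lambda>t. (b' t, y t)))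
        \<or> s1 + \<theta> \<le> ent (emp n a') + ent (emp n y) - ent (emp n (\<lambda>t. (a' t, y t))))"

lemma competitor_margin:
  fixes q :: "'a::finite \<Rightarrow> 'b::finite \<Rightarrow> 'c::finite \<Rightarrow> real"
  assumes "rates_below q P s1 s2"
  shows "\<exists>\<eta>>0. \<eta> \<le> 1 \<and> (\<forall>n a b y a' b'. n > 0 \<longrightarrow> near \<eta> (emp n (\<lambda>t. (a t, b t, y t))) P \<longrightarrow>
      near \<eta> (emp n (\<lambda>t. (a' t, b' t))) (marg P pX1X2) \<longrightarrow>
      (\<Sum>t<n. q (a t) (b t) (y t)) \<le> (\<Sum>t<n. q (a' t) (b' t) (y t)) \<longrightarrow>
      separates s1 s2 \<eta> n a b y a' b')"
proof -
  note cont = continuous_on_ent_marg continuous_on_ent continuous_on_const continuous_on_add continuous_on_diff continuous_on_max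
  define \<Phi>1 where "\<Phi>1 f = (if s1 > 0 then HX1 f + HX2Y f - ent f - s1 else 1)" for f :: "'a \<times> 'b \<times> 'c \<Rightarrow> real"
  define \<Phi>2 where "\<Phi>2 f = (if s2 > 0 then HX2 f + HX1Y f - ent f - s2 else 1)" for f :: "'a \<times> 'b \<times> 'c \<Rightarrow> real"
  \<comment> \<open>A maximum turns the disjunction of three strict bounds into positivity of one
    continuous function; the constant 1 covers the cases without competitors.\<close>
  define \<Phi>0 where "\<Phi>0 f = (if s1 > 0 \<and> s2 > 0 then max (HX1 f + HX2 f + HY f - ent f - (s1 + s2))
     (max (HX2 f + HY f - HX2Y f - s2) (HX1 f + HY f - HX1Y f - s1)) else 1)" for f :: "'a \<times> 'b \<times> 'c \<Rightarrow> real"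
  have c1: "continuous_on {f. is_pmf f} \<Phi>1" unfolding \<Phi>1_def by (cases "s1 > 0") (auto intro!: cont)
  have c2: "continuous_on {f. is_pmf f} \<Phi>2" unfolding \<Phi>2_def by (cases "s2 > 0") (auto intro!: cont)
  have c0: "continuous_on {f. is_pmf f} \<Phi>0" unfolding \<Phi>0_def by (cases "s1 > 0 \<and> s2 > 0") (auto intro!: cont)
  have p1: "\<Phi>1 f > 0" if "f \<in> Gq q P" "marg f (\<lambda>(x1, x2, y). (x2, y)) = marg P (\<lambda>(x1, x2, y). (x2, y))" for f
    using assms that unfolding rates_below_def \<Phi>1_def L1_def by auto
  have p2: "\<Phi>2 f > 0" if "f \<in> Gq q P" "marg f (\<lambda>(x1, x2, y). (x1, y)) = marg P (\<lambda>(x1, x2, y). (x1, y))" for f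
    using assms that unfolding rates_below_def \<Phi>2_def L2_def by auto
  have p0: "\<Phi>0 f > 0" if "f \<in> Gq q P" "marg f (\<lambda>(x1, x2, y). y) = marg P (\<lambda>(x1, x2, y). y)" for f
  proof (cases "s1 > 0 \<and> s2 > 0")
    case True
    have "f \<in> L0 q P" using that by (simp add: L0_def)
    then have "s1 + s2 < HX1 f + HX2 f + HY f - ent f
        \<or> s2 < HX2 f + HY f - HX2Y f \<or> s1 < HX1 f + HY f - HX1Y f"
      using assms True unfolding rates_below_def by blast
    then show ?thesis using True unfolding \<Phi>0_def by (simp add: less_max_iff_disj)
  next
    case False
    then show ?thesis by (auto simp: \<Phi>0_def)
  qed
  obtain \<eta>1 where e1: "\<eta>1 > 0" and m1: "\<And>n \<omega> \<omega>'. competes q P (\<lambda>(x1, x2, y). (x2, y)) \<eta>1 n \<omega> \<omega>' \<Longrightarrow> \<eta>1 \<le> \<Phi>1 (emp n \<omega>')"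
    using sequence_margin[OF c1 p1] by blast
  obtain \<eta>2 where e2: "\<eta>2 > 0" and m2: "\<And>n \<omega> \<omega>'. competes q P (\<lambda>(x1, x2, y). (x1, y)) \<eta>2 n \<omega> \<omega>' \<Longrightarrow> \<eta>2 \<le> \<Phi>2 (emp n \<omega>')"
    using sequence_margin[OF c2 p2] by blast
  obtain \<eta>0 where e0: "\<eta>0 > 0" and m0: "\<And>n \<omega> \<omega>'. competes q P (\<lambda>(x1, x2, y). y) \<eta>0 n \<omega> \<omega>' \<Longrightarrow> \<eta>0 \<le> \<Phi>0 (emp n \<omega>')"
    using sequence_margin[OF c0 p0] by blast
  define \<eta> where "\<eta> = min 1 (min \<eta>0 (min \<eta>1 \<eta>2))"
  have \<eta>: "\<eta> > 0" "\<eta> \<le> 1" "\<eta> \<le> \<eta>0" "\<eta> \<le> \<eta>1" "\<eta> \<le> \<eta>2" using e0 e1 e2 by (auto simp: \<eta>_def)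
  show ?thesis
  proof (rule exI[of _ \<eta>], intro conjI[OF \<eta>(1)] conjI[OF \<eta>(2)], intro allI impI)
    fix n a b y a' b'
    assume n: "n > (0::nat)" and H: "near \<eta> (emp n (\<lambda>t. (a t, b t, y t))) P"
      "near \<eta> (emp n (\<lambda>t. (a' t, b' t))) (marg P pX1X2)"
      "(\<Sum>t<n. q (a t) (b t) (y t)) \<le> (\<Sum>t<n. q (a' t) (b' t) (y t))"
    let ?w = "\<lambda>t. (a t, b t, y t)" and ?v = "\<lambda>t. (a' t, b' t, y t)"
    have N: "near \<theta> (emp n ?w) P" "near \<theta> (emp n (\<lambda>t. pX1X2 (?v t))) (marg P pX1X2)" if "\<eta> \<le> \<theta>" for \<theta>
      using near_mono[OF H(1) that] near_mono[OF H(2) that] by simp_all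
    have sc: "(\<Sum>t<n. qt q (?w t)) \<le> (\<Sum>t<n. qt q (?v t))" using H(3) by simp
    have M: "marg (emp n ?v) g = emp n (\<lambda>t. g (?v t))" for g :: "'a \<times> 'b \<times> 'c \<Rightarrow> 'z" by (rule marg_emp)
    have i: "ent (emp n (\<lambda>t. (b' t, a' t, y t))) = ent (emp n ?v)"
      using ent_emp_inj[OF n, of "\<lambda>(u, v, w). (v, u, w)" ?v] by (auto simp: inj_def)
    show "separates s1 s2 \<eta> n a b y a' b'"
      unfolding separates_def
    proof (intro conjI impI)
      assume "s1 > 0" "b' = b"
      then have "\<eta>1 \<le> \<Phi>1 (emp n ?v)" using n N[OF \<eta>(4)] sc by (intro m1) (auto simp: competes_def)
      then show "s1 + \<eta> \<le> ent (emp n a') + ent (emp n (\<lambda>t. (b t, y t))) - ent (emp n (\<lambda>t. (a' t, b t, y t)))"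
        using \<open>s1 > 0\<close> \<open>b' = b\<close> \<eta>(4) unfolding \<Phi>1_def M by simp
    next
      assume "s2 > 0" "a' = a"
      then have "\<eta>2 \<le> \<Phi>2 (emp n ?v)" using n N[OF \<eta>(5)] sc by (intro m2) (auto simp: competes_def)
      then show "s2 + \<eta> \<le> ent (emp n b') + ent (emp n (\<lambda>t. (a t, y t))) - ent (emp n (\<lambda>t. (b' t, a t, y t)))"
        using \<open>s2 > 0\<close> \<open>a' = a\<close> \<eta>(5) i unfolding \<Phi>2_def M by simp
    next
      assume s: "s1 > 0" "s2 > 0"
      have "\<eta>0 \<le> \<Phi>0 (emp n ?v)" using n N[OF \<eta>(3)] sc by (intro m0) (auto simp: competes_def)
      then show "s1 + s2 + \<eta> \<le> ent (emp n a') + ent (emp n b') + ent (emp n y) - ent (emp n (\<lambda>t. (a' t, b' t, y t)))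
        \<or> s2 + \<eta> \<le> ent (emp n b') + ent (emp n y) - ent (emp n (\<lambda>t. (b' t, y t)))
        \<or> s1 + \<eta> \<le> ent (emp n a') + ent (emp n y) - ent (emp n (\<lambda>t. (a' t, y t)))"
        using s \<eta>(3) unfolding \<Phi>0_def M by (simp add: le_max_iff_disj) linarith
    qed
  qed
qed

subsection \<open>Expectations over random codebooks\<close>

definition codebooks :: "nat \<Rightarrow> 'x set \<Rightarrow> (nat \<Rightarrow> 'x) set" where
  "codebooks N A = PiE {..<N} (\<lambda>_. A)"

definition weight :: "('x \<Rightarrow> real) \<Rightarrow> nat \<Rightarrow> (nat \<Rightarrow> 'x) \<Rightarrow> real" where
  "weight \<mu> N g = (\<Prod>i<N. \<mu> (g i))"

lemma weight_nonneg: "(\<And>a. a \<in> A \<Longrightarrow> 0 \<le> \<mu> a) \<Longrightarrow> g \<in> codebooks N A \<Longrightarrow> 0 \<le> weight \<mu> N g"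
  unfolding weight_def codebooks_def by (intro prod_nonneg) auto

lemma sum_weight_prod:
  fixes \<mu> :: "'x \<Rightarrow> real"
  assumes "finite A"
  shows "(\<Sum>g\<in>codebooks N A. weight \<mu> N g * (\<Prod>i<N. F i (g i))) = (\<Prod>i<N. \<Sum>a\<in>A. \<mu> a * F i a)"
  unfolding codebooks_def weight_def using assms by (subst prod_sum_PiE) (auto simp: prod.distrib)

lemma sum_weight:
  assumes "finite A" "sum \<mu> A = (1 :: real)"
  shows "(\<Sum>g\<in>codebooks N A. weight \<mu> N g) = 1"
  using sum_weight_prod[OF assms(1), of \<mu> N "\<lambda>_ _. 1"] assms by simp

lemma sum_weight_1:
  fixes F :: "'x \<Rightarrow> real"
  assumes A: "finite A" "sum \<mu> A = 1" and i: "i < N"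
  shows "(\<Sum>g\<in>codebooks N A. weight \<mu> N g * F (g i)) = (\<Sum>a\<in>A. \<mu> a * F a)"
proof -
  define f where "f k c = (if k = i then F c else 1)" for k c
  have "(\<Prod>k<N. f k (g k)) = F (g i)" for g
    using i by (subst prod.remove[of _ i]) (auto simp: f_def intro!: prod.neutral)
  then have "(\<Sum>g\<in>codebooks N A. weight \<mu> N g * F (g i)) = (\<Prod>k<N. \<Sum>a\<in>A. \<mu> a * f k a)"
    using sum_weight_prod[OF A(1), of \<mu> N f] by simp
  also have "\<dots> = (\<Sum>a\<in>A. \<mu> a * F a)"
    using i A(2) by (subst prod.remove[of _ i]) (auto simp: f_def intro!: prod.neutral)
  finally show ?thesis .
qed

lemma sum_weight_2:
  fixes F :: "'x \<Rightarrow> 'x \<Rightarrow> real"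
  assumes A: "finite A" "sum \<mu> A = 1" and ij: "i < N" "j < N" "i \<noteq> j"
  shows "(\<Sum>g\<in>codebooks N A. weight \<mu> N g * F (g i) (g j)) = (\<Sum>a\<in>A. \<Sum>b\<in>A. \<mu> a * \<mu> b * F a b)"
proof -
  \<comment> \<open>Once the value of codeword \<open>i\<close> is fixed to \<open>a\<close>, the
    summand becomes a product over positions and the product formula applies.\<close>
  have fixed: "(\<Sum>g\<in>codebooks N A. weight \<mu> N g * (of_bool (g i = a) * F a (g j))) = \<mu> a * (\<Sum>b\<in>A. \<mu> b * F a b)"
    if a: "a \<in> A" for a
  proof -
    define f where "f k c = (if k = i then of_bool (c = a) else if k = j then F a c else 1)" for k c
    have rem: "(\<Prod>k<N. G k) = G i * (G j * (\<Prod>k\<in>{..<N} - {i} - {j}. G k))" for G :: "nat \<Rightarrow> real"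
      using ij by (subst prod.remove[of _ i]; (subst prod.remove[of _ j])?) auto
    have "(\<Prod>k<N. f k (g k)) = of_bool (g i = a) * F a (g j)" for g
      unfolding rem using ij by (auto simp: f_def intro!: prod.neutral)
    then have "(\<Sum>g\<in>codebooks N A. weight \<mu> N g * (of_bool (g i = a) * F a (g j))) = (\<Prod>k<N. \<Sum>c\<in>A. \<mu> c * f k c)"
      using sum_weight_prod[OF A(1), of \<mu> N f] by simp
    also have "\<dots> = (\<Sum>c\<in>A. \<mu> c * of_bool (c = a)) * ((\<Sum>b\<in>A. \<mu> b * F a b) * (\<Prod>k\<in>{..<N} - {i} - {j}. 1))"
      unfolding rem using ij A(2) by (auto simp: f_def intro!: prod.neutral)
    also have "(\<Sum>c\<in>A. \<mu> c * of_bool (c = a)) = \<mu> a"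
      using A(1) a by (subst sum.remove[of _ a]) (auto intro!: sum.neutral)
    finally show ?thesis by simp
  qed
  have "(\<Sum>g\<in>codebooks N A. weight \<mu> N g * F (g i) (g j)) =
      (\<Sum>g\<in>codebooks N A. \<Sum>a\<in>A. weight \<mu> N g * (of_bool (g i = a) * F a (g j)))"
  proof (rule sum.cong[OF refl])
    fix g assume "g \<in> codebooks N A"
    then have g: "g i \<in> A" using ij by (auto simp: codebooks_def)
    have "(\<Sum>a\<in>A. weight \<mu> N g * (of_bool (g i = a) * F a (g j))) = (\<Sum>a\<in>A. if a = g i then weight \<mu> N g * F a (g j) else 0)"
      by (intro sum.cong refl) auto
    then show "weight \<mu> N g * F (g i) (g j) = (\<Sum>a\<in>A. weight \<mu> N g * (of_bool (g i = a) * F a (g j)))"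
      using A(1) g by simp
  qed
  also have "\<dots> = (\<Sum>a\<in>A. \<mu> a * (\<Sum>b\<in>A. \<mu> b * F a b))"
    by (subst sum.swap) (intro sum.cong refl fixed)
  finally show ?thesis by (simp add: sum_distrib_left mult.assoc)
qed

locale random_codebooks =
  fixes A :: "'x set" and B :: "'y set" and \<mu> :: "'x \<Rightarrow> real" and \<nu> :: "'y \<Rightarrow> real" and N1 N2 :: nat
  assumes A: "finite A" "sum \<mu> A = 1" and B: "finite B" "sum \<nu> B = 1"
    and \<mu>0: "\<And>a. a \<in> A \<Longrightarrow> 0 \<le> \<mu> a" and \<nu>0: "\<And>b. b \<in> B \<Longrightarrow> 0 \<le> \<nu> b"
begin

definition expct :: "((nat \<Rightarrow> 'x) \<Rightarrow> (nat \<Rightarrow> 'y) \<Rightarrow> real) \<Rightarrow> real" where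
  "expct F = (\<Sum>g\<in>codebooks N1 A. weight \<mu> N1 g * (\<Sum>h\<in>codebooks N2 B. weight \<nu> N2 h * F g h))"

lemma expct_add: "expct (\<lambda>g h. F g h + G g h) = expct F + expct G"
  by (simp add: expct_def distrib_left sum.distrib)

lemma expct_sum: "expct (\<lambda>g h. \<Sum>k\<in>K. F k g h) = (\<Sum>k\<in>K. expct (F k))"
  by (induction K rule: infinite_finite_induct) (simp_all add: expct_add, simp_all add: expct_def)

lemma expct_cmult: "expct (\<lambda>g h. c * F g h) = c * expct F"
  by (simp add: expct_def sum_distrib_left mult_ac)

lemma expct_const: "expct (\<lambda>g h. c) = c"
  by (simp add: expct_def sum_weight[OF A] sum_weight[OF B] flip: sum_distrib_right)

lemma expct_mono:
  assumes "\<And>g h. g \<in> codebooks N1 A \<Longrightarrow> h \<in> codebooks N2 B \<Longrightarrow> F g h \<le> G g h"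
  shows "expct F \<le> expct G"
  unfolding expct_def
  by (intro sum_mono mult_left_mono assms weight_nonneg[of A] weight_nonneg[of B]) (auto intro: \<mu>0 \<nu>0)

lemma ex_codebook_le:
  assumes "expct F < c"
  shows "\<exists>g\<in>codebooks N1 A. \<exists>h\<in>codebooks N2 B. F g h < c"
proof (rule ccontr)
  assume "\<not> ?thesis"
  then have "expct (\<lambda>g h. c) \<le> expct F" by (intro expct_mono) (auto simp: not_less)
  then show False using assms by (simp add: expct_const)
qed

lemma expct_11:
  assumes "i < N1" "m < N2"
  shows "expct (\<lambda>g h. F (g i) (h m)) = (\<Sum>a\<in>A. \<Sum>b\<in>B. \<mu> a * \<nu> b * F a b)"
  unfolding expct_def sum_weight_1[OF B assms(2)] 
  by (subst sum_weight_1[OF A assms(1)]) (simp add: sum_distrib_left mult.assoc)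

lemma expct_12:
  assumes "i < N1" "m < N2" "m' < N2" "m \<noteq> m'"
  shows "expct (\<lambda>g h. F (g i) (h m) (h m')) = (\<Sum>a\<in>A. \<Sum>b\<in>B. \<mu> a * \<nu> b * (\<Sum>b'\<in>B. \<nu> b' * F a b b'))"
  unfolding expct_def sum_weight_2[OF B assms(2-4)]
  by (subst sum_weight_1[OF A assms(1)]) (simp add: sum_distrib_left mult.assoc)

lemma expct_21:
  assumes "i < N1" "i' < N1" "i \<noteq> i'" "m < N2"
  shows "expct (\<lambda>g h. F (g i) (h m) (g i')) = (\<Sum>a\<in>A. \<Sum>b\<in>B. \<mu> a * \<nu> b * (\<Sum>a'\<in>A. \<mu> a' * F a b a'))"
proof -
  have "expct (\<lambda>g h. F (g i) (h m) (g i')) = (\<Sum>a\<in>A. \<Sum>a'\<in>A. \<mu> a * \<mu> a' * (\<Sum>b\<in>B. \<nu> b * F a b a'))"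
    unfolding expct_def
    by (subst sum_weight_1[OF B assms(4)]) (rule sum_weight_2[OF A assms(1-3)])
  also have "\<dots> = (\<Sum>a\<in>A. \<Sum>b\<in>B. \<mu> a * \<nu> b * (\<Sum>a'\<in>A. \<mu> a' * F a b a'))"
    unfolding sum_distrib_left by (rule sum.cong[OF refl], subst sum.swap) (simp add: mult_ac)
  finally show ?thesis .
qed

lemma expct_22:
  assumes "i < N1" "i' < N1" "i \<noteq> i'" "m < N2" "m' < N2" "m \<noteq> m'"
  shows "expct (\<lambda>g h. F (g i) (h m) (g i') (h m')) =
     (\<Sum>a\<in>A. \<Sum>b\<in>B. \<mu> a * \<nu> b * (\<Sum>a'\<in>A. \<Sum>b'\<in>B. \<mu> a' * \<nu> b' * F a b a' b'))"
proof -
  have "expct (\<lambda>g h. F (g i) (h m) (g i') (h m')) =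
      (\<Sum>a\<in>A. \<Sum>a'\<in>A. \<mu> a * \<mu> a' * (\<Sum>b\<in>B. \<Sum>b'\<in>B. \<nu> b * \<nu> b' * F a b a' b'))"
    unfolding expct_def
    by (subst sum_weight_2[OF B assms(4-6)]) (rule sum_weight_2[OF A assms(1-3)])
  also have "\<dots> = (\<Sum>a\<in>A. \<Sum>b\<in>B. \<mu> a * \<nu> b * (\<Sum>a'\<in>A. \<Sum>b'\<in>B. \<mu> a' * \<nu> b' * F a b a' b'))"
    unfolding sum_distrib_left by (rule sum.cong[OF refl], subst sum.swap) (simp add: mult_ac)
  finally show ?thesis .
qed

text \<open>A competing word with a different index is a fresh independent draw, so each sum over
  competitors collapses to their number times one expectation. The true pair (a, b) remains outside,
  ready for a change of measure.\<close>

lemma expct_union_bound: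
  assumes i: "i < N1" and m: "m < N2"
  shows "expct (\<lambda>g h. G0 (g i) (h m) + (\<Sum>m'\<in>{..<N2} - {m}. G2 (g i) (h m) (h m'))
       + (\<Sum>i'\<in>{..<N1} - {i}. G1 (g i) (h m) (g i'))
       + (\<Sum>i'\<in>{..<N1} - {i}. \<Sum>m'\<in>{..<N2} - {m}. G3 (g i) (h m) (g i') (h m')))
    = (\<Sum>a\<in>A. \<Sum>b\<in>B. \<mu> a * \<nu> b * (G0 a b + (real N2 - 1) * (\<Sum>b'\<in>B. \<nu> b' * G2 a b b')
         + (real N1 - 1) * (\<Sum>a'\<in>A. \<mu> a' * G1 a b a')
         + (real N1 - 1) * (real N2 - 1) * (\<Sum>a'\<in>A. \<Sum>b'\<in>B. \<mu> a' * \<nu> b' * G3 a b a' b')))"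
proof -
  have c: "real (card ({..<N1} - {i})) = real N1 - 1" "real (card ({..<N2} - {m})) = real N2 - 1"
    using i m by (auto simp: card_Diff_subset of_nat_diff)
  let ?E2 = "\<Sum>a\<in>A. \<Sum>b\<in>B. \<mu> a * \<nu> b * (\<Sum>b'\<in>B. \<nu> b' * G2 a b b')"
  let ?E1 = "\<Sum>a\<in>A. \<Sum>b\<in>B. \<mu> a * \<nu> b * (\<Sum>a'\<in>A. \<mu> a' * G1 a b a')"
  let ?E3 = "\<Sum>a\<in>A. \<Sum>b\<in>B. \<mu> a * \<nu> b * (\<Sum>a'\<in>A. \<Sum>b'\<in>B. \<mu> a' * \<nu> b' * G3 a b a' b')"
  have "(\<Sum>m'\<in>{..<N2} - {m}. expct (\<lambda>g h. G2 (g i) (h m) (h m'))) = (\<Sum>m'\<in>{..<N2} - {m}. ?E2)"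
    using i m by (intro sum.cong refl expct_12) auto
  moreover have "(\<Sum>i'\<in>{..<N1} - {i}. expct (\<lambda>g h. G1 (g i) (h m) (g i'))) = (\<Sum>i'\<in>{..<N1} - {i}. ?E1)"
    using i m by (intro sum.cong refl expct_21) auto
  moreover have "(\<Sum>i'\<in>{..<N1} - {i}. \<Sum>m'\<in>{..<N2} - {m}. expct (\<lambda>g h. G3 (g i) (h m) (g i') (h m')))
      = (\<Sum>i'\<in>{..<N1} - {i}. \<Sum>m'\<in>{..<N2} - {m}. ?E3)"
    using i m by (intro sum.cong refl expct_22) auto
  ultimately have "expct (\<lambda>g h. G0 (g i) (h m) + (\<Sum>m'\<in>{..<N2} - {m}. G2 (g i) (h m) (h m'))
       + (\<Sum>i'\<in>{..<N1} - {i}. G1 (g i) (h m) (g i'))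
       + (\<Sum>i'\<in>{..<N1} - {i}. \<Sum>m'\<in>{..<N2} - {m}. G3 (g i) (h m) (g i') (h m')))
    = (\<Sum>a\<in>A. \<Sum>b\<in>B. \<mu> a * \<nu> b * G0 a b) + (real N2 - 1) * ?E2 + (real N1 - 1) * ?E1
       + (real N1 - 1) * (real N2 - 1) * ?E3"
    by (simp add: expct_add expct_sum expct_11[OF i m] c mult.assoc)
  also have "\<dots> = (\<Sum>a\<in>A. \<Sum>b\<in>B. \<mu> a * \<nu> b * (G0 a b + (real N2 - 1) * (\<Sum>b'\<in>B. \<nu> b' * G2 a b b')
         + (real N1 - 1) * (\<Sum>a'\<in>A. \<mu> a' * G1 a b a')
         + (real N1 - 1) * (real N2 - 1) * (\<Sum>a'\<in>A. \<Sum>b'\<in>B. \<mu> a' * \<nu> b' * G3 a b a' b')))"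
    unfolding distrib_left sum.distrib by (simp only: sum_distrib_left[of "_ :: real" _ A] sum_distrib_left[of "_ :: real" _ B] mult_ac)
  finally show ?thesis .
qed

end

subsection \<open>The random coding ensemble\<close>

locale cognitive_mac =
  fixes W :: "'a::finite \<Rightarrow> 'b::finite \<Rightarrow> 'c::finite \<Rightarrow> real" and q :: "'a \<Rightarrow> 'b \<Rightarrow> 'c \<Rightarrow> real"
    and PX :: "'a \<times> 'b \<Rightarrow> real"
  assumes W: "is_channel W" and PX: "is_pmf PX"
begin

definition P :: "'a \<times> 'b \<times> 'c \<Rightarrow> real" where "P = (\<lambda>(x1, x2, y). PX (x1, x2) * W x1 x2 y)"
definition P1 :: "'a \<Rightarrow> real" where "P1 = marg PX fst"
definition P2 :: "'b \<Rightarrow> real" where "P2 = marg PX snd"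
definition info_density :: "'a \<times> 'b \<Rightarrow> real" where "info_density w = log 2 (PX w / (P1 (fst w) * P2 (snd w)))"
text \<open>The l1 norm of the information density: it bounds the change of the mean density when
  the law moves by \<open>\<eta>\<close> in each coordinate.\<close>

definition density_norm :: real where "density_norm = (\<Sum>w\<in>UNIV. \<bar>info_density w\<bar>)"
text \<open>Closeness alone tolerates a few letters of probability zero, where the information
  density is meaningless and the joint likelihood vanishes; the second condition excludes
  them.\<close>

definition typical :: "real \<Rightarrow> nat \<Rightarrow> (nat \<Rightarrow> 'a) \<Rightarrow> (nat \<Rightarrow> 'b) \<Rightarrow> bool" where
  "typical \<eta> n a b \<longleftrightarrow> near \<eta> (emp n (\<lambda>t. (a t, b t))) PX \<and> (\<forall>t<n. PX (a t, b t) \<noteq> 0)"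
definition Wn :: "nat \<Rightarrow> (nat \<Rightarrow> 'a) \<Rightarrow> (nat \<Rightarrow> 'b) \<Rightarrow> (nat \<Rightarrow> 'c) \<Rightarrow> real" where
  "Wn n a b y = (\<Prod>t<n. W (a t) (b t) (y t))"

abbreviation "joint n a b \<equiv> iid PX n (\<lambda>t. (a t, b t))"

lemma PX0: "0 \<le> PX w" using PX unfolding is_pmf_def by blast
lemma pmf_P1: "is_pmf P1" unfolding P1_def by (rule is_pmf_marg[OF PX])
lemma pmf_P2: "is_pmf P2" unfolding P2_def by (rule is_pmf_marg[OF PX])
lemma P10: "0 \<le> P1 x" using pmf_P1 by (auto simp: is_pmf_def)
lemma P20: "0 \<le> P2 x" using pmf_P2 by (auto simp: is_pmf_def)
lemma Wn0: "0 \<le> Wn n a b y" using W unfolding Wn_def by (auto simp: is_channel_def intro!: prod_nonneg)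
lemma sum_Wn: "(\<Sum>y\<in>seqs n. Wn n a b y) = 1" unfolding Wn_def by (rule sum_channel_seqs[OF W])

lemma marg_P: "marg P pX1X2 = PX"
proof
  fix w :: "'a \<times> 'b"
  have "marg P pX1X2 w = (\<Sum>y\<in>UNIV. P (fst w, snd w, y))"
    unfolding marg_def by (rule sum.reindex_bij_witness[of _ "\<lambda>y. (fst w, snd w, y)" "\<lambda>(x1, x2, y). y"]) auto
  also have "\<dots> = PX w * (\<Sum>y\<in>UNIV. W (fst w) (snd w) y)" by (simp add: P_def sum_distrib_left)
  finally show "marg P pX1X2 w = PX w" using W by (simp add: is_channel_def)
qed

lemma pmf_P: "is_pmf P"
  unfolding is_pmf_def
proof (intro conjI allI)
  fix w show "0 \<le> P w" using W PX0 by (auto simp: P_def is_channel_def split: prod.splits)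
  have "(\<Sum>w\<in>UNIV. P w) = (\<Sum>z\<in>UNIV. marg P pX1X2 z)" using sum_marg[of P pX1X2 "\<lambda>_. 1"] by simp
  then show "(\<Sum>w\<in>UNIV. P w) = 1" using PX by (simp add: marg_P is_pmf_def)
qed

lemma mi_PX: "mi PX = (\<Sum>w\<in>UNIV. PX w * info_density w)"
  unfolding mi_def info_density_def P1_def P2_def by (intro sum.cong refl) auto

lemma sum_info_density:
  assumes "typical \<eta> n a b" "n > 0"
  shows "\<bar>(\<Sum>t<n. info_density (a t, b t)) - real n * mi PX\<bar> \<le> real n * (\<eta> * density_norm)"
proof -
  have "(\<Sum>t<n. info_density (a t, b t)) = (\<Sum>w\<in>UNIV. emp n (\<lambda>t. (a t, b t)) w * info_density w) * real n"
    by (rule sum_emp[OF assms(2), symmetric])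
  then have "\<bar>(\<Sum>t<n. info_density (a t, b t)) - real n * mi PX\<bar> =
      real n * \<bar>(\<Sum>w\<in>UNIV. emp n (\<lambda>t. (a t, b t)) w * info_density w) - (\<Sum>w\<in>UNIV. PX w * info_density w)\<bar>"
    by (simp add: mi_PX abs_mult right_diff_distrib[symmetric] mult.commute[of _ "real n"])
  also have "\<dots> \<le> real n * (\<eta> * density_norm)"
    unfolding density_norm_def using assms(1) by (intro mult_left_mono near_sum) (auto simp: typical_def)
  finally show ?thesis .
qed

lemma iid_PX_info_density:
  assumes "typical \<eta> n a b"
  shows "joint n a b = iid P1 n a * iid P2 n b * 2 powr (\<Sum>t<n. info_density (a t, b t))"
proof -
  have "PX (a t, b t) = P1 (a t) * P2 (b t) * 2 powr (info_density (a t, b t))" if "t < n" for t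
  proof -
    have "PX (a t, b t) \<noteq> 0" using assms that by (simp add: typical_def)
    then have "PX (a t, b t) > 0" "P1 (a t) > 0" "P2 (b t) > 0"
      using PX0[of "(a t, b t)"] marg_pos[of PX "(a t, b t)" fst] marg_pos[of PX "(a t, b t)" snd] PX0
      by (auto simp: P1_def P2_def less_le)
    then show ?thesis by (simp add: info_density_def)
  qed
  then show ?thesis by (simp add: iid_def prod.distrib powr_sum)
qed

text \<open>The change of measure from independent codewords to the joint input law. Its exponential
  gain offsets the number of codewords in a bin.\<close>

lemma product_le_joint:
  assumes "typical \<eta> n a b" "n > 0"
  shows "iid P1 n a * iid P2 n b \<le> 2 powr (- (real n * (mi PX - \<eta> * density_norm))) * joint n a b"
proof -
  let ?s = "\<Sum>t<n. info_density (a t, b t)"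
  have "iid P1 n a * iid P2 n b = 2 powr (- ?s) * joint n a b"
    by (simp add: iid_PX_info_density[OF assms(1)] powr_minus)
  also have "\<dots> \<le> 2 powr (- (real n * (mi PX - \<eta> * density_norm))) * joint n a b"
    using sum_info_density[OF assms] by (intro mult_right_mono powr_mono iid_nonneg PX0) (auto simp: algebra_simps abs_le_iff)
  finally show ?thesis .
qed

lemma joint_le_product:
  assumes "typical \<eta> n a b" "n > 0"
  shows "joint n a b \<le> 2 powr (real n * (mi PX + \<eta> * density_norm)) * (iid P1 n a * iid P2 n b)"
proof -
  let ?s = "\<Sum>t<n. info_density (a t, b t)"
  have "joint n a b = 2 powr ?s * (iid P1 n a * iid P2 n b)"
    by (simp add: iid_PX_info_density[OF assms(1)])
  also have "\<dots> \<le> 2 powr (real n * (mi PX + \<eta> * density_norm)) * (iid P1 n a * iid P2 n b)"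
    using sum_info_density[OF assms]
    by (intro mult_right_mono powr_mono mult_nonneg_nonneg iid_nonneg P10 P20) (auto simp: algebra_simps abs_le_iff)
  finally show ?thesis .
qed

lemma prob_not_typical:
  assumes "n > 0" "0 < \<eta>" "\<eta> \<le> 1"
  shows "(\<Sum>a\<in>seqs n. \<Sum>b\<in>seqs n. joint n a b * of_bool (\<not> typical \<eta> n a b))
     \<le> 2 * real CARD('a \<times> 'b) * exp (- (real n * \<eta>\<^sup>2 / 4))"
proof -
  have "(\<Sum>a\<in>seqs n. \<Sum>b\<in>seqs n. joint n a b * of_bool (\<not> typical \<eta> n a b))
      \<le> (\<Sum>a\<in>seqs n. \<Sum>b\<in>seqs n. (\<lambda>x. iid PX n x * of_bool (\<not> near \<eta> (emp n x) PX)) (\<lambda>t. (a t, b t)))"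
  proof (intro sum_mono)
    fix a b
    have "joint n a b = 0" if "t < n" "PX (a t, b t) = 0" for t
      unfolding iid_def using that by (intro prod_zero) auto
    then show "joint n a b * of_bool (\<not> typical \<eta> n a b)
       \<le> (\<lambda>x. iid PX n x * of_bool (\<not> near \<eta> (emp n x) PX)) (\<lambda>t. (a t, b t))"
      using iid_nonneg[of PX n "\<lambda>t. (a t, b t)"] PX0 by (auto simp: typical_def)
  qed
  also have "\<dots> = (\<Sum>x\<in>seqs n. iid PX n x * of_bool (\<not> near \<eta> (emp n x) PX))"
    by (rule sum_seqs_pair) (simp cong: emp_cong iid_cong)
  also have "\<dots> = (\<Sum>x\<in>{x \<in> seqs n. \<not> near \<eta> (emp n x) PX}. iid PX n x)"
    unfolding sum.inter_filter[OF finite_seqs] by (intro sum.cong refl) simp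
  also have "\<dots> \<le> 2 * real CARD('a \<times> 'b) * exp (- (real n * \<eta>\<^sup>2 / 4))"
    by (rule prob_not_near[OF PX assms])
  finally show ?thesis .
qed

lemma sum_joint_second: "(\<Sum>b\<in>seqs n. joint n a b) = iid P1 n a"
proof -
  have "P1 x = (\<Sum>b\<in>UNIV. PX (x, b))" for x
    unfolding P1_def marg_def by (rule sum.reindex_bij_witness[of _ "\<lambda>b. (x, b)" snd]) auto
  then show ?thesis unfolding iid_def seqs_def by (subst prod_sum_PiE[symmetric]) auto
qed

lemma prob_not_near_joint:
  assumes "n > 0" "0 < \<eta>" "\<eta> \<le> 1"
  shows "(\<Sum>a\<in>seqs n. \<Sum>b\<in>seqs n. joint n a b *
     (\<Sum>y\<in>seqs n. Wn n a b y * of_bool (\<not> near \<eta> (emp n (\<lambda>t. (a t, b t, y t))) P)))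
     \<le> 2 * real CARD('a \<times> 'b \<times> 'c) * exp (- (real n * \<eta>\<^sup>2 / 4))"
proof -
  let ?F = "\<lambda>x. iid P n x * of_bool (\<not> near \<eta> (emp n x) P)"
  have "(\<Sum>a\<in>seqs n. \<Sum>b\<in>seqs n. joint n a b *
     (\<Sum>y\<in>seqs n. Wn n a b y * of_bool (\<not> near \<eta> (emp n (\<lambda>t. (a t, b t, y t))) P)))
    = (\<Sum>a\<in>seqs n. \<Sum>b\<in>seqs n. \<Sum>y\<in>seqs n. (\<lambda>z. ?F (\<lambda>t. (a t, z t))) (\<lambda>t. (b t, y t)))"
    unfolding sum_distrib_left
    by (intro sum.cong refl) (simp add: iid_def Wn_def P_def prod.distrib)
  also have "\<dots> = (\<Sum>a\<in>seqs n. \<Sum>z\<in>seqs n. ?F (\<lambda>t. (a t, z t)))"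
    by (intro sum.cong refl sum_seqs_pair) (simp cong: emp_cong iid_cong)
  also have "\<dots> = (\<Sum>x\<in>seqs n. ?F x)"
    by (rule sum_seqs_pair) (simp cong: emp_cong iid_cong)
  also have "\<dots> = (\<Sum>x\<in>{x \<in> seqs n. \<not> near \<eta> (emp n x) P}. iid P n x)"
    unfolding sum.inter_filter[OF finite_seqs] by (intro sum.cong refl) simp
  also have "\<dots> \<le> 2 * real CARD('a \<times> 'b \<times> 'c) * exp (- (real n * \<eta>\<^sup>2 / 4))"
    by (rule prob_not_near[OF pmf_P assms])
  finally show ?thesis .
qed

text \<open>Up to the factor 1/4, the inverse of the bound on the ratio of joint to product law at
  typical pairs. The 1/4 caps the joint mass of typical pairs whose first word is not
  coverable.\<close>

definition cover_prob :: "real \<Rightarrow> nat \<Rightarrow> real" where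
  "cover_prob \<eta> n = 2 powr (- (real n * (mi PX + \<eta> * density_norm))) / 4"

abbreviation "typical_mass \<eta> n a \<equiv> (\<Sum>b\<in>seqs n. iid P2 n b * of_bool (typical \<eta> n a b))"

text \<open>A bin can serve a first codeword reliably only if a random second codeword is typical
  with it often enough. First codewords are drawn from these sequences only, by conditioning the
  product law.\<close>

definition coverable :: "real \<Rightarrow> nat \<Rightarrow> (nat \<Rightarrow> 'a) set" where
  "coverable \<eta> n = {a \<in> seqs n. cover_prob \<eta> n \<le> typical_mass \<eta> n a}"

abbreviation "coverable_mass \<eta> n \<equiv> (\<Sum>a\<in>coverable \<eta> n. iid P1 n a)"

definition \<mu> :: "real \<Rightarrow> nat \<Rightarrow> (nat \<Rightarrow> 'a) \<Rightarrow> real" where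
  "\<mu> \<eta> n a = iid P1 n a / coverable_mass \<eta> n"

lemma finite_coverable: "finite (coverable \<eta> n)" unfolding coverable_def by simp

text \<open>The joint mass 1 splits into three parts: atypical pairs, at most 1/4; typical pairs
  with coverable first word, at most the mass sought; and typical pairs without, which by
  \<open>joint_le_product\<close> and the definition of \<open>cover_prob\<close> have mass at most
  1/4.\<close>

lemma prob_coverable:
  assumes n: "n > 0" "0 < \<eta>" "\<eta> \<le> 1" and small: "2 * real CARD('a \<times> 'b) * exp (- (real n * \<eta>\<^sup>2 / 4)) \<le> 1/4"
  shows "coverable_mass \<eta> n \<ge> 1/2"
proof -
  let ?J = "\<lambda>a b. joint n a b"
  have sp: "(\<Sum>a\<in>seqs n. F a) = (\<Sum>a\<in>coverable \<eta> n. F a) + (\<Sum>a\<in>seqs n - coverable \<eta> n. F a)" for F :: "_ \<Rightarrow> real"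
    by (subst sum.subset_diff[of "coverable \<eta> n"]) (auto simp: coverable_def)
  have "1 = (\<Sum>a\<in>seqs n. iid P1 n a)" by (rule iid_sum_pmf[OF pmf_P1, symmetric])
  also have "\<dots> = (\<Sum>a\<in>seqs n. \<Sum>b\<in>seqs n. ?J a b)" by (simp add: sum_joint_second)
  also have "\<dots> = (\<Sum>a\<in>seqs n. \<Sum>b\<in>seqs n. ?J a b * of_bool (\<not> typical \<eta> n a b))
       + (\<Sum>a\<in>seqs n. \<Sum>b\<in>seqs n. ?J a b * of_bool (typical \<eta> n a b))"
    unfolding sum.distrib[symmetric] by (intro sum.cong refl) auto
  also have "\<dots> \<le> 1/4 + (\<Sum>a\<in>seqs n. \<Sum>b\<in>seqs n. ?J a b * of_bool (typical \<eta> n a b))"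
    using order_trans[OF prob_not_typical[OF n] small] by simp
  also have "(\<Sum>a\<in>seqs n. \<Sum>b\<in>seqs n. ?J a b * of_bool (typical \<eta> n a b))
      = (\<Sum>a\<in>coverable \<eta> n. \<Sum>b\<in>seqs n. ?J a b * of_bool (typical \<eta> n a b))
      + (\<Sum>a\<in>seqs n - coverable \<eta> n. \<Sum>b\<in>seqs n. ?J a b * of_bool (typical \<eta> n a b))"
    by (rule sp)
  also have "(\<Sum>a\<in>coverable \<eta> n. \<Sum>b\<in>seqs n. ?J a b * of_bool (typical \<eta> n a b)) \<le> (\<Sum>a\<in>coverable \<eta> n. \<Sum>b\<in>seqs n. ?J a b)"
    by (intro sum_mono) (auto intro!: iid_nonneg PX0)
  also have "(\<Sum>a\<in>coverable \<eta> n. \<Sum>b\<in>seqs n. ?J a b) = coverable_mass \<eta> n" by (simp add: sum_joint_second)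
  also have "(\<Sum>a\<in>seqs n - coverable \<eta> n. \<Sum>b\<in>seqs n. ?J a b * of_bool (typical \<eta> n a b))
      \<le> (\<Sum>a\<in>seqs n - coverable \<eta> n. iid P1 n a * (1/4))"
  proof (rule sum_mono)
    fix a assume a: "a \<in> seqs n - coverable \<eta> n"
    let ?M = "2 powr (real n * (mi PX + \<eta> * density_norm))"
    have "(\<Sum>b\<in>seqs n. ?J a b * of_bool (typical \<eta> n a b)) \<le> (\<Sum>b\<in>seqs n. ?M * iid P1 n a * (iid P2 n b * of_bool (typical \<eta> n a b)))"
      using joint_le_product[of \<eta> n a] n(1) by (intro sum_mono) (auto simp: mult.assoc)
    also have "\<dots> = ?M * iid P1 n a * typical_mass \<eta> n a"
      by (simp only: sum_distrib_left)
    also have "\<dots> \<le> ?M * iid P1 n a * cover_prob \<eta> n"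
      using a by (intro mult_left_mono mult_nonneg_nonneg iid_nonneg P10) (auto simp: coverable_def)
    also have "\<dots> = iid P1 n a * (1/4)" by (simp add: cover_prob_def powr_minus)
    finally show "(\<Sum>b\<in>seqs n. ?J a b * of_bool (typical \<eta> n a b)) \<le> iid P1 n a * (1/4)" .
  qed
  also have "(\<Sum>a\<in>seqs n - coverable \<eta> n. iid P1 n a * (1/4)) \<le> (\<Sum>a\<in>seqs n. iid P1 n a * (1/4))"
    by (rule sum_mono2) (auto intro!: mult_nonneg_nonneg iid_nonneg P10)
  also have "\<dots> = 1/4" using iid_sum_pmf[OF pmf_P1, of n] by (simp add: sum_divide_distrib[symmetric])
  finally show ?thesis by simp
qed

end

subsection \<open>Union bound for a jointly typical pair\<close>

lemma weighted_tail:
  fixes z :: "nat \<Rightarrow> 'z::finite" and p :: "'x::finite \<Rightarrow> real"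
  assumes "n > 0" "is_pmf p" "CARD('x \<times> 'z) \<le> D"
  shows "(\<Sum>x\<in>seqs n. iid p n x * of_bool (c \<le> ent (emp n x) + ent (emp n z) - ent (emp n (\<lambda>t. (x t, z t)))))
     \<le> real (n + 1) ^ D * 2 powr (- (real n * c))"
proof -
  let ?E = "{x \<in> seqs n. c \<le> ent (emp n x) + ent (emp n z) - ent (emp n (\<lambda>t. (x t, z t)))}"
  have "(\<Sum>x\<in>seqs n. iid p n x * of_bool (c \<le> ent (emp n x) + ent (emp n z) - ent (emp n (\<lambda>t. (x t, z t)))))
     = (\<Sum>x\<in>?E. iid p n x)"
    unfolding sum.inter_filter[OF finite_seqs] by (intro sum.cong refl) simp
  also have "\<dots> \<le> real (n + 1) ^ CARD('x \<times> 'z) * 2 powr (- (real n * c))"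
    by (rule prob_empirical_mi_ge[OF assms(1,2)]) auto
  also have "\<dots> \<le> real (n + 1) ^ D * 2 powr (- (real n * c))"
    using assms(3) by (intro mult_right_mono power_increasing) auto
  finally show ?thesis .
qed

context cognitive_mac
begin

definition confusable :: "nat \<Rightarrow> nat \<Rightarrow> real \<Rightarrow> nat \<Rightarrow> (nat \<Rightarrow> nat \<Rightarrow> 'a) \<Rightarrow> (nat \<Rightarrow> nat \<Rightarrow> 'b) \<Rightarrow> nat \<Rightarrow> nat \<Rightarrow> (nat \<Rightarrow> 'c) \<Rightarrow> bool" where
  "confusable N1 N2 \<eta> n g h i m y \<longleftrightarrow> (\<exists>i'<N1. \<exists>m'<N2. (i', m') \<noteq> (i, m) \<and> typical \<eta> n (g i') (h m') \<and>
     (\<Sum>t<n. q (g i t) (h m t) (y t)) \<le> (\<Sum>t<n. q (g i' t) (h m' t) (y t)))"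

text \<open>Atypical pairs count as 0 because they are never sent. Competitors range over all
  typical pairs of the codebook, so the quantity can be averaged before any encoder has been
  chosen.\<close>

definition pair_err :: "nat \<Rightarrow> nat \<Rightarrow> real \<Rightarrow> nat \<Rightarrow> (nat \<Rightarrow> nat \<Rightarrow> 'a) \<Rightarrow> (nat \<Rightarrow> nat \<Rightarrow> 'b) \<Rightarrow> nat \<Rightarrow> nat \<Rightarrow> real" where
  "pair_err N1 N2 \<eta> n g h i m = of_bool (typical \<eta> n (g i) (h m)) *
     (\<Sum>y\<in>seqs n. Wn n (g i) (h m) y * of_bool (confusable N1 N2 \<eta> n g h i m y))"

lemma random_codebooks_coverable:
  assumes "coverable_mass \<eta> n \<ge> 1/2"
  shows "random_codebooks (coverable \<eta> n) (seqs n) (\<mu> \<eta> n) (iid P2 n)"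
proof
  show "sum (\<mu> \<eta> n) (coverable \<eta> n) = 1"
    using assms by (simp add: \<mu>_def sum_divide_distrib[symmetric])
  show "0 \<le> \<mu> \<eta> n a" for a unfolding \<mu>_def
    by (intro divide_nonneg_nonneg sum_nonneg iid_nonneg P10)
qed (auto simp: finite_coverable iid_sum_pmf[OF pmf_P2] intro!: iid_nonneg P20)

lemma \<mu>_le:
  assumes "coverable_mass \<eta> n \<ge> 1/2"
  shows "\<mu> \<eta> n a \<le> 2 * iid P1 n a"
proof -
  let ?Z = "\<Sum>a\<in>coverable \<eta> n. iid P1 n a"
  have "iid P1 n a * 1 \<le> iid P1 n a * (2 * ?Z)" using assms by (intro mult_left_mono iid_nonneg P10) auto
  then show ?thesis using assms by (simp add: \<mu>_def pos_divide_le_eq mult_ac)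
qed

text \<open>Conditioning on an event of probability at least 1/2 costs a factor 2, so tail bounds
  for unconditioned words carry over.\<close>

lemma sum_\<mu>_le:
  assumes Z: "coverable_mass \<eta> n \<ge> 1/2" and "\<And>a. 0 \<le> F a"
  shows "(\<Sum>a\<in>coverable \<eta> n. \<mu> \<eta> n a * F a) \<le> 2 * (\<Sum>a\<in>seqs n. iid P1 n a * F a)"
proof -
  have "(\<Sum>a\<in>coverable \<eta> n. \<mu> \<eta> n a * F a) \<le> (\<Sum>a\<in>coverable \<eta> n. (2 * iid P1 n a) * F a)"
    by (intro sum_mono mult_right_mono \<mu>_le Z assms)
  also have "\<dots> \<le> (\<Sum>a\<in>seqs n. (2 * iid P1 n a) * F a)"
    by (rule sum_mono2) (auto simp: coverable_def intro!: mult_nonneg_nonneg iid_nonneg P10 assms)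
  finally show ?thesis by (simp add: sum_distrib_left mult.assoc)
qed

text \<open>For a fixed true pair and each output separately, averaging over the other codewords
  gives at most \<open>8 * u\<close>: 2 for second words, 4 for first words, 2 for pairs. Afterwards
  the true pair is moved to the joint law, under which an atypical output is exponentially rare. The
  leading 2 comes from conditioning the true first codeword.\<close>

lemma expected_pair_err:
  assumes n: "n > 0" and Z: "coverable_mass \<eta> n \<ge> 1/2"
    and \<eta>: "0 < \<eta>" "\<eta> \<le> \<theta>" and \<theta>: "0 < \<theta>" "\<theta> \<le> 1"
    and N: "real N1 \<le> 2 powr (real n * s1)" "real N2 \<le> 2 powr (real n * s2)"
    and s0: "0 \<le> s1" "0 \<le> s2"
    and M: "\<And>a b y a' b'. near \<theta> (emp n (\<lambda>t. (a t, b t, y t))) P \<Longrightarrow>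
      near \<theta> (emp n (\<lambda>t. (a' t, b' t))) PX \<Longrightarrow>
      (\<Sum>t<n. q (a t) (b t) (y t)) \<le> (\<Sum>t<n. q (a' t) (b' t) (y t)) \<Longrightarrow>
      separates s1 s2 \<theta> n a b y a' b'"
    and im: "i < N1" "m < N2"
  defines "D \<equiv> CARD('a \<times> 'b \<times> 'c)"
  shows "random_codebooks.expct (coverable \<eta> n) (seqs n) (\<mu> \<eta> n) (iid P2 n) N1 N2
     (\<lambda>g h. pair_err N1 N2 \<eta> n g h i m) \<le>
     2 * 2 powr (- (real n * (mi PX - \<eta> * density_norm))) *
       (2 * real D * exp (- (real n * \<theta>\<^sup>2 / 4)) + 8 * real (n + 1) ^ D * 2 powr (- (real n * \<theta>)))"
proof -
  let ?A = "coverable \<eta> n" and ?B = "seqs n :: (nat \<Rightarrow> 'b) set"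
  interpret rc: random_codebooks ?A ?B "\<mu> \<eta> n" "iid P2 n" N1 N2
    by (rule random_codebooks_coverable[OF Z])
  define u where "u = real (n + 1) ^ D * 2 powr (- (real n * \<theta>))"
  have u0: "u \<ge> 0" by (simp add: u_def)
  define S where "S a b = (of_bool (typical \<eta> n a b) :: real)" for a b
  define T where "T a b y = (of_bool (\<not> near \<theta> (emp n (\<lambda>t. (a t, b t, y t))) P) :: real)" for a b y
  \<comment> \<open>Two events are charged to a wrong second word: dependence on (a, y) when the
    first index is right, and dependence on y alone when both are wrong. The latter needs a union
    over second words only, although the first index is wrong as well. \<open>K1\<close> is the
    mirror image.\<close>
  define K2 where "K2 a y b' = (of_bool (s2 + \<theta> \<le> ent (emp n b') + ent (emp n (\<lambda>t. (a t, y t))) - ent (emp n (\<lambda>t. (b' t, a t, y t)))) :: real)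
     + of_bool (s2 + \<theta> \<le> ent (emp n b') + ent (emp n y) - ent (emp n (\<lambda>t. (b' t, y t))))"
    for a :: "nat \<Rightarrow> 'a" and y :: "nat \<Rightarrow> 'c" and b' :: "nat \<Rightarrow> 'b"
  define K1 where "K1 b y a' = (of_bool (s1 + \<theta> \<le> ent (emp n a') + ent (emp n (\<lambda>t. (b t, y t))) - ent (emp n (\<lambda>t. (a' t, b t, y t)))) :: real)
     + of_bool (s1 + \<theta> \<le> ent (emp n a') + ent (emp n y) - ent (emp n (\<lambda>t. (a' t, y t))))"
    for a' :: "nat \<Rightarrow> 'a" and y :: "nat \<Rightarrow> 'c" and b :: "nat \<Rightarrow> 'b"
  define K3 where "K3 y a' b' = (of_bool (s1 + s2 + \<theta> \<le> ent (emp n a') + ent (emp n b') + ent (emp n y) - ent (emp n (\<lambda>t. (a' t, b' t, y t)))) :: real)"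
    for a' :: "nat \<Rightarrow> 'a" and y :: "nat \<Rightarrow> 'c" and b' :: "nat \<Rightarrow> 'b"
  have K0: "0 \<le> K1 b y a'" "0 \<le> K2 a y b'" "0 \<le> K3 y a' b'" "0 \<le> T a b y" "0 \<le> S a b" for a b y a' b'
    by (auto simp: K1_def K2_def K3_def T_def S_def)
  have cards: "CARD('b \<times> 'a \<times> 'c) \<le> D" "CARD('b \<times> 'c) \<le> D" "CARD('a \<times> 'b \<times> 'c) \<le> D" "CARD('a \<times> 'c) \<le> D"
    by (auto simp: D_def Suc_le_eq)
  have pw20: "real (N - 1) * (r * 2 powr (- (real n * (s + \<theta>)))) \<le> r * 2 powr (- (real n * \<theta>))"
    if "real N \<le> 2 powr (real n * s)" "0 \<le> r" for N s r
  proof -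
    have "real (N - 1) * (r * 2 powr (- (real n * (s + \<theta>)))) \<le> 2 powr (real n * s) * (r * 2 powr (- (real n * (s + \<theta>))))"
      using that by (intro mult_right_mono) auto
    also have "\<dots> = r * 2 powr (real n * s + - (real n * (s + \<theta>)))" unfolding powr_add by simp
    also have "real n * s + - (real n * (s + \<theta>)) = - (real n * \<theta>)" by (simp add: algebra_simps)
    finally show ?thesis .
  qed
  have r1: "real N1 - 1 = real (N1 - 1)" and r2: "real N2 - 1 = real (N2 - 1)"
    using im by (simp_all add: of_nat_diff)
  let ?t = "\<lambda>s. real (n + 1) ^ D * 2 powr (- (real n * (s + \<theta>)))"
  have t2: "(real N2 - 1) * (\<Sum>b'\<in>?B. iid P2 n b' * K2 a y b') \<le> 2 * u" for a y
  proof -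
    have "(\<Sum>b'\<in>?B. iid P2 n b' * K2 a y b') \<le> 2 * ?t s2"
      using weighted_tail[OF n pmf_P2 cards(1), of "s2 + \<theta>" "\<lambda>t. (a t, y t)"] weighted_tail[OF n pmf_P2 cards(2), of "s2 + \<theta>" y]
      unfolding K2_def distrib_left sum.distrib by linarith
    then have "(real N2 - 1) * (\<Sum>b'\<in>?B. iid P2 n b' * K2 a y b') \<le> real (N2 - 1) * (2 * ?t s2)"
      unfolding r2 by (rule mult_left_mono) simp
    also have "\<dots> \<le> 2 * u" using pw20[OF N(2), of "real (n + 1) ^ D"] unfolding u_def by simp
    finally show ?thesis .
  qed
  have t1: "(real N1 - 1) * (\<Sum>a'\<in>?A. \<mu> \<eta> n a' * K1 b y a') \<le> 4 * u" for b y
  proof -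
    have "(\<Sum>a'\<in>?A. \<mu> \<eta> n a' * K1 b y a') \<le> 2 * (\<Sum>a'\<in>seqs n. iid P1 n a' * K1 b y a')"
      by (rule sum_\<mu>_le[OF Z K0(1)])
    also have "(\<Sum>a'\<in>seqs n. iid P1 n a' * K1 b y a') \<le> 2 * ?t s1"
      using weighted_tail[OF n pmf_P1 cards(3), of "s1 + \<theta>" "\<lambda>t. (b t, y t)"] weighted_tail[OF n pmf_P1 cards(4), of "s1 + \<theta>" y]
      unfolding K1_def distrib_left sum.distrib by linarith
    finally have "(\<Sum>a'\<in>?A. \<mu> \<eta> n a' * K1 b y a') \<le> 4 * ?t s1"
      by linarith
    then have "(real N1 - 1) * (\<Sum>a'\<in>?A. \<mu> \<eta> n a' * K1 b y a') \<le> real (N1 - 1) * (4 * ?t s1)"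
      unfolding r1 by (rule mult_left_mono) simp
    also have "\<dots> \<le> 4 * u" using pw20[OF N(1), of "real (n + 1) ^ D"] unfolding u_def by simp
    finally show ?thesis .
  qed
  have t3: "(real N1 - 1) * (real N2 - 1) * (\<Sum>a'\<in>?A. \<Sum>b'\<in>?B. \<mu> \<eta> n a' * iid P2 n b' * K3 y a' b') \<le> 2 * u" for y
  proof -
    have "(\<Sum>a'\<in>?A. \<Sum>b'\<in>?B. \<mu> \<eta> n a' * iid P2 n b' * K3 y a' b') = (\<Sum>a'\<in>?A. \<mu> \<eta> n a' * (\<Sum>b'\<in>?B. iid P2 n b' * K3 y a' b'))"
      by (simp only: sum_distrib_left mult.assoc)
    also have "\<dots> \<le> 2 * (\<Sum>a'\<in>seqs n. iid P1 n a' * (\<Sum>b'\<in>?B. iid P2 n b' * K3 y a' b'))"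
      by (rule sum_\<mu>_le[OF Z]) (intro sum_nonneg mult_nonneg_nonneg iid_nonneg P20 K0)
    also have "(\<Sum>a'\<in>seqs n. iid P1 n a' * (\<Sum>b'\<in>?B. iid P2 n b' * K3 y a' b')) \<le>
        real (n + 1) ^ D * 2 powr (- (real n * (s1 + s2 + \<theta>)))"
      using prob_empirical_triple_ge[OF n pmf_P1 pmf_P2, of "s1 + s2 + \<theta>" y]
      unfolding D_def K3_def by (simp only: sum_distrib_left mult.assoc)
    finally have "(real N1 - 1) * (real N2 - 1) * (\<Sum>a'\<in>?A. \<Sum>b'\<in>?B. \<mu> \<eta> n a' * iid P2 n b' * K3 y a' b')
        \<le> (real N1 - 1) * (real N2 - 1) * (2 * (real (n + 1) ^ D * 2 powr (- (real n * (s1 + s2 + \<theta>)))))"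
      using im by (intro mult_left_mono) auto
    also have "\<dots> \<le> 2 powr (real n * s1) * 2 powr (real n * s2) * (2 * (real (n + 1) ^ D * 2 powr (- (real n * (s1 + s2 + \<theta>)))))"
      using im N by (intro mult_right_mono mult_mono) auto
    also have "\<dots> = 2 * (real (n + 1) ^ D * 2 powr (real n * s1 + real n * s2 + - (real n * (s1 + s2 + \<theta>))))"
      unfolding powr_add by simp
    also have "real n * s1 + real n * s2 + - (real n * (s1 + s2 + \<theta>)) = - (real n * \<theta>)" by (simp add: algebra_simps)
    finally show ?thesis by (simp add: u_def)
  qed
  \<comment> \<open>A second index exists only at positive rate, since \<open>N\<close> is at most 1
    for \<open>s = 0\<close>; this opens the guards in \<open>separates\<close>.\<close>
  have large: "s > 0" if "real N \<le> 2 powr (real n * s)" "k < N" "l < N" "k \<noteq> l" "0 \<le> s" for N k l s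
  proof (rule ccontr)
    assume "\<not> s > 0"
    then have "s = 0" using that by simp
    then have "N \<le> 1" using that(1) by simp
    then show False using that by simp
  qed
  have bound: "of_bool (confusable N1 N2 \<eta> n g h i m y) \<le> T (g i) (h m) y + (\<Sum>m'\<in>{..<N2} - {m}. K2 (g i) y (h m'))
       + (\<Sum>i'\<in>{..<N1} - {i}. K1 (h m) y (g i'))
       + (\<Sum>i'\<in>{..<N1} - {i}. \<Sum>m'\<in>{..<N2} - {m}. K3 y (g i') (h m'))" (is "_ \<le> _ + ?s2 + ?s1 + ?s3") for g h y
  proof (cases "confusable N1 N2 \<eta> n g h i m y \<and> near \<theta> (emp n (\<lambda>t. (g i t, h m t, y t))) P")
    case False
    have "?s2 \<ge> 0" "?s1 \<ge> 0" "?s3 \<ge> 0" by (intro sum_nonneg K0)+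
    then show ?thesis using False by (auto simp: T_def)
  next
    case True
    then obtain i' m' where c: "i' < N1" "m' < N2" "(i', m') \<noteq> (i, m)" "typical \<eta> n (g i') (h m')"
      "(\<Sum>t<n. q (g i t) (h m t) (y t)) \<le> (\<Sum>t<n. q (g i' t) (h m' t) (y t))"
      unfolding confusable_def by blast
    have nr: "near \<theta> (emp n (\<lambda>t. (g i' t, h m' t))) PX"
      using c(4) near_mono[OF _ \<eta>(2)] by (auto simp: typical_def)
    note MM = M[OF conjunct2[OF True] nr c(5), unfolded separates_def]
    have s: "?s2 \<ge> 0" "?s1 \<ge> 0" "?s3 \<ge> 0" by (intro sum_nonneg K0)+
    have m2: "K2 (g i) y (h m') \<le> ?s2" if "m' \<noteq> m"
      by (rule member_le_sum) (use that c K0 in auto)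
    have m1: "K1 (h m) y (g i') \<le> ?s1" if "i' \<noteq> i"
      by (rule member_le_sum) (use that c K0 in auto)
    have m3: "K3 y (g i') (h m') \<le> ?s3" if "i' \<noteq> i" "m' \<noteq> m"
    proof -
      have "K3 y (g i') (h m') \<le> (\<Sum>m'\<in>{..<N2} - {m}. K3 y (g i') (h m'))"
        by (rule member_le_sum) (use that c K0 in auto)
      also have "\<dots> \<le> ?s3"
        by (rule member_le_sum[of _ _ "\<lambda>i'. \<Sum>m'\<in>{..<N2} - {m}. K3 y (g i') (h m')"]) (use that c K0 in \<open>auto intro: sum_nonneg\<close>)
      finally show ?thesis .
    qed
    have "1 \<le> ?s2 + ?s1 + ?s3"
    proof (cases "i' = i")
      case True
      then have "m' \<noteq> m" using c by auto
      then have "s2 > 0" using large[OF N(2) c(2) im(2)] s0 by simp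
      then have "K2 (g i) y (h m') \<ge> 1" using MM True by (auto simp: K2_def)
      then show ?thesis using m2[OF \<open>m' \<noteq> m\<close>] s by linarith
    next
      case i': False
      then have s1: "s1 > 0" using large[OF N(1) c(1) im(1)] s0 by simp
      show ?thesis
      proof (cases "m' = m")
        case True
        then have "K1 (h m) y (g i') \<ge> 1" using MM s1 by (auto simp: K1_def)
        then show ?thesis using m1[OF i'] s by linarith
      next
        case m': False
        then have s2: "s2 > 0" using large[OF N(2) c(2) im(2)] s0 by simp
        then consider "K3 y (g i') (h m') \<ge> 1" | "K2 (g i) y (h m') \<ge> 1" | "K1 (h m) y (g i') \<ge> 1"
          using MM s1 unfolding K1_def K2_def K3_def by auto
        then show ?thesis using m1[OF i'] m2[OF m'] m3[OF i' m'] s by cases linarith+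
      qed
    qed
    then show ?thesis using True K0(4)[of "g i" "h m" y] by simp
  qed
  let ?U = "2 powr (- (real n * (mi PX - \<eta> * density_norm)))" and ?L = "\<lambda>a b. (\<Sum>y\<in>seqs n. Wn n a b y * T a b y) + 8 * u"
  define G0 where "G0 a b = S a b * (\<Sum>y\<in>seqs n. Wn n a b y * T a b y)" for a b
  define G2 where "G2 a b b' = S a b * (\<Sum>y\<in>seqs n. Wn n a b y * K2 a y b')" for a b b'
  define G1 where "G1 a b a' = S a b * (\<Sum>y\<in>seqs n. Wn n a b y * K1 b y a')" for a b a'
  define G3 where "G3 a b a' b' = S a b * (\<Sum>y\<in>seqs n. Wn n a b y * K3 y a' b')" for a b a' b'
  have "rc.expct (\<lambda>g h. pair_err N1 N2 \<eta> n g h i m) \<le>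
     rc.expct (\<lambda>g h. G0 (g i) (h m) + (\<Sum>m'\<in>{..<N2} - {m}. G2 (g i) (h m) (h m'))
       + (\<Sum>i'\<in>{..<N1} - {i}. G1 (g i) (h m) (g i'))
       + (\<Sum>i'\<in>{..<N1} - {i}. \<Sum>m'\<in>{..<N2} - {m}. G3 (g i) (h m) (g i') (h m')))"
  proof (rule rc.expct_mono)
    fix g h
    have swap2: "(\<Sum>k\<in>I. S (g i) (h m) * (\<Sum>y\<in>seqs n. Wn n (g i) (h m) y * F k y)) =
        S (g i) (h m) * (\<Sum>y\<in>seqs n. Wn n (g i) (h m) y * (\<Sum>k\<in>I. F k y))" for I :: "nat set" and F
      unfolding sum_distrib_left by (rule sum.swap)
    have "pair_err N1 N2 \<eta> n g h i m \<le> S (g i) (h m) * (\<Sum>y\<in>seqs n. Wn n (g i) (h m) y * (T (g i) (h m) y + (\<Sum>m'\<in>{..<N2} - {m}. K2 (g i) y (h m'))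
       + (\<Sum>i'\<in>{..<N1} - {i}. K1 (h m) y (g i'))
       + (\<Sum>i'\<in>{..<N1} - {i}. \<Sum>m'\<in>{..<N2} - {m}. K3 y (g i') (h m'))))"
      unfolding pair_err_def S_def[symmetric]
      by (intro mult_left_mono sum_mono bound Wn0 K0)
    also have "\<dots> = G0 (g i) (h m) + (\<Sum>m'\<in>{..<N2} - {m}. G2 (g i) (h m) (h m'))
       + (\<Sum>i'\<in>{..<N1} - {i}. G1 (g i) (h m) (g i'))
       + (\<Sum>i'\<in>{..<N1} - {i}. \<Sum>m'\<in>{..<N2} - {m}. G3 (g i) (h m) (g i') (h m'))"
      unfolding G0_def G1_def G2_def G3_def swap2 by (simp only: distrib_left sum.distrib)
    finally show "pair_err N1 N2 \<eta> n g h i m \<le> \<dots>" .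
  qed
  also have "\<dots> = (\<Sum>a\<in>?A. \<Sum>b\<in>?B. \<mu> \<eta> n a * iid P2 n b * (G0 a b + (real N2 - 1) * (\<Sum>b'\<in>?B. iid P2 n b' * G2 a b b')
         + (real N1 - 1) * (\<Sum>a'\<in>?A. \<mu> \<eta> n a' * G1 a b a')
         + (real N1 - 1) * (real N2 - 1) * (\<Sum>a'\<in>?A. \<Sum>b'\<in>?B. \<mu> \<eta> n a' * iid P2 n b' * G3 a b a' b')))"
    by (rule rc.expct_union_bound[OF im])
  also have "\<dots> \<le> (\<Sum>a\<in>?A. \<Sum>b\<in>?B. \<mu> \<eta> n a * iid P2 n b * (S a b * ?L a b))"
  proof (intro sum_mono mult_left_mono)
    fix a b
    \<comment> \<open>The bound \<open>v\<close> holds for every output and the channel weights sum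
      to 1, so averaging over outputs costs nothing.\<close>
    have av: "r * (\<Sum>k\<in>I. w k * (S a b * (\<Sum>y\<in>seqs n. Wn n a b y * F k y))) \<le> S a b * v"
      if "\<And>y. r * (\<Sum>k\<in>I. w k * F k y) \<le> v" for r v :: real and I :: "'k set" and w F
    proof -
      have "r * (\<Sum>k\<in>I. w k * (S a b * (\<Sum>y\<in>seqs n. Wn n a b y * F k y)))
          = S a b * (\<Sum>y\<in>seqs n. Wn n a b y * (r * (\<Sum>k\<in>I. w k * F k y)))"
        unfolding sum_distrib_left by (subst sum.swap) (simp add: mult_ac)
      also have "\<dots> \<le> S a b * (\<Sum>y\<in>seqs n. Wn n a b y * v)"
        by (intro mult_left_mono sum_mono that Wn0 K0)
      also have "\<dots> = S a b * v" by (simp add: sum_Wn flip: sum_distrib_right)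
      finally show ?thesis .
    qed
    have "(real N2 - 1) * (\<Sum>b'\<in>?B. iid P2 n b' * G2 a b b') \<le> S a b * (2 * u)"
      unfolding G2_def by (rule av[OF t2])
    moreover have "(real N1 - 1) * (\<Sum>a'\<in>?A. \<mu> \<eta> n a' * G1 a b a') \<le> S a b * (4 * u)"
      unfolding G1_def by (rule av[OF t1])
    moreover have "(real N1 - 1) * (real N2 - 1) * (\<Sum>a'\<in>?A. \<Sum>b'\<in>?B. \<mu> \<eta> n a' * iid P2 n b' * G3 a b a' b') \<le> S a b * (2 * u)"
    proof -
      have "(real N1 - 1) * (real N2 - 1) * (\<Sum>(a', b')\<in>?A \<times> ?B. \<mu> \<eta> n a' * iid P2 n b' * K3 y a' b') \<le> 2 * u" for y
        using t3[of y] by (simp add: sum.cartesian_product)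
      then have "(real N1 - 1) * (real N2 - 1) * (\<Sum>k\<in>?A \<times> ?B. (\<mu> \<eta> n (fst k) * iid P2 n (snd k)) * K3 y (fst k) (snd k)) \<le> 2 * u" for y
        by (simp add: case_prod_beta')
      from av[OF this] show ?thesis
        unfolding G3_def by (simp add: sum.cartesian_product case_prod_beta')
    qed
    ultimately show "G0 a b + (real N2 - 1) * (\<Sum>b'\<in>?B. iid P2 n b' * G2 a b b')
         + (real N1 - 1) * (\<Sum>a'\<in>?A. \<mu> \<eta> n a' * G1 a b a')
         + (real N1 - 1) * (real N2 - 1) * (\<Sum>a'\<in>?A. \<Sum>b'\<in>?B. \<mu> \<eta> n a' * iid P2 n b' * G3 a b a' b')
       \<le> S a b * ?L a b"
      unfolding G0_def by (simp add: distrib_left)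
  qed (auto simp: rc.\<mu>0 intro!: mult_nonneg_nonneg iid_nonneg P20)
  also have "\<dots> = (\<Sum>a\<in>?A. \<mu> \<eta> n a * (\<Sum>b\<in>?B. iid P2 n b * (S a b * ?L a b)))"
    by (simp only: sum_distrib_left mult.assoc)
  also have "\<dots> \<le> 2 * (\<Sum>a\<in>seqs n. iid P1 n a * (\<Sum>b\<in>?B. iid P2 n b * (S a b * ?L a b)))"
    by (rule sum_\<mu>_le[OF Z])
       (intro sum_nonneg mult_nonneg_nonneg add_nonneg_nonneg iid_nonneg P20 K0 Wn0; simp add: u0)
  also have "(\<Sum>a\<in>seqs n. iid P1 n a * (\<Sum>b\<in>?B. iid P2 n b * (S a b * ?L a b)))
     \<le> (\<Sum>a\<in>seqs n. \<Sum>b\<in>seqs n. ?U * (joint n a b * ?L a b))"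
    unfolding sum_distrib_left[of "iid P1 n _"]
  proof (intro sum_mono)
    fix a b
    have nn: "0 \<le> (\<Sum>y\<in>seqs n. Wn n a b y * T a b y) + 8 * u"
      by (intro add_nonneg_nonneg sum_nonneg mult_nonneg_nonneg Wn0 K0) (use u0 in auto)
    show "iid P1 n a * (iid P2 n b * (S a b * ?L a b)) \<le>
       ?U * (joint n a b * ?L a b)"
    proof (cases "typical \<eta> n a b")
      case True
      have "iid P1 n a * iid P2 n b * ?L a b \<le>
          ?U * joint n a b * ?L a b"
        by (rule mult_right_mono[OF product_le_joint[OF True n] nn])
      then show ?thesis using True by (simp add: S_def mult.assoc)
    next
      case False
      then show ?thesis using nn by (auto simp: S_def intro!: mult_nonneg_nonneg iid_nonneg PX0)
    qed
  qed
  also have "\<dots> = ?U *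
      ((\<Sum>a\<in>seqs n. \<Sum>b\<in>seqs n. joint n a b * (\<Sum>y\<in>seqs n. Wn n a b y * T a b y)) +
       (\<Sum>a\<in>seqs n. \<Sum>b\<in>seqs n. joint n a b) * (8 * u))"
    by (simp only: distrib_left sum.distrib sum_distrib_left sum_distrib_right)
  also have "(\<Sum>a\<in>seqs n. \<Sum>b\<in>seqs n. joint n a b) = 1"
    by (simp add: sum_joint_second iid_sum_pmf[OF pmf_P1])
  also have "?U *
      ((\<Sum>a\<in>seqs n. \<Sum>b\<in>seqs n. joint n a b * (\<Sum>y\<in>seqs n. Wn n a b y * T a b y)) + 1 * (8 * u))
     \<le> ?U * (2 * real D * exp (- (real n * \<theta>\<^sup>2 / 4)) + 1 * (8 * u))"
    unfolding T_def D_def by (intro mult_left_mono add_mono prob_not_near_joint n \<theta>) auto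
  finally show ?thesis by (simp add: u_def mult.assoc)
qed

end

subsection \<open>Asymptotics and covering\<close>

context cognitive_mac
begin

abbreviation "codebook_expct \<eta> n N1 N2 \<equiv> random_codebooks.expct (coverable \<eta> n) (seqs n) (\<mu> \<eta> n) (iid P2 n) N1 N2"

text \<open>The target is scaled so that the sum over one bin, which will hold at most (n^2 + 2) /
  \<open>cover_prob\<close> words, is at most \<open>\<epsilon>\<close>.\<close>

definition error_decay :: "real \<Rightarrow> real \<Rightarrow> real \<Rightarrow> real \<Rightarrow> nat \<Rightarrow> bool" where
  "error_decay s1 s2 \<eta> \<epsilon> n \<longleftrightarrow> n > 0 \<and> coverable_mass \<eta> n \<ge> 1/2 \<and>
     (\<forall>N1 N2 i m. real N1 \<le> 2 powr (real n * s1) \<longrightarrow> real N2 \<le> 2 powr (real n * s2) \<longrightarrow> i < N1 \<longrightarrow> m < N2 \<longrightarrow>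
        codebook_expct \<eta> n N1 N2 (\<lambda>g h. pair_err N1 N2 \<eta> n g h i m) \<le> \<epsilon> * cover_prob \<eta> n / ((real n)\<^sup>2 + 2))"

lemma pair_err_nonneg: "0 \<le> pair_err N1 N2 \<eta> n g h i m"
  unfolding pair_err_def by (intro mult_nonneg_nonneg sum_nonneg Wn0) auto

lemma density_norm_nonneg: "0 \<le> density_norm"
  unfolding density_norm_def by (rule sum_nonneg) simp

text \<open>Read off from any coverable word, whose typical mass is a probability.\<close>

lemma cover_prob_le_1:
  assumes "coverable_mass \<eta> n \<ge> 1/2" shows "cover_prob \<eta> n \<le> 1"
proof -
  have "coverable \<eta> n \<noteq> {}" using assms by auto
  then obtain a where "a \<in> coverable \<eta> n" by auto
  then have "cover_prob \<eta> n \<le> typical_mass \<eta> n a" by (simp add: coverable_def)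
  also have "\<dots> \<le> (\<Sum>b\<in>seqs n. iid P2 n b)" by (intro sum_mono) (auto intro!: iid_nonneg P20)
  also have "\<dots> = 1" by (rule iid_sum_pmf[OF pmf_P2])
  finally show ?thesis .
qed

lemma cover_prob_pos: "0 < cover_prob \<eta> n" by (simp add: cover_prob_def)

text \<open>The error bound carries \<open>mi PX - \<eta> * density_norm\<close> in its exponent,
  the target \<open>mi PX + \<eta> * density_norm\<close>. The discrepancy 2^(2 n \<eta> C) must
  lose against the decay governed by \<open>\<theta>\<close>, which is why \<open>\<theta>\<close>
  is fixed before \<open>\<eta>\<close>.\<close>

lemma expected_pair_err_asymptotic:
  assumes rb: "rates_below q P s1 s2" and s0: "0 \<le> s1" "0 \<le> s2" and \<kappa>: "\<kappa> > 0"
  shows "\<exists>\<eta>>0. \<eta> * density_norm \<le> \<kappa> \<and> (\<forall>\<epsilon>>0. \<forall>\<^sub>F n in sequentially.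
     error_decay s1 s2 \<eta> \<epsilon> n)"
proof -
  obtain \<theta> where \<theta>: "\<theta> > 0" "\<theta> \<le> 1" and M: "\<And>n a b y a' b'. n > 0 \<Longrightarrow> near \<theta> (emp n (\<lambda>t. (a t, b t, y t))) P \<Longrightarrow>
      near \<theta> (emp n (\<lambda>t. (a' t, b' t))) (marg P pX1X2) \<Longrightarrow>
      (\<Sum>t<n. q (a t) (b t) (y t)) \<le> (\<Sum>t<n. q (a' t) (b' t) (y t)) \<Longrightarrow>
      separates s1 s2 \<theta> n a b y a' b'"
    using competitor_margin[OF rb] by blast
  \<comment> \<open>The discrepancy exponent is then at most \<theta>^2 / 8, half of the Chernoff
    exponent; since \<theta>^2 <= \<theta>, it is also at most half of the margin exponent
    \<theta>.\<close>
  define \<tau> where "\<tau> = min \<kappa> (\<theta>\<^sup>2 / 16)"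
  define \<eta> where "\<eta> = min \<theta> (\<tau> / (density_norm + 1))"
  have \<tau>: "\<tau> > 0" "\<tau> \<le> \<kappa>" "\<tau> \<le> \<theta>\<^sup>2 / 16" using \<kappa> \<theta> by (auto simp: \<tau>_def)
  have \<eta>: "\<eta> > 0" "\<eta> \<le> \<theta>" using \<theta> \<tau> density_norm_nonneg by (auto simp: \<eta>_def)
  have \<eta>C: "\<eta> * density_norm \<le> \<tau>"
  proof -
    have "\<eta> * density_norm \<le> \<tau> / (density_norm + 1) * (density_norm + 1)"
      using density_norm_nonneg \<tau> by (intro mult_mono) (auto simp: \<eta>_def)
    then show ?thesis using density_norm_nonneg by simp
  qed
  define D where "D = CARD('a \<times> 'b \<times> 'c)"
  have D0: "D > 0" by (simp add: D_def)
  show ?thesis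
  proof (intro exI[of _ \<eta>] conjI allI impI)
    show "0 < \<eta>" by (rule \<eta>(1))
    show "\<eta> * density_norm \<le> \<kappa>" using \<eta>C \<tau> by simp
    fix \<epsilon> :: real assume \<epsilon>: "\<epsilon> > 0"
    have e1: "\<forall>\<^sub>F n in sequentially. 2 * real CARD('a \<times> 'b) * exp (- (real n * \<eta>\<^sup>2 / 4)) \<le> 1/4"
      using \<eta> by real_asymp
    \<comment> \<open>The 8 is the leading 2 of the error bound times the 4 in the denominator of
      \<open>cover_prob\<close>.\<close>
    have e2: "\<forall>\<^sub>F n in sequentially. 8 * ((real n)\<^sup>2 + 2) * (2 * real D * exp (- (real n * (\<theta>\<^sup>2 / 8))) + 8 * real (n + 1) ^ D * 2 powr (- (real n * (\<theta> / 2)))) < \<epsilon>"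
    proof -
      have key: "\<forall>\<^sub>F n in sequentially. 8 * ((real n)\<^sup>2 + 2) * (2 * real D * exp (- (real n * u)) + 8 * real (n + 1) ^ D * 2 powr (- (real n * v))) < \<epsilon>"
        if "u > 0" "v > 0" for u v :: real
      proof -
        define d where "d = real D"
        have "d > 0" using D0 by (simp add: d_def)
        have rp: "real (n + 1) powr d = real (n + 1) ^ D" for n by (simp add: d_def powr_realpow)
        have A: "\<forall>\<^sub>F n in sequentially. 8 * ((real n)\<^sup>2 + 2) * (2 * d * exp (- (real n * u))) < \<epsilon> / 2"
          using that(1) \<epsilon> \<open>d > 0\<close> by real_asymp
        have B: "\<forall>\<^sub>F n in sequentially. 8 * ((real n)\<^sup>2 + 2) * (8 * real (n + 1) powr d * 2 powr (- (real n * v))) < \<epsilon> / 2"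
          using that(2) \<epsilon> \<open>d > 0\<close> by real_asymp
        show ?thesis using A B
          unfolding rp unfolding d_def
        proof eventually_elim
          case (elim n)
          then show ?case unfolding distrib_left[of "8 * ((real n)\<^sup>2 + 2)"] by linarith
        qed
      qed
      show ?thesis by (rule key) (use \<theta>(1) in auto)
    qed
    show "\<forall>\<^sub>F n in sequentially.
     error_decay s1 s2 \<eta> \<epsilon> n"
      using e1 e2[unfolded times_divide_eq_right] eventually_gt_at_top[of 0]
    proof eventually_elim
      case (elim n)
      have Z: "coverable_mass \<eta> n \<ge> 1/2"
        by (rule prob_coverable[OF elim(3) \<eta>(1) _ elim(1)]) (use \<eta> \<theta> in auto)
      have num: "2 * 2 powr (- (real n * (mi PX - \<eta> * density_norm))) *
           (2 * real D * exp (- (real n * \<theta>\<^sup>2 / 4)) + 8 * real (n + 1) ^ D * 2 powr (- (real n * \<theta>)))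
         \<le> \<epsilon> * cover_prob \<eta> n / ((real n)\<^sup>2 + 2)"
      proof -
        let ?B = "2 * real D * exp (- (real n * \<theta>\<^sup>2 / 4)) + 8 * real (n + 1) ^ D * 2 powr (- (real n * \<theta>))"
        let ?B' = "2 * real D * exp (- (real n * \<theta>\<^sup>2 / 8)) + 8 * real (n + 1) ^ D * 2 powr (- (real n * \<theta> / 2))"
        let ?r = "real n * (2 * (\<eta> * density_norm))"
        have r0: "?r \<le> real n * (\<theta>\<^sup>2 / 8)" using \<eta>C \<tau> by (intro mult_left_mono) auto
        have "\<theta>\<^sup>2 \<le> \<theta>" using \<theta> by (simp add: power2_eq_square mult_left_le)
        then have r1: "?r \<le> real n * (\<theta> / 2)"
          using r0 \<theta> by (intro order_trans[OF r0] mult_left_mono) auto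
        have rnn: "0 \<le> ?r" using \<eta> density_norm_nonneg by simp
        have "2 powr ?r * exp (- (real n * \<theta>\<^sup>2 / 4)) \<le> exp (- (real n * \<theta>\<^sup>2 / 8))"
        proof -
          have ln2: "ln (2 :: real) \<le> 1" using ln_le_minus_one[of "2 :: real"] by simp
          have "2 powr ?r = exp (?r * ln 2)" by (simp add: powr_def)
          also have "\<dots> \<le> exp (?r * 1)" using ln2 rnn by (intro exp_le_cancel_iff[THEN iffD2] mult_left_mono)
          finally have "2 powr ?r * exp (- (real n * \<theta>\<^sup>2 / 4)) \<le> exp ?r * exp (- (real n * \<theta>\<^sup>2 / 4))"
            by (intro mult_right_mono) auto
          also have "\<dots> = exp (?r + - (real n * \<theta>\<^sup>2 / 4))" by (rule exp_add[symmetric])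
          also have "\<dots> \<le> exp (- (real n * \<theta>\<^sup>2 / 8))" using r0 by simp
          finally show ?thesis .
        qed
        moreover have "2 powr ?r * 2 powr (- (real n * \<theta>)) \<le> 2 powr (- (real n * \<theta> / 2))"
          unfolding powr_add[symmetric] using r1 by (intro powr_mono) auto
        ultimately have "2 powr ?r * ?B \<le> ?B'"
          unfolding distrib_left[of "2 powr ?r"]
          by (intro add_mono) (simp_all add: mult.left_commute[of "2 powr ?r"] mult_left_mono)
        then have le: "8 * ((real n)\<^sup>2 + 2) * (2 powr ?r * ?B) \<le> \<epsilon>"
          using mult_left_mono[of "2 powr ?r * ?B" ?B' "8 * ((real n)\<^sup>2 + 2)"] elim(2) by (simp del: mult_le_cancel_left_pos mult_le_cancel_left)
        have "- (real n * (mi PX - \<eta> * density_norm)) = - (real n * (mi PX + \<eta> * density_norm)) + ?r"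
          by (simp add: algebra_simps)
        then have "2 * 2 powr (- (real n * (mi PX - \<eta> * density_norm))) * ?B = cover_prob \<eta> n * (8 * (2 powr ?r * ?B))"
          by (simp only: powr_add cover_prob_def)
        also have "\<dots> \<le> cover_prob \<eta> n * (\<epsilon> / ((real n)\<^sup>2 + 2))"
        proof -
          have "(real n)\<^sup>2 + 2 > 0" by (simp add: add_nonneg_pos)
          moreover have "8 * x \<le> \<epsilon> / N" if "8 * N * x \<le> \<epsilon>" "N > 0" for x N :: real
            using that by (simp add: pos_le_divide_eq mult_ac)
          ultimately show ?thesis using le cover_prob_pos[of \<eta> n] by (intro mult_left_mono) auto
        qed
        finally show ?thesis by (simp add: mult.commute)
      qed
      show ?case
        unfolding error_decay_def
      proof (intro conjI allI impI Z elim(3))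
        fix N1 N2 i m
        assume N: "real N1 \<le> 2 powr (real n * s1)" "real N2 \<le> 2 powr (real n * s2)" "i < N1" "m < N2"
        have "codebook_expct \<eta> n N1 N2 (\<lambda>g h. pair_err N1 N2 \<eta> n g h i m) \<le>
            2 * 2 powr (- (real n * (mi PX - \<eta> * density_norm))) *
           (2 * real D * exp (- (real n * \<theta>\<^sup>2 / 4)) + 8 * real (n + 1) ^ D * 2 powr (- (real n * \<theta>)))"
          unfolding D_def
          by (rule expected_pair_err[OF elim(3) Z \<eta> \<theta> N(1,2) s0 _ N(3,4)])
             (rule M[OF elim(3)]; simp add: marg_P)
        then show "codebook_expct \<eta> n N1 N2 (\<lambda>g h. pair_err N1 N2 \<eta> n g h i m) \<le> \<epsilon> * cover_prob \<eta> n / ((real n)\<^sup>2 + 2)"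
          using num by simp
      qed
    qed
  qed
qed

text \<open>Distinct messages use distinct typical index pairs, so every competing message is among
  the competitors counted by \<open>confusable\<close>. Both code constructions below are such an
  assignment \<open>\<phi>\<close>.\<close>

lemma err_prob_le_pair_err:
  assumes \<phi>: "\<And>i j. i < M1 \<Longrightarrow> j < M2 \<Longrightarrow> fst (\<phi> (i, j)) < N1 \<and> snd (\<phi> (i, j)) < N2 \<and> typical \<eta> n (g (fst (\<phi> (i, j)))) (h (snd (\<phi> (i, j))))"
    and inj: "inj_on \<phi> ({..<M1} \<times> {..<M2})"
    and x1: "\<And>i j. i < M1 \<Longrightarrow> j < M2 \<Longrightarrow> x1 i = g (fst (\<phi> (i, j)))"
    and x2: "\<And>i j. i < M1 \<Longrightarrow> j < M2 \<Longrightarrow> x2 i j = h (snd (\<phi> (i, j)))"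
    and ij: "i < M1" "j < M2"
  shows "err_prob W q n M1 M2 x1 x2 i j \<le> pair_err N1 N2 \<eta> n g h (fst (\<phi> (i, j))) (snd (\<phi> (i, j)))"
proof -
  have "decodes_correctly q n M1 M2 x1 x2 i j y"
    if nc: "\<not> confusable N1 N2 \<eta> n g h (fst (\<phi> (i, j))) (snd (\<phi> (i, j))) y" for y
    unfolding decodes_correctly_def
  proof (intro allI impI)
    fix i' j' assume h: "i' < M1" "j' < M2" "(i', j') \<noteq> (i, j)"
    have "\<phi> (i', j') \<noteq> \<phi> (i, j)" using inj_onD[OF inj, of "(i', j')" "(i, j)"] h ij by auto
    then have "(fst (\<phi> (i', j')), snd (\<phi> (i', j'))) \<noteq> (fst (\<phi> (i, j)), snd (\<phi> (i, j)))" by simp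
    then have "\<not> (\<Sum>t<n. q (g (fst (\<phi> (i, j))) t) (h (snd (\<phi> (i, j))) t) (y t))
        \<le> (\<Sum>t<n. q (g (fst (\<phi> (i', j'))) t) (h (snd (\<phi> (i', j'))) t) (y t))"
      using nc \<phi>[OF h(1,2)] unfolding confusable_def by blast
    then show "score q n x1 x2 i' j' y < score q n x1 x2 i j y"
      by (simp add: score_def x1[OF h(1,2)] x2[OF h(1,2)] x1[OF ij] x2[OF ij])
  qed
  then have "err_prob W q n M1 M2 x1 x2 i j \<le> (\<Sum>y\<in>seqs n. Wn n (g (fst (\<phi> (i, j)))) (h (snd (\<phi> (i, j)))) y *
      of_bool (confusable N1 N2 \<eta> n g h (fst (\<phi> (i, j))) (snd (\<phi> (i, j))) y))"
    unfolding err_prob_seqs x1[OF ij] x2[OF ij] Wn_def[symmetric] using Wn0 by (intro sum_mono) auto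
  then show ?thesis
    using \<phi>[OF ij] unfolding pair_err_def by (simp only: of_bool_eq simp_thms mult_1)
qed

text \<open>The words of a bin are independent, and each is typical with the coverable word
  \<open>g i\<close> with probability at least c = \<open>cover_prob\<close>; finally (1 - c)^K <=
  exp (- c K).\<close>

lemma covering_failure:
  assumes Z: "coverable_mass \<eta> n \<ge> 1/2" and ij: "i < N1" "j < M2"
  shows "codebook_expct \<eta> n N1 (M2 * K) (\<lambda>g h. of_bool (\<forall>k<K. \<not> typical \<eta> n (g i) (h (j * K + k)))) \<le> exp (- (cover_prob \<eta> n * real K))"
proof -
  interpret rc: random_codebooks "coverable \<eta> n" "seqs n" "\<mu> \<eta> n" "iid P2 n" N1 "M2 * K"
    by (rule random_codebooks_coverable[OF Z])
  have inner: "(\<Sum>h\<in>codebooks (M2 * K) (seqs n). weight (iid P2 n) (M2 * K) h * of_bool (\<forall>k<K. \<not> typical \<eta> n a (h (j * K + k))))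
      \<le> exp (- (cover_prob \<eta> n * real K))" if a: "a \<in> coverable \<eta> n" for a
  proof -
    let ?J = "{j * K..<j * K + K}"
    have J: "?J \<subseteq> {..<M2 * K}"
    proof -
      have "Suc j * K \<le> M2 * K" using ij by (intro mult_right_mono) auto
      then show ?thesis by auto
    qed
    \<comment> \<open>Factors outside bin \<open>j\<close> are 1, so the failure event becomes a
      product over all positions.\<close>
    define F where "F m b = (if m \<in> ?J then of_bool (\<not> typical \<eta> n a b) else (1 :: real))" for m b
    have ind: "of_bool (\<forall>k<K. \<not> typical \<eta> n a (h (j * K + k))) \<le> (\<Prod>m<M2 * K. F m (h m))" for h
    proof (cases "\<forall>k<K. \<not> typical \<eta> n a (h (j * K + k))")
      case True
      have "F m (h m) = 1" for m
      proof (cases "m \<in> ?J")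
        case m: True
        then have "m - j * K < K" "j * K + (m - j * K) = m" by auto
        then show ?thesis using True m by (metis F_def of_bool_eq(2))
      qed (simp only: F_def if_False)
      then show ?thesis by simp
    next
      case False
      then have "of_bool (\<forall>k<K. \<not> typical \<eta> n a (h (j * K + k))) = (0 :: real)" by (simp only: of_bool_eq)
      moreover have "0 \<le> (\<Prod>m<M2 * K. F m (h m))" by (intro prod_nonneg) (simp add: F_def)
      ultimately show ?thesis by linarith
    qed
    have "(\<Sum>h\<in>codebooks (M2 * K) (seqs n). weight (iid P2 n) (M2 * K) h * of_bool (\<forall>k<K. \<not> typical \<eta> n a (h (j * K + k))))
      \<le> (\<Sum>h\<in>codebooks (M2 * K) (seqs n). weight (iid P2 n) (M2 * K) h * (\<Prod>m<M2 * K. F m (h m)))"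
      by (intro sum_mono mult_left_mono ind weight_nonneg[of "seqs n"] iid_nonneg P20)
    also have "\<dots> = (\<Prod>m<M2 * K. \<Sum>b\<in>seqs n. iid P2 n b * F m b)" by (rule sum_weight_prod) simp
    also have "\<dots> = (\<Prod>m<M2 * K. if m \<in> ?J then (\<Sum>b\<in>seqs n. iid P2 n b * of_bool (\<not> typical \<eta> n a b)) else 1)"
      by (intro prod.cong refl) (auto simp: F_def iid_sum_pmf[OF pmf_P2])
    also have "\<dots> = (\<Prod>m\<in>?J. \<Sum>b\<in>seqs n. iid P2 n b * of_bool (\<not> typical \<eta> n a b))"
      using J by (simp only: prod.inter_restrict[symmetric, OF finite_lessThan] Int_absorb1)
    also have "\<dots> = (\<Sum>b\<in>seqs n. iid P2 n b * of_bool (\<not> typical \<eta> n a b)) ^ K" by simp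
    also have "\<dots> \<le> exp (- cover_prob \<eta> n) ^ K"
    proof (rule power_mono)
      have "(\<Sum>b\<in>seqs n. iid P2 n b * of_bool (\<not> typical \<eta> n a b)) = (\<Sum>b\<in>seqs n. iid P2 n b) - typical_mass \<eta> n a"
        unfolding sum_subtractf[symmetric] by (intro sum.cong refl) auto
      also have "\<dots> \<le> 1 + - cover_prob \<eta> n" using a by (simp add: coverable_def iid_sum_pmf[OF pmf_P2])
      also have "\<dots> \<le> exp (- cover_prob \<eta> n)" by (rule exp_ge_add_one_self)
      finally show "(\<Sum>b\<in>seqs n. iid P2 n b * of_bool (\<not> typical \<eta> n a b)) \<le> exp (- cover_prob \<eta> n)" .
    qed (intro sum_nonneg mult_nonneg_nonneg iid_nonneg P20, simp)
    also have "\<dots> = exp (- (cover_prob \<eta> n * real K))" by (simp add: exp_of_nat_mult[symmetric] mult.commute)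
    finally show ?thesis .
  qed
  have "rc.expct (\<lambda>g h. of_bool (\<forall>k<K. \<not> typical \<eta> n (g i) (h (j * K + k))))
      \<le> (\<Sum>g\<in>codebooks N1 (coverable \<eta> n). weight (\<mu> \<eta> n) N1 g * exp (- (cover_prob \<eta> n * real K)))"
    unfolding rc.expct_def
  proof (rule sum_mono)
    fix g assume g: "g \<in> codebooks N1 (coverable \<eta> n)"
    then have "g i \<in> coverable \<eta> n" using ij by (auto simp: codebooks_def)
    then show "weight (\<mu> \<eta> n) N1 g * (\<Sum>h\<in>codebooks (M2 * K) (seqs n). weight (iid P2 n) (M2 * K) h * of_bool (\<forall>k<K. \<not> typical \<eta> n (g i) (h (j * K + k))))
        \<le> weight (\<mu> \<eta> n) N1 g * exp (- (cover_prob \<eta> n * real K))"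
      by (intro mult_left_mono inner weight_nonneg[OF rc.\<mu>0 g])
  qed
  also have "\<dots> = exp (- (cover_prob \<eta> n * real K))" by (simp add: sum_weight[OF rc.A] flip: sum_distrib_right)
  finally show ?thesis .
qed

end

subsection \<open>Existence of codes\<close>

lemma le_num_msgs: "real M \<le> 2 powr (real n * R) \<Longrightarrow> M \<le> num_msgs n R"
  unfolding num_msgs_def by (simp add: le_nat_floor)

lemma rates_below_max: "rates_below q P s1 s2 \<Longrightarrow> rates_below q P s1 (max 0 s2)"
  unfolding rates_below_def max_def by auto

context cognitive_mac
begin

text \<open>Bins of \<open>K\<close> words serve all message pairs at once for a good codebook, and
  the error of a selected word is bounded by the sum over its whole bin. That sum is affordable
  because \<open>pair_err\<close> is already weighted by the probability of typicality.\<close>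

lemma covering_code:
  assumes rb: "rates_below q P s1 (r2 + mi PX + \<sigma>)" and s0: "0 \<le> s1" "0 \<le> r2" and \<sigma>: "\<sigma> > 0" and \<epsilon>: "\<epsilon> > 0"
  shows "\<forall>\<^sub>F n in sequentially. has_code W q n (num_msgs n s1) (num_msgs n r2) \<epsilon>"
proof -
  define s2 where "s2 = r2 + mi PX + \<sigma>"
  \<comment> \<open>The bound \<open>2 * e\<close> has two tasks: at most \<open>\<epsilon>\<close>
    for the error, and at most 1 to exclude unserved pairs.\<close>
  define e where "e = min \<epsilon> 1 / 2"
  have e: "e > 0" "2 * e \<le> \<epsilon>" "2 * e \<le> 1" using \<epsilon> by (auto simp: e_def)
  obtain \<eta> where \<eta>: "\<eta> > 0" "\<eta> * density_norm \<le> \<sigma> / 2" and as: "\<And>\<epsilon>. \<epsilon> > 0 \<Longrightarrow> \<forall>\<^sub>F n in sequentially.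
     error_decay s1 (max 0 s2) \<eta> \<epsilon> n"
    using expected_pair_err_asymptotic[OF rates_below_max[OF rb] s0(1), of "\<sigma> / 2"] \<sigma> unfolding s2_def by auto
  have e1: "\<forall>\<^sub>F n in sequentially. 4 * ((real n)\<^sup>2 + 2) \<le> 2 powr (real n * (\<sigma> / 2))"
    using \<sigma> by real_asymp
  have e2: "\<forall>\<^sub>F n in sequentially. 2 powr (real n * (s1 + r2)) * exp (- ((real n)\<^sup>2)) < e"
  proof -
    have pos: "s1 + r2 + 1 > 0" using s0 by simp
    have "\<forall>\<^sub>F n in sequentially. 2 powr (real n * s) * exp (- ((real n)\<^sup>2)) < e" if "s > 0" for s
      using e(1) that by real_asymp
    from this[OF pos] show ?thesis
    proof eventually_elim
      case (elim n)
      have "2 powr (real n * (s1 + r2)) * exp (- ((real n)\<^sup>2)) \<le> 2 powr (real n * (s1 + r2 + 1)) * exp (- ((real n)\<^sup>2))"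
        by (intro mult_right_mono powr_mono mult_left_mono) auto
      then show ?case using elim by linarith
    qed
  qed
  show ?thesis using as[OF e(1)] e1 e2
  proof eventually_elim
    case (elim n)
    note decay = elim(1)[unfolded error_decay_def]
    then have n: "n > 0" and Z: "coverable_mass \<eta> n \<ge> 1/2" by auto
    define M1 where "M1 = num_msgs n s1"
    define M2 where "M2 = num_msgs n r2"
    \<comment> \<open>The n^2 makes the failure probability at most exp (- n^2); its cost, together
      with the constant 4, is absorbed by one half of \<open>\<sigma>\<close>, the typicality loss
      by the other.\<close>
    define K where "K = nat \<lceil>((real n)\<^sup>2 + 1) / cover_prob \<eta> n\<rceil>"
    have M: "M1 > 0" "M2 > 0" "real M1 \<le> 2 powr (real n * s1)" "real M2 \<le> 2 powr (real n * r2)"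
      unfolding M1_def M2_def using s0 by (auto intro: num_msgs_pos num_msgs_le_powr)
    have pl: "0 < cover_prob \<eta> n" "cover_prob \<eta> n \<le> 1" using cover_prob_pos cover_prob_le_1[OF Z] by auto
    have K0: "((real n)\<^sup>2 + 1) / cover_prob \<eta> n \<ge> 0" using pl by simp
    have K1: "((real n)\<^sup>2 + 1) / cover_prob \<eta> n \<le> real K" unfolding K_def by linarith
    have K2: "real K \<le> ((real n)\<^sup>2 + 2) / cover_prob \<eta> n"
    proof -
      have "real K \<le> ((real n)\<^sup>2 + 1) / cover_prob \<eta> n + 1" unfolding K_def using K0 by linarith
      also have "\<dots> \<le> ((real n)\<^sup>2 + 1) / cover_prob \<eta> n + 1 / cover_prob \<eta> n" using pl by (simp add: le_divide_eq)
      also have "\<dots> = ((real n)\<^sup>2 + 2) / cover_prob \<eta> n" by (simp add: add_divide_distrib)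
      finally show ?thesis .
    qed
    have K3: "(real n)\<^sup>2 \<le> cover_prob \<eta> n * real K" using K1 pl by (simp add: divide_le_eq mult.commute)
    have K4: "real K * cover_prob \<eta> n \<le> (real n)\<^sup>2 + 2" using K2 pl by (simp add: le_divide_eq)
    have N2: "real (M2 * K) \<le> 2 powr (real n * max 0 s2)"
    proof -
      have "real K \<le> 4 * ((real n)\<^sup>2 + 2) * 2 powr (real n * (mi PX + \<eta> * density_norm))"
      proof -
        have "((real n)\<^sup>2 + 2) / cover_prob \<eta> n = 4 * ((real n)\<^sup>2 + 2) * 2 powr (real n * (mi PX + \<eta> * density_norm))"
          unfolding cover_prob_def powr_minus_divide by simp
        then show ?thesis using K2 by linarith
      qed
      also have "\<dots> \<le> 2 powr (real n * (\<sigma> / 2)) * 2 powr (real n * (mi PX + \<sigma> / 2))"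
        using elim(2) \<eta>(2) by (intro mult_mono powr_mono mult_left_mono add_left_mono) auto
      finally have "real M2 * real K \<le> 2 powr (real n * r2) * (2 powr (real n * (\<sigma> / 2)) * 2 powr (real n * (mi PX + \<sigma> / 2)))"
        using M by (intro mult_mono) auto
      also have "\<dots> = 2 powr (real n * s2)"
        unfolding powr_add[symmetric] by (simp add: s2_def algebra_simps)
      also have "\<dots> \<le> 2 powr (real n * max 0 s2)" by (intro powr_mono mult_left_mono) auto
      finally show ?thesis by simp
    qed
    interpret rc: random_codebooks "coverable \<eta> n" "seqs n" "\<mu> \<eta> n" "iid P2 n" M1 "M2 * K"
      by (rule random_codebooks_coverable[OF Z])
    define fail where "fail g h i j = (of_bool (\<forall>k<K. \<not> typical \<eta> n (g i) (h (j * K + k))) :: real)"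
      for g :: "nat \<Rightarrow> nat \<Rightarrow> 'a" and h :: "nat \<Rightarrow> nat \<Rightarrow> 'b" and i j :: nat
    let ?E = "\<lambda>g h. \<Sum>i<M1. \<Sum>m<M2 * K. pair_err M1 (M2 * K) \<eta> n g h i m"
    let ?C = "\<lambda>g h. \<Sum>i<M1. \<Sum>j<M2. fail g h i j"
    have EE: "rc.expct ?E \<le> e * (real M1 * real M2)"
    proof -
      have "rc.expct ?E = (\<Sum>i<M1. \<Sum>m<M2 * K. rc.expct (\<lambda>g h. pair_err M1 (M2 * K) \<eta> n g h i m))"
        by (simp add: rc.expct_sum)
      also have "\<dots> \<le> (\<Sum>i<M1. \<Sum>m<M2 * K. e * cover_prob \<eta> n / ((real n)\<^sup>2 + 2))"
        using decay M N2 by (intro sum_mono) auto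
      also have "\<dots> = e * (real M1 * real M2) * ((real K * cover_prob \<eta> n) / ((real n)\<^sup>2 + 2))"
        by simp
      also have "\<dots> \<le> e * (real M1 * real M2) * 1"
      proof -
        have "(real n)\<^sup>2 + 2 > 0" by (simp add: add_nonneg_pos)
        then show ?thesis using K4 e by (intro mult_left_mono) auto
      qed
      finally show ?thesis by simp
    qed
    have EC: "rc.expct ?C < e"
    proof -
      have "rc.expct ?C = (\<Sum>i<M1. \<Sum>j<M2. rc.expct (\<lambda>g h. fail g h i j))"
        by (simp add: rc.expct_sum)
      also have "\<dots> \<le> (\<Sum>i<M1. \<Sum>j<M2. exp (- (cover_prob \<eta> n * real K)))"
        unfolding fail_def by (intro sum_mono covering_failure Z) auto
      also have "\<dots> = real M1 * real M2 * exp (- (cover_prob \<eta> n * real K))" by simp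
      also have "\<dots> \<le> 2 powr (real n * s1) * 2 powr (real n * r2) * exp (- ((real n)\<^sup>2))"
        using M K3 by (intro mult_mono) auto
      also have "\<dots> = 2 powr (real n * (s1 + r2)) * exp (- ((real n)\<^sup>2))"
        by (simp add: powr_add[symmetric] distrib_left)
      also have "\<dots> < e" by (rule elim(3))
      finally show ?thesis .
    qed
    let ?c = "1 / (real M1 * real M2)"
    have "rc.expct (\<lambda>g h. ?c * ?E g h + ?C g h) = ?c * rc.expct ?E + rc.expct ?C"
      by (simp only: rc.expct_add rc.expct_cmult)
    also have "?c * rc.expct ?E \<le> ?c * (e * (real M1 * real M2))" using EE by (intro mult_left_mono) auto
    also have "\<dots> = e" using M by simp
    finally have "rc.expct (\<lambda>g h. ?c * ?E g h + ?C g h) < 2 * e" using EC by linarith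
    from rc.ex_codebook_le[OF this] obtain g h where gh: "?c * ?E g h + ?C g h < 2 * e" by blast
    have Epos: "?E g h \<ge> 0" by (intro sum_nonneg pair_err_nonneg)
    have Cpos: "?C g h \<ge> 0" by (intro sum_nonneg) (simp add: fail_def)
    have Ele: "?c * ?E g h \<le> \<epsilon>" using gh Cpos e by linarith
    \<comment> \<open>The sum counts unserved message pairs, so a value below 1 means that there are
      none.\<close>
    have Clt: "?C g h < 1"
    proof -
      have "0 \<le> ?c * ?E g h" using Epos by (intro mult_nonneg_nonneg) auto
      then show ?thesis using gh e by linarith
    qed
    have "\<exists>k<K. typical \<eta> n (g i) (h (j * K + k))" if ij: "i < M1" "j < M2" for i j
    proof (rule ccontr)
      assume "\<not> ?thesis"
      then have "fail g h i j = 1" by (simp add: fail_def)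
      moreover have "fail g h i j \<le> (\<Sum>j<M2. fail g h i j)"
        by (rule member_le_sum) (use ij in \<open>auto simp: fail_def\<close>)
      moreover have "(\<Sum>j<M2. fail g h i j) \<le> ?C g h"
        by (rule member_le_sum[of _ _ "\<lambda>i. \<Sum>j<M2. fail g h i j"]) (use ij in \<open>auto simp: fail_def intro!: sum_nonneg\<close>)
      ultimately show False using Clt by linarith
    qed
    then obtain k where k: "\<And>i j. i < M1 \<Longrightarrow> j < M2 \<Longrightarrow> k i j < K \<and> typical \<eta> n (g i) (h (j * K + k i j))" by metis
    let ?pe = "pair_err M1 (M2 * K) \<eta> n g h"
    define \<phi> where "\<phi> = (\<lambda>(i, j). (i, j * K + k i j))"
    have bj: "j * K + k i j < M2 * K" if "i < M1" "j < M2" for i j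
      using bij_betwE[OF bij_betw_div_mod[of K M2]] k[OF that] that by auto
    have dm: "(j * K + k i j) div K = j" if "i < M1" "j < M2" for i j
      using k[OF that] by simp
    have "avg_err W q n M1 M2 g (\<lambda>i j. h (j * K + k i j)) \<le> ?c * ?E g h"
    proof -
      have "(\<Sum>i<M1. \<Sum>j<M2. err_prob W q n M1 M2 g (\<lambda>i j. h (j * K + k i j)) i j)
          \<le> (\<Sum>i<M1. \<Sum>j<M2. ?pe (fst (\<phi> (i, j))) (snd (\<phi> (i, j))))"
      proof (intro sum_mono err_prob_le_pair_err)
        show "inj_on \<phi> ({..<M1} \<times> {..<M2})"
          unfolding \<phi>_def inj_on_def using dm by auto metis
      qed (use k bj in \<open>auto simp: \<phi>_def\<close>)
      also have "\<dots> \<le> ?E g h"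
      proof (rule sum_mono)
        fix i assume i: "i \<in> {..<M1}"
        have "(\<Sum>m<M2 * K. ?pe i m) = (\<Sum>m<M2 * K. (\<lambda>j k. ?pe i (j * K + k)) (m div K) (m mod K))"
          by simp
        also have "\<dots> = (\<Sum>j<M2. \<Sum>k<K. ?pe i (j * K + k))"
          by (rule sum_div_mod)
        finally have eq: "(\<Sum>m<M2 * K. ?pe i m) = (\<Sum>j<M2. \<Sum>k<K. ?pe i (j * K + k))" .
        have "(\<Sum>j<M2. ?pe i (j * K + k i j)) \<le> (\<Sum>j<M2. \<Sum>k<K. ?pe i (j * K + k))"
        proof (rule sum_mono)
          fix j assume "j \<in> {..<M2}"
          then show "?pe i (j * K + k i j) \<le> (\<Sum>k<K. ?pe i (j * K + k))"
            using k[of i j] i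
            by (intro member_le_sum[of "k i j" _ "\<lambda>k. ?pe i (j * K + k)"]) (auto intro: pair_err_nonneg)
        qed
        then show "(\<Sum>j<M2. ?pe (fst (\<phi> (i, j))) (snd (\<phi> (i, j)))) \<le> (\<Sum>m<M2 * K. ?pe i m)"
          unfolding eq by (simp add: \<phi>_def)
      qed
      finally show ?thesis unfolding avg_err_def by (simp add: divide_right_mono)
    qed
    then have "has_code W q n M1 M2 \<epsilon>" using Ele unfolding has_code_def by (meson order_trans)
    then show ?case by (simp add: M1_def M2_def)
  qed
qed

text \<open>With a single message for the second user, the jointly typical codeword pairs themselves serve as
  the messages of the first user.\<close>

lemma typical_pairs_code:
  assumes rb: "rates_below q P s1 (max 0 (mi PX - \<sigma>))" and s0: "0 \<le> s1" and \<sigma>: "\<sigma> > 0" and \<epsilon>: "\<epsilon> > 0"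
  shows "\<forall>\<^sub>F n in sequentially. \<exists>V. 2 powr (real n * (s1 - 3 * \<sigma>)) \<le> real V \<and> has_code W q n V 1 \<epsilon>"
proof -
  define s2 where "s2 = max 0 (mi PX - \<sigma>)"
  define e where "e = \<epsilon> / 2"
  have e: "e > 0" using \<epsilon> by (simp add: e_def)
  obtain \<eta> where \<eta>: "\<eta> > 0" "\<eta> * density_norm \<le> \<sigma>" and as: "\<And>\<epsilon>. \<epsilon> > 0 \<Longrightarrow> \<forall>\<^sub>F n in sequentially.
     error_decay s1 s2 \<eta> \<epsilon> n"
    using expected_pair_err_asymptotic[OF rb s0, of \<sigma>] \<sigma> unfolding s2_def by auto
  \<comment> \<open>The constant is 16 * 4: 16 from two roundings of message numbers and the 1/4 in
    \<open>cover_prob\<close>, 4 from keeping a quarter of the expected number of typical pairs. Of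
    the loss \<open>3 * \<sigma>\<close>, this takes one share, the second codebook rate and
    typicality one each.\<close>
  have e1: "\<forall>\<^sub>F n in sequentially. 64 \<le> 2 powr (real n * \<sigma>)" using \<sigma> by real_asymp
  show ?thesis using as[OF e] e1
  proof eventually_elim
    case (elim n)
    note decay = elim(1)[unfolded error_decay_def]
    then have n: "n > 0" and Z: "coverable_mass \<eta> n \<ge> 1/2" by auto
    define N1 where "N1 = num_msgs n s1"
    define N2 where "N2 = num_msgs n s2"
    have s2: "s2 \<ge> 0" "s2 \<ge> mi PX - \<sigma>" by (auto simp: s2_def)
    have N: "N1 > 0" "N2 > 0" "real N1 \<le> 2 powr (real n * s1)" "real N2 \<le> 2 powr (real n * s2)"
      "2 powr (real n * s1) / 2 \<le> real N1" "2 powr (real n * s2) / 2 \<le> real N2"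
      unfolding N1_def N2_def using num_msgs_ge_half[OF s0] num_msgs_ge_half[OF s2(1)] s0 s2 by (auto intro: num_msgs_pos num_msgs_le_powr)
    have pl: "0 < cover_prob \<eta> n" by (rule cover_prob_pos)
    interpret rc: random_codebooks "coverable \<eta> n" "seqs n" "\<mu> \<eta> n" "iid P2 n" N1 N2
      by (rule random_codebooks_coverable[OF Z])
    let ?E = "\<lambda>g h. \<Sum>i<N1. \<Sum>m<N2. pair_err N1 N2 \<eta> n g h i m"
    let ?V = "\<lambda>g h. \<Sum>i<N1. \<Sum>m<N2. (of_bool (typical \<eta> n (g i) (h m)) :: real)"
    let ?N = "real N1 * real N2 * cover_prob \<eta> n"
    have Np: "?N > 0" using N pl by simp
    have EE: "rc.expct ?E \<le> e * ?N"
    proof -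
      have "rc.expct ?E = (\<Sum>i<N1. \<Sum>m<N2. rc.expct (\<lambda>g h. pair_err N1 N2 \<eta> n g h i m))"
        by (simp add: rc.expct_sum)
      also have "\<dots> \<le> (\<Sum>i<N1. \<Sum>m<N2. e * cover_prob \<eta> n / ((real n)\<^sup>2 + 2))"
        using decay N by (intro sum_mono) auto
      also have "\<dots> \<le> (\<Sum>i<N1. \<Sum>m<N2. e * cover_prob \<eta> n / 1)"
        using e pl by (intro sum_mono divide_left_mono) (auto simp: add_nonneg_pos)
      finally show ?thesis by (simp add: mult_ac)
    qed
    have EV: "?N \<le> rc.expct ?V"
    proof -
      have "cover_prob \<eta> n \<le> rc.expct (\<lambda>g h. of_bool (typical \<eta> n (g i) (h m)))" if "i < N1" "m < N2" for i m
      proof -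
        have "cover_prob \<eta> n = (\<Sum>a\<in>coverable \<eta> n. \<mu> \<eta> n a * cover_prob \<eta> n)" using rc.A by (simp flip: sum_distrib_right)
        also have "\<dots> \<le> (\<Sum>a\<in>coverable \<eta> n. \<mu> \<eta> n a * typical_mass \<eta> n a)"
          by (intro sum_mono mult_left_mono rc.\<mu>0) (auto simp: coverable_def)
        also have "\<dots> = rc.expct (\<lambda>g h. of_bool (typical \<eta> n (g i) (h m)))"
          by (subst rc.expct_11[OF that]) (simp only: sum_distrib_left mult.assoc)
        finally show ?thesis .
      qed
      then have "(\<Sum>i<N1. \<Sum>m<N2. cover_prob \<eta> n) \<le> (\<Sum>i<N1. \<Sum>m<N2. rc.expct (\<lambda>g h. of_bool (typical \<eta> n (g i) (h m))))"
        by (intro sum_mono) auto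
      also have "\<dots> = rc.expct ?V" by (simp only: rc.expct_sum)
      finally show ?thesis by (simp add: mult.assoc)
    qed
    \<comment> \<open>One codebook must have both many typical pairs and a small error relative to
      their number. A single linear combination yields both: below -N/4, where N is
      \<open>?N\<close>, it forces V >= N/4 and E <= 2 e V, as E is nonnegative.\<close>
    have "rc.expct (\<lambda>g h. 1 / (2 * e) * ?E g h + (- 1) * ?V g h) = 1 / (2 * e) * rc.expct ?E + (- 1) * rc.expct ?V"
      by (simp only: rc.expct_add rc.expct_cmult)
    also have "1 / (2 * e) * rc.expct ?E \<le> 1 / (2 * e) * (e * ?N)" using EE e by (intro mult_left_mono) auto
    also have "1 / (2 * e) * (e * ?N) = ?N / 2" using e by simp
    finally have "rc.expct (\<lambda>g h. 1 / (2 * e) * ?E g h + (- 1) * ?V g h) < - (?N / 4)" using EV Np by linarith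
    from rc.ex_codebook_le[OF this] obtain g h where gh: "1 / (2 * e) * ?E g h + (- 1) * ?V g h < - (?N / 4)" by blast
    have Epos: "?E g h \<ge> 0" by (intro sum_nonneg pair_err_nonneg)
    then have "1 / (2 * e) * ?E g h \<ge> 0" using e by simp
    then have Vge: "?N / 4 \<le> ?V g h" using gh by linarith
    have "1 / (2 * e) * ?E g h \<le> ?V g h" using gh Np by linarith
    then have EleV: "?E g h \<le> \<epsilon> * ?V g h" using e by (simp add: e_def field_simps)
    define S where "S = {(i, m) \<in> {..<N1} \<times> {..<N2}. typical \<eta> n (g i) (h m)}"
    have finS: "finite S" unfolding S_def by (rule finite_subset[of _ "{..<N1} \<times> {..<N2}"]) auto
    have VS: "?V g h = real (card S)"
    proof -
      have "S = {x \<in> {..<N1} \<times> {..<N2}. typical \<eta> n (g (fst x)) (h (snd x))}" by (auto simp: S_def)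
      then have "real (card S) = (\<Sum>x\<in>{x \<in> {..<N1} \<times> {..<N2}. typical \<eta> n (g (fst x)) (h (snd x))}. 1)" by simp
      also have "\<dots> = (\<Sum>x\<in>{..<N1} \<times> {..<N2}. if typical \<eta> n (g (fst x)) (h (snd x)) then 1 else 0)"
        by (rule sum.inter_filter) simp
      also have "\<dots> = ?V g h"
        unfolding sum.cartesian_product by (intro sum.cong) auto
      finally show ?thesis ..
    qed
    obtain b where b: "bij_betw b {..<card S} S"
      using ex_bij_betw_nat_finite[OF finS] by (auto simp: atLeast0LessThan)
    have bS: "b w \<in> S" if "w < card S" for w using bij_betwE[OF b] that by auto
    have Vpos: "real (card S) > 0" using Vge Np VS by linarith
    have "(\<Sum>i<card S. \<Sum>j<1. err_prob W q n (card S) 1 (\<lambda>w. g (fst (b w))) (\<lambda>w j. h (snd (b w))) i j)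
        \<le> (\<Sum>i<card S. \<Sum>j<(1::nat). pair_err N1 N2 \<eta> n g h (fst ((b \<circ> fst) (i, j))) (snd ((b \<circ> fst) (i, j))))"
    proof (intro sum_mono err_prob_le_pair_err)
      show "inj_on (b \<circ> fst) ({..<card S} \<times> {..<1::nat})"
        using bij_betw_imp_inj_on[OF b] by (auto simp: inj_on_def)
    qed (use bS in \<open>fastforce simp: S_def\<close>)+
    also have "\<dots> = (\<Sum>w<card S. (\<lambda>x. pair_err N1 N2 \<eta> n g h (fst x) (snd x)) (b w))" by simp
    also have "\<dots> = (\<Sum>x\<in>S. pair_err N1 N2 \<eta> n g h (fst x) (snd x))"
      by (rule sum.reindex_bij_betw[OF b])
    also have "\<dots> \<le> (\<Sum>x\<in>{..<N1} \<times> {..<N2}. pair_err N1 N2 \<eta> n g h (fst x) (snd x))"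
      by (rule sum_mono2) (auto simp: S_def intro: pair_err_nonneg)
    also have "\<dots> = ?E g h" by (simp add: sum.cartesian_product case_prod_beta')
    also note EleV
    finally have "avg_err W q n (card S) 1 (\<lambda>w. g (fst (b w))) (\<lambda>w j. h (snd (b w))) \<le> \<epsilon>"
      unfolding avg_err_def VS using Vpos by (simp add: divide_le_eq)
    then have code: "has_code W q n (card S) 1 \<epsilon>" by (auto simp: has_code_def)
    have "2 powr (real n * (s1 - 3 * \<sigma>)) * 64 \<le> 2 powr (real n * (s1 - 3 * \<sigma>)) * 2 powr (real n * \<sigma>)"
      using elim(2) by (intro mult_left_mono) auto
    also have "\<dots> = 2 powr (real n * s1 + real n * (mi PX - \<sigma>) + - (real n * (mi PX + \<sigma>)))"
      unfolding powr_add[symmetric] by (simp add: algebra_simps)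
    also have "\<dots> \<le> 2 powr (real n * s1 + real n * s2 + - (real n * (mi PX + \<eta> * density_norm)))"
    proof (intro powr_mono add_mono)
      show "- (real n * (mi PX + \<sigma>)) \<le> - (real n * (mi PX + \<eta> * density_norm))"
        using \<eta>(2) by (simp add: mult_left_mono)
    qed (use s2 in \<open>auto intro: mult_left_mono\<close>)
    also have "\<dots> = (2 powr (real n * s1) / 2) * (2 powr (real n * s2) / 2) * cover_prob \<eta> n * 16"
      unfolding powr_add cover_prob_def by simp
    also have "\<dots> \<le> real N1 * real N2 * cover_prob \<eta> n * 16"
      using N pl by (intro mult_right_mono mult_mono) auto
    also have "\<dots> \<le> real (card S) * 64" using Vge VS by linarith
    finally have "2 powr (real n * (s1 - 3 * \<sigma>)) \<le> real (card S)" by simp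
    then show ?case using code by blast
  qed
qed

end

subsection \<open>The binning region\<close>

text \<open>An infimum of reals lies below its members only for sets bounded below; compactness of
  the simplex provides this. The two functions need to agree only on \<open>S\<close>, where the
  entropy formulas are valid.\<close>

lemma INF_le_continuous:
  fixes \<Psi> :: "('w::finite \<Rightarrow> real) \<Rightarrow> real"
  assumes cont: "continuous_on {f. is_pmf f} \<Psi>" and S: "S \<subseteq> {f. is_pmf f}"
    and eq: "\<And>f. f \<in> S \<Longrightarrow> \<Phi> f = \<Psi> f" and f: "f \<in> S"
  shows "(INF f\<in>S. \<Phi> f) \<le> \<Psi> f"
proof -
  have "bounded (\<Psi> ` {f. is_pmf f})"
    by (intro compact_imp_bounded compact_continuous_image cont compact_pmf)
  then have "bdd_below (\<Psi> ` {f. is_pmf f})" by (rule bounded_imp_bdd_below)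
  then have "bdd_below (\<Psi> ` S)" by (rule bdd_below_mono) (use S in auto)
  moreover have "\<Phi> ` S = \<Psi> ` S" using eq by (auto simp: image_def)
  ultimately show ?thesis using f by (simp add: cINF_lower)
qed

lemma has_code_trivial:
  shows "has_code W q n 1 1 0"
  by (simp add: has_code_def avg_err_def err_prob_def decodes_correctly_def)

context cognitive_mac
begin

text \<open>Competing laws keep the input marginal, so I(X1;X2) can be expressed in the entropies of
  \<open>f\<close> itself.\<close>

lemma mi_PX_Gq:
  assumes "f \<in> Gq q P"
  shows "mi PX = HX1 f + HX2 f - HX1X2 f"
proof -
  have m: "marg f pX1X2 = PX" using assms by (simp add: Gq_iff marg_P)
  have "marg PX fst = marg f (\<lambda>(x1, x2, y). x1)" "marg PX snd = marg f (\<lambda>(x1, x2, y). x2)"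
    unfolding m[symmetric] marg_marg by (simp_all add: case_prod_beta')
  then show ?thesis using mi_ent[of PX] PX0 m by simp
qed

lemma Gq_pmf: "f \<in> Gq q P \<Longrightarrow> is_pmf f" by (simp add: Gq_iff)

lemma pmf_nonneg: "is_pmf f \<Longrightarrow> 0 \<le> f w" unfolding is_pmf_def by blast

lemma R1'_le:
  assumes "f \<in> L1 q P" shows "R1' q P \<le> HX1 f + HX2Y f - ent f"
  unfolding R1'_def
proof (rule INF_le_continuous[OF _ _ _ assms])
  show "I_X1_YX2 f = HX1 f + HX2Y f - ent f" if "f \<in> L1 q P" for f
  proof -
    have "is_pmf f" using that by (simp add: L1_def Gq_pmf)
    then show ?thesis by (intro information_ent pmf_nonneg)
  qed
qed (auto simp: L1_def Gq_pmf intro!: continuous_on_add continuous_on_diff continuous_on_ent_marg continuous_on_ent)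

lemma R2'_le:
  assumes "f \<in> L2 q P" shows "R2' q P \<le> HX1X2 f + HX1Y f - ent f - HX1 f"
  unfolding R2'_def
proof (rule INF_le_continuous[OF _ _ _ assms])
  show "I_X2_Y_given_X1 f = HX1X2 f + HX1Y f - ent f - HX1 f" if "f \<in> L2 q P" for f
  proof -
    have "is_pmf f" using that by (simp add: L2_def Gq_pmf)
    then show ?thesis by (intro information_ent pmf_nonneg)
  qed
qed (auto simp: L2_def Gq_pmf intro!: continuous_on_add continuous_on_diff continuous_on_ent_marg continuous_on_ent)

lemma R1''_le:
  assumes "f \<in> L0 q P"
  shows "R1'' q P r \<le> HX1 f + HY f - HX1Y f + max 0 (HX1X2 f + HX1Y f - ent f - HX1 f - r)"
  unfolding R1''_def
proof (rule INF_le_continuous[OF _ _ _ assms])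
  show "I_X1_Y f + max 0 (I_X2_Y_given_X1 f - r) = HX1 f + HY f - HX1Y f + max 0 (HX1X2 f + HX1Y f - ent f - HX1 f - r)"
    if "f \<in> L0 q P" for f
  proof -
    have "is_pmf f" using that by (simp add: L0_def Gq_pmf)
    then have "0 \<le> f w" for w by (rule pmf_nonneg)
    note info = information_ent[OF this]
    show ?thesis unfolding info ..
  qed
qed (auto simp: L0_def Gq_pmf intro!: continuous_on_add continuous_on_diff continuous_on_max continuous_on_const continuous_on_ent_marg continuous_on_ent)

lemma R2''_le:
  assumes "f \<in> L0 q P"
  shows "R2'' q P r \<le> HX2 f + HY f - HX2Y f - (HX2 f + HX1 f - HX1X2 f) + max 0 (HX1 f + HX2Y f - ent f - r)"
  unfolding R2''_def
proof (rule INF_le_continuous[OF _ _ _ assms])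
  show "I_X2_Y f - I_X2_X1 f + max 0 (I_X1_YX2 f - r) =
     HX2 f + HY f - HX2Y f - (HX2 f + HX1 f - HX1X2 f) + max 0 (HX1 f + HX2Y f - ent f - r)"
    if "f \<in> L0 q P" for f
  proof -
    have "is_pmf f" using that by (simp add: L0_def Gq_pmf)
    then have "0 \<le> f w" for w by (rule pmf_nonneg)
    note info = information_ent[OF this]
    show ?thesis unfolding info ..
  qed
qed (auto simp: L0_def Gq_pmf intro!: continuous_on_add continuous_on_diff continuous_on_max continuous_on_const continuous_on_ent_marg continuous_on_ent)

text \<open>The two alternatives of the binning region merge into one pointwise condition: for every
  competing law \<open>f\<close> it suffices that one of three union bounds decays.\<close>

lemma rates_below_binning:
  assumes R: "r1 \<le> R1' q P" "r2 \<le> R2' q P" "r1 \<le> R1'' q P r2 \<or> r2 \<le> R2'' q P r1"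
    and s: "s1 > 0 \<Longrightarrow> s1 < r1" "s2 > 0 \<Longrightarrow> s2 < r2 + mi PX"
  shows "rates_below q P s1 s2"
  unfolding rates_below_def
proof (intro conjI impI ballI)
  fix f assume "s1 > 0" "f \<in> L1 q P"
  then show "s1 < HX1 f + HX2Y f - ent f" using R1'_le[of f] R s by linarith
next
  fix f assume h: "s2 > 0" "f \<in> L2 q P"
  then have "f \<in> Gq q P" by (simp add: L2_def)
  \<comment> \<open>The binning overhead turns I(X2;Y|X1) into I(X2;X1,Y).\<close>
  then show "s2 < HX2 f + HX1Y f - ent f" using R2'_le[OF h(2)] R s(2)[OF h(1)] mi_PX_Gq[of f] by linarith
next
  fix f assume h: "s1 > 0" "s2 > 0" "f \<in> L0 q P"
  then have "f \<in> Gq q P" by (simp add: L0_def)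
  note mi = mi_PX_Gq[OF this]
  show "s1 + s2 < HX1 f + HX2 f + HY f - ent f \<or> s2 < HX2 f + HY f - HX2Y f \<or> s1 < HX1 f + HY f - HX1Y f"
    using R(3)
  proof
    assume "r1 \<le> R1'' q P r2"
    then have "r1 \<le> HX1 f + HY f - HX1Y f + max 0 (HX1X2 f + HX1Y f - ent f - HX1 f - r2)"
      using R1''_le[OF h(3), of r2] by linarith
    \<comment> \<open>If the positive part is 0, the bound reads r1 <= I(X1;Y). Otherwise, adding r2
      and I(X1;X2) to both sides yields the total correlation. The other alternative is symmetric,
      with I(X2;Y).\<close>
    then show ?thesis using s(1)[OF h(1)] s(2)[OF h(2)] mi by (auto simp: max_def split: if_splits)
  next
    assume "r2 \<le> R2'' q P r1"
    then have "r2 \<le> HX2 f + HY f - HX2Y f - (HX2 f + HX1 f - HX1X2 f) + max 0 (HX1 f + HX2Y f - ent f - r1)"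
      using R2''_le[OF h(3), of r1] by linarith
    then show ?thesis using s(1)[OF h(1)] s(2)[OF h(2)] mi by (auto simp: max_def split: if_splits)
  qed
qed

lemma Rbin_star_rate_ok: "Rbin_star q P \<subseteq> {R. rate_ok W q R}"
proof (clarsimp simp: Rbin_star_def)
  fix R2 ra rb
  assume h: "0 \<le> R2" "0 \<le> ra" "0 \<le> rb" "ra \<le> R1' q P" "rb + R2 \<le> R2' q P"
    "ra \<le> R1'' q P (rb + R2) \<or> rb + R2 \<le> R2'' q P ra"
  define rt where "rt = rb + R2"
  have rt0: "rt \<ge> 0" using h by (simp add: rt_def)
  note below = rates_below_binning[OF h(4-6), folded rt_def]
  show "rate_ok W q (ra + rb, R2)"
    unfolding rate_ok_def fst_conv snd_conv
  proof (intro conjI allI impI)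
    fix \<epsilon> :: real assume \<epsilon>: "\<epsilon> > 0"
    show "\<forall>\<^sub>F n in sequentially. \<exists>M1 M2. 2 powr (real n * (ra + rb - \<epsilon>)) \<le> real M1 \<and>
        2 powr (real n * (R2 - \<epsilon>)) \<le> real M2 \<and> has_code W q n M1 M2 \<epsilon>"
    proof (cases "rt = 0")
      \<comment> \<open>Covering would need a second codebook of rate above I(X1;X2), while the
        available bounds require a rate strictly below it.\<close>
      case True
      then have z: "rb = 0" "R2 = 0" using h by (auto simp: rt_def)
      have le1: "2 powr (real n * (0 - \<epsilon>)) \<le> real 1" for n
        using \<epsilon> powr_mono[of "real n * (0 - \<epsilon>)" 0 2] by simp
      show ?thesis
      proof (cases "ra = 0")
        case True
        have "has_code W q n 1 1 \<epsilon>" for n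
          by (rule has_code_mono[OF has_code_trivial]) (use \<epsilon> in simp)
        then show ?thesis using le1 z True by (intro always_eventually allI exI[of _ "1 :: nat"]) auto
      next
        case False
        \<comment> \<open>One \<open>\<sigma>\<close> is given up here and three by the code itself,
          in total at most \<open>\<epsilon>\<close>; the bound \<open>ra / 2\<close> keeps the rate
          positive.\<close>
        define \<sigma> where "\<sigma> = min (\<epsilon> / 4) (ra / 2)"
        have \<sigma>: "\<sigma> > 0" "4 * \<sigma> \<le> \<epsilon>" "\<sigma> < ra" using \<epsilon> False h by (auto simp: \<sigma>_def)
        have rb: "rates_below q P (ra - \<sigma>) (max 0 (mi PX - \<sigma>))"
          by (rule below) (use \<sigma> True in auto)
        have "ra - \<sigma> \<ge> 0" using \<sigma> by simp
        from typical_pairs_code[OF rb this \<sigma>(1) \<epsilon>] show ?thesis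
        proof eventually_elim
          case (elim n)
          then obtain V where V: "2 powr (real n * (ra - \<sigma> - 3 * \<sigma>)) \<le> real V" "has_code W q n V 1 \<epsilon>" by blast
          have "2 powr (real n * (ra - \<epsilon>)) \<le> 2 powr (real n * (ra - \<sigma> - 3 * \<sigma>))"
            using \<sigma> by (intro powr_mono mult_left_mono) auto
          then have "2 powr (real n * (ra - \<epsilon>)) \<le> real V" using V(1) by (rule order_trans)
          then show ?case using V(2) le1[of n] z by (intro exI[of _ V] exI[of _ "1 :: nat"]) auto
        qed
      qed
    next
      case False
      \<comment> \<open>Three losses of \<open>\<delta>\<close> add up for the first user: one in
        each part of the rate and one for rounding. The bound by \<open>rt\<close> keeps
        \<open>rt - \<delta>\<close> nonnegative, and \<open>\<delta> / 2\<close> of the rate given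
        up is the covering slack.\<close>
      define \<delta> where "\<delta> = min (\<epsilon> / 3) rt"
      have \<delta>: "\<delta> > 0" "3 * \<delta> \<le> \<epsilon>" "\<delta> \<le> rt" using \<epsilon> False rt0 by (auto simp: \<delta>_def)
      define s1 where "s1 = max 0 (ra - \<delta>)"
      have rb: "rates_below q P s1 ((rt - \<delta>) + mi PX + \<delta> / 2)"
        by (rule below) (use \<delta> in \<open>auto simp: s1_def split: if_splits\<close>)
      have s0: "0 \<le> s1" "0 \<le> rt - \<delta>" "0 < \<delta> / 2" using \<delta> by (auto simp: s1_def)
      \<comment> \<open>Truncation does no harm: since \<open>\<delta> \<le> rt\<close>, the sum of
        the two truncated rates is at most \<open>rt - \<delta>\<close> in every case.\<close>
      define m1 where "m1 = max 0 (rb - \<delta>)"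
      define m2 where "m2 = max 0 (R2 - \<delta>)"
      have m: "0 \<le> m1" "0 \<le> m2" "m1 + m2 \<le> rt - \<delta>" using h \<delta> by (auto simp: m1_def m2_def rt_def max_def)
      have e1: "\<forall>\<^sub>F n in sequentially. 4 \<le> 2 powr (real n * \<delta>)" using \<delta>(1) by real_asymp
      show ?thesis using covering_code[OF rb s0 \<epsilon>] e1
      proof eventually_elim
        case (elim n)
        define Ma where "Ma = num_msgs n s1"
        define Mb where "Mb = num_msgs n m1"
        define M2 where "M2 = num_msgs n m2"
        have pos: "0 < Ma" "0 < Mb" "0 < M2" using s0 m by (auto simp: Ma_def Mb_def M2_def intro: num_msgs_pos)
        have ge: "2 powr (real n * s1) / 2 \<le> real Ma" "2 powr (real n * m1) / 2 \<le> real Mb" "2 powr (real n * m2) / 2 \<le> real M2"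
          unfolding Ma_def Mb_def M2_def by (intro num_msgs_ge_half s0 m)+
        have "real (Mb * M2) \<le> 2 powr (real n * m1) * 2 powr (real n * m2)"
          unfolding Mb_def M2_def of_nat_mult by (intro mult_mono num_msgs_le_powr) auto
        also have "\<dots> = 2 powr (real n * (m1 + m2))" by (simp add: powr_add[symmetric] distrib_left)
        also have "\<dots> \<le> 2 powr (real n * (rt - \<delta>))" using m by (intro powr_mono mult_left_mono) auto
        finally have "Mb * M2 \<le> num_msgs n (rt - \<delta>)" by (rule le_num_msgs)
        then have "has_code W q n Ma (Mb * M2) \<epsilon>"
          using pos by (intro has_code_subcode[OF W elim(1)]) (auto simp: Ma_def)
        then have code: "has_code W q n (Ma * Mb) M2 \<epsilon>" by (rule has_code_split[OF W])
        have "2 powr (real n * (ra + rb - \<epsilon>)) * 4 \<le> 2 powr (real n * (ra + rb - \<epsilon>)) * 2 powr (real n * \<delta>)"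
          using elim(2) by (intro mult_left_mono) auto
        also have "\<dots> = 2 powr (real n * (ra + rb - \<epsilon> + \<delta>))" by (simp add: powr_add[symmetric] distrib_left)
        also have "\<dots> \<le> 2 powr (real n * (s1 + m1))"
          using \<delta> by (intro powr_mono mult_left_mono) (auto simp: s1_def m1_def)
        also have "\<dots> = (2 powr (real n * s1) / 2) * (2 powr (real n * m1) / 2) * 4"
          by (simp add: powr_add distrib_left)
        also have "\<dots> \<le> real Ma * real Mb * 4" using ge by (intro mult_right_mono mult_mono) auto
        finally have r1: "2 powr (real n * (ra + rb - \<epsilon>)) \<le> real (Ma * Mb)" by simp
        have "2 powr (real n * (R2 - \<epsilon>)) * 4 \<le> 2 powr (real n * (R2 - \<epsilon>)) * 2 powr (real n * \<delta>)"
          using elim(2) by (intro mult_left_mono) auto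
        also have "\<dots> = 2 powr (real n * (R2 - \<epsilon> + \<delta>))" by (simp add: powr_add[symmetric] distrib_left)
        also have "\<dots> \<le> 2 powr (real n * m2)"
          using \<delta> by (intro powr_mono mult_left_mono) (auto simp: m2_def)
        also have "\<dots> \<le> real M2 * 4" using ge by linarith
        finally have r2: "2 powr (real n * (R2 - \<epsilon>)) \<le> real M2" by simp
        show ?case using r1 r2 code by blast
      qed
    qed
  qed (use h in auto)
qed

end

theorem theorem6:
  fixes W :: "'a::finite \<Rightarrow> 'b::finite \<Rightarrow> 'c::finite \<Rightarrow> real"
    and q :: "'a \<Rightarrow> 'b \<Rightarrow> 'c \<Rightarrow> real"
  assumes "is_channel W"
  shows "Rbin_cog W q \<subseteq> capacity_region W q"
proof -
  have "Rbin_star q Q \<subseteq> {R. rate_ok W q R}" if Q: "Q \<in> channel_dists W" for Q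
  proof -
    obtain PX where pmf: "is_pmf PX" and Q_eq: "Q = (\<lambda>(x1, x2, y). PX (x1, x2) * W x1 x2 y)"
      using Q unfolding channel_dists_def by blast
    interpret cognitive_mac W q PX by unfold_locales (use assms pmf in auto)
    show ?thesis using Rbin_star_rate_ok by (simp add: Q_eq P_def)
  qed
  then have "convex hull (\<Union>Q\<in>channel_dists W. Rbin_star q Q) \<subseteq> {R. rate_ok W q R}"
    by (intro hull_minimal rate_ok_convex assms) auto
  also have "\<dots> \<subseteq> closure {R. achievable W q R}" using rate_ok_in_closure[OF assms] by auto
  finally have "closure (convex hull (\<Union>Q\<in>channel_dists W. Rbin_star q Q)) \<subseteq> closure {R. achievable W q R}"
    by (rule closure_minimal) simp
  then show ?thesis by (simp add: Rbin_cog_def capacity_region_def)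
qed

end
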